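(* Let $n\geq 2$ be an integer and let $k$ be a field containing a primitive $n$-th root of unity $q$. Let $H_n(q)$ be the Taft algebra over $k$ and let $r(H_n(q))$ be its Green ring. Define polynomials $f_m(y,z)\in\mathbb{Z}[y,z]$, $m\geq 1$, recursively by $$f_1(y,z)=1,\quad f_2(y,z)=z,\quad f_m(y,z)=z f_{m-1}(y,z)-y f_{m-2}(y,z)\ \text{ for } m\geq 3,$$ and let $I$ be the ideal of $\mathbb{Z}[y,z]$ generated by $y^n-1$ and $(z-y-1)f_n(y,z)$. Then the ring $r(H_n(q))$ is isomorphic to the quotient ring $\mathbb{Z}[y,z]/I$.
   Context: The Taft algebra $H_n(q)$ is the $k$-algebra generated by $g,h$ subject to $g^n=1$, $h^n=0$, $hg=qgh$. It is a Hopf algebra of dimension $n^2$ with comultiplication $\Delta(g)=g\otimes g$, $\Delta(h)=1\otimes h+h\otimes g$, counit $\varepsilon(g)=1$, $\varepsilon(h)=0$, and antipode $S(g)=g^{-1}$, $S(h)=-q^{-1}g^{n-1}h$. All modules are finite-dimensional left modules. The tensor product $M\otimes N=M\otimes_k N$ of two modules over a Hopf algebra is a module via $\Delta$. For a Hopf algebra $H$, the Green ring (representation ring) $r(H)$ is the abelian group generated by the isomorphism classes $[V]$ of finite-dimensional $H$-modules $V$ modulo the relations $[M\oplus V]=[M]+[V]$, with multiplication $[M][V]=[M\otimes V]$; its identity is the class of the trivial module. *)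

theory Defs
  imports
    "HOL-Library.Poly_Mapping"
    "HOL-Library.Product_Plus"
    "HOL-Algebra.QuotRing"
    "HOL-Algebra.Algebraic_Closure_Type"
    "HOL-Computational_Algebra.Polynomial"
    "Jordan_Normal_Form.Matrix"
begin

section \<open>The Taft algebra\<close>

text \<open>The free monoid on two letters is written additively, because the convolution product of
  \<^typ>\<open>'a \<Rightarrow>\<^sub>0 'k\<close> needs a \<^class>\<open>monoid_add\<close> on its index type. With it,
  the finitely supported functions on words are the free algebra \<open>F = k\<langle>g,h\<rangle>\<close>, and those on pairs of words
  (with the componentwise monoid structure) are \<open>F \<otimes> F\<close>, the pair \<open>(u, v)\<close> standing for
  \<open>u \<otimes> v\<close>. In both algebras the scalar \<open>c\<close> is \<open>Poly_Mapping.single 0 c\<close>.\<close>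

datatype taft_gen = GenG | GenH

datatype word = Word "taft_gen list"

instantiation word :: monoid_add
begin

definition zero_word :: word where
  "zero_word = Word []"

fun plus_word :: "word \<Rightarrow> word \<Rightarrow> word" where
  "plus_word (Word xs) (Word ys) = Word (xs @ ys)"

instance
proof
  fix a b c :: word
  show "a + b + c = a + (b + c)" by (cases a; cases b; cases c) simp
  show "0 + a = a" by (cases a) (simp add: zero_word_def)
  show "a + 0 = a" by (cases a) (simp add: zero_word_def)
qed

end

type_synonym 'k free_alg = "word \<Rightarrow>\<^sub>0 'k"
type_synonym 'k free_alg2 = "word \<times> word \<Rightarrow>\<^sub>0 'k"

abbreviation free_gen :: "taft_gen \<Rightarrow> 'k::field free_alg" where
  "free_gen x \<equiv> Poly_Mapping.single (Word [x]) 1"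

definition taft_relators :: "nat \<Rightarrow> 'k::field \<Rightarrow> 'k free_alg set" where
  "taft_relators n q =
    {free_gen GenG ^ n - 1,
     free_gen GenH ^ n,
     free_gen GenH * free_gen GenG - Poly_Mapping.single 0 q * free_gen GenG * free_gen GenH}"

definition taft_ideal :: "nat \<Rightarrow> 'k::field \<Rightarrow> 'k free_alg set" where
  "taft_ideal n q = Idl\<^bsub>ring_of_type_algebra\<^esub> (taft_relators n q)"

definition taft_algebra :: "nat \<Rightarrow> 'k::field \<Rightarrow> 'k free_alg set ring" where
  "taft_algebra n q = ring_of_type_algebra Quot taft_ideal n q"

definition taft_class :: "nat \<Rightarrow> 'k::field \<Rightarrow> 'k free_alg \<Rightarrow> 'k free_alg set" where
  "taft_class n q a = taft_ideal n q +>\<^bsub>ring_of_type_algebra\<^esub> a"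

text \<open>The structure map of the \<open>k\<close>-algebra \<open>H\<^sub>n(q)\<close>.\<close>

definition taft_scalar :: "nat \<Rightarrow> 'k::field \<Rightarrow> 'k \<Rightarrow> 'k free_alg set" where
  "taft_scalar n q c = taft_class n q (Poly_Mapping.single 0 c)"


subsection \<open>Comultiplication and counit\<close>

text \<open>\<open>H \<otimes> H\<close> for \<open>H = F/J\<close> is \<open>(F \<otimes> F)/(J \<otimes> F + F \<otimes> J)\<close>.\<close>

definition left_leg :: "'k::field free_alg \<Rightarrow> 'k free_alg2" where
  "left_leg a = (\<Sum>u\<in>Poly_Mapping.keys a. Poly_Mapping.single (u, 0) (Poly_Mapping.lookup a u))"

definition right_leg :: "'k::field free_alg \<Rightarrow> 'k free_alg2" where
  "right_leg a = (\<Sum>u\<in>Poly_Mapping.keys a. Poly_Mapping.single (0, u) (Poly_Mapping.lookup a u))"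

definition taft_tensor_ideal :: "nat \<Rightarrow> 'k::field \<Rightarrow> 'k free_alg2 set" where
  "taft_tensor_ideal n q =
    Idl\<^bsub>ring_of_type_algebra\<^esub> (left_leg ` taft_ideal n q \<union> right_leg ` taft_ideal n q)"

definition taft_tensor_square :: "nat \<Rightarrow> 'k::field \<Rightarrow> 'k free_alg2 set ring" where
  "taft_tensor_square n q = ring_of_type_algebra Quot taft_tensor_ideal n q"

text \<open>The structure maps are first defined on \<open>F\<close> as the algebra homomorphisms with the prescribed
  values on the generators; they descend to \<open>H\<^sub>n(q)\<close> when \<open>q\<close> is a primitive \<open>n\<close>-th root of unity.\<close>

fun comult_gen :: "taft_gen \<Rightarrow> 'k::field free_alg2" where
  "comult_gen GenG = Poly_Mapping.single (Word [GenG], Word [GenG]) 1"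
| "comult_gen GenH =
    Poly_Mapping.single (0, Word [GenH]) 1 + Poly_Mapping.single (Word [GenH], Word [GenG]) 1"

fun comult_word :: "word \<Rightarrow> 'k::field free_alg2" where
  "comult_word (Word xs) = prod_list (map comult_gen xs)"

definition free_comult :: "'k::field free_alg \<Rightarrow> 'k free_alg2" where
  "free_comult a =
    (\<Sum>w\<in>Poly_Mapping.keys a. Poly_Mapping.single 0 (Poly_Mapping.lookup a w) * comult_word w)"

definition taft_comult :: "nat \<Rightarrow> 'k::field \<Rightarrow> 'k free_alg set \<Rightarrow> 'k free_alg2 set" where
  "taft_comult n q x = (\<Union>a\<in>x. taft_tensor_ideal n q +>\<^bsub>ring_of_type_algebra\<^esub> free_comult a)"

fun counit_gen :: "taft_gen \<Rightarrow> 'k::field" where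
  "counit_gen GenG = 1"
| "counit_gen GenH = 0"

fun counit_word :: "word \<Rightarrow> 'k::field" where
  "counit_word (Word xs) = prod_list (map counit_gen xs)"

definition free_counit :: "'k::field free_alg \<Rightarrow> 'k" where
  "free_counit a = (\<Sum>w\<in>Poly_Mapping.keys a. Poly_Mapping.lookup a w * counit_word w)"

definition taft_counit :: "'k::field free_alg set \<Rightarrow> 'k" where
  "taft_counit x = the_elem (free_counit ` x)"


section \<open>Finite-dimensional modules over a \<open>k\<close>-algebra\<close>

text \<open>A finite-dimensional left module over an algebra \<open>A\<close> with structure map \<open>\<iota> :: k \<rightarrow> A\<close> is given on
  the coordinate space \<open>k\<^sup>d\<close> (column vectors) by an algebra homomorphism from \<open>A\<close> to the \<open>d\<close> by \<open>d\<close>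
  matrices. Every finite-dimensional module is isomorphic to one of these
  (lemma \<open>fd_module_coordinates\<close> below), so the isomorphism classes are all accounted for.\<close>

type_synonym ('a, 'k) fd_module = "nat \<times> ('a \<Rightarrow> 'k mat)"

definition fd_modules :: "('a, 'b) ring_scheme \<Rightarrow> ('k::field \<Rightarrow> 'a) \<Rightarrow> ('a, 'k) fd_module set" where
  "fd_modules A \<iota> =
    {(d, \<rho>). \<rho> \<in> Ring.ring_hom A (ring_mat TYPE('k) d ()) \<and> (\<forall>c. \<rho> (\<iota> c) = c \<cdot>\<^sub>m 1\<^sub>m d)}"

lemma fd_module_coordinates:
  fixes A :: "('a, 'b) ring_scheme" and \<iota> :: "'k::field \<Rightarrow> 'a"
    and scale :: "'k \<Rightarrow> 'v::ab_group_add \<Rightarrow> 'v" and act :: "'a \<Rightarrow> 'v \<Rightarrow> 'v"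
  assumes vs: "vector_space scale" and "finite S" and "module.span scale S = UNIV"
    and act_add_right: "\<And>x u v. x \<in> carrier A \<Longrightarrow> act x (u + v) = act x u + act x v"
    and act_scale_right: "\<And>x c v. x \<in> carrier A \<Longrightarrow> act x (scale c v) = scale c (act x v)"
    and act_add: "\<And>x y v. \<lbrakk>x \<in> carrier A; y \<in> carrier A\<rbrakk> \<Longrightarrow> act (x \<oplus>\<^bsub>A\<^esub> y) v = act x v + act y v"
    and act_mult: "\<And>x y v. \<lbrakk>x \<in> carrier A; y \<in> carrier A\<rbrakk> \<Longrightarrow> act (x \<otimes>\<^bsub>A\<^esub> y) v = act x (act y v)"
    and act_one: "\<And>v. act \<one>\<^bsub>A\<^esub> v = v"
    and act_scalar: "\<And>c v. act (\<iota> c) v = scale c v"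
  obtains d \<rho> \<phi> where "(d, \<rho>) \<in> fd_modules A \<iota>" and "bij_betw \<phi> UNIV (carrier_vec d)"
    and "\<And>u v. \<phi> (u + v) = \<phi> u + \<phi> v" and "\<And>c v. \<phi> (scale c v) = c \<cdot>\<^sub>v \<phi> v"
    and "\<And>x v. x \<in> carrier A \<Longrightarrow> \<phi> (act x v) = \<rho> x *\<^sub>v \<phi> v"
proof -
  interpret V: vector_space scale by (rule vs)
  obtain B where B: "B \<subseteq> S" "V.independent B" "S \<subseteq> V.span B"
    using V.maximal_independent_subset[of S] by blast
  have finB: "finite B" using B(1) \<open>finite S\<close> finite_subset by blast
  have spanB: "V.span B = UNIV"
    using B(3) assms(3) V.span_minimal[OF B(3) V.subspace_span] by blast
  define d where "d = card B"
  obtain b where b: "bij_betw b {0..<d} B"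
    using ex_bij_betw_nat_finite[OF finB] unfolding d_def by blast
  have bB: "b j \<in> B" if "j < d" for j using b that unfolding bij_betw_def by auto
  have binj: "b i = b j \<longleftrightarrow> i = j" if "i < d" "j < d" for i j
    using b that unfolding bij_betw_def inj_on_def by auto
  define R where "R v i = V.representation B v (b i)" for v i
  have R_add: "R (u + v) i = R u i + R v i" for u v i
    unfolding R_def using V.representation_add[OF B(2)] spanB by simp
  have R_scale: "R (scale c v) i = c * R v i" for c v i
    unfolding R_def using V.representation_scale[OF B(2)] spanB by simp
  have R_b: "R (b j) i = (if i = j then 1 else 0)" if "i < d" "j < d" for i j
    unfolding R_def using V.representation_basis[OF B(2) bB[OF that(2)]] binj[OF that] by auto
  have R_sum: "v = (\<Sum>j\<in>{0..<d}. scale (R v j) (b j))" for v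
  proof -
    have "(\<Sum>w\<in>B. scale (V.representation B v w) w) = v"
      using V.sum_representation_eq[OF B(2) _ finB order_refl] spanB by simp
    then show ?thesis
      unfolding R_def sum.reindex_bij_betw[OF b, of "\<lambda>w. scale (V.representation B v w) w"] by simp
  qed
  have R_sum_distrib: "R (sum f J) i = (\<Sum>j\<in>J. R (f j) i)" for f and J :: "nat set" and i
  proof (induction J rule: infinite_finite_induct)
    case (insert j J)
    then show ?case by (simp add: R_add)
  qed (use R_scale[of 0 0 i] in simp_all)
  have act0: "act x 0 = 0" if "x \<in> carrier A" for x
    using act_scale_right[OF that, of 0 0] by simp
  have act_sum: "act x (sum f J) = (\<Sum>j\<in>J. act x (f j))" if "x \<in> carrier A"
    for x f and J :: "nat set"
  proof (induction J rule: infinite_finite_induct)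
    case (insert j J)
    then show ?case by (simp add: act_add_right[OF that])
  qed (simp_all add: act0[OF that])
  define \<phi> where "\<phi> v = vec d (R v)" for v
  define \<rho> where "\<rho> x = mat d d (\<lambda>(i, j). R (act x (b j)) i)" for x
  have act_R: "R (act x v) i = (\<Sum>j\<in>{0..<d}. R (act x (b j)) i * R v j)" if "x \<in> carrier A" for x v i
  proof -
    have "act x v = act x (\<Sum>j\<in>{0..<d}. scale (R v j) (b j))" using R_sum[of v] by simp
    also have "\<dots> = (\<Sum>j\<in>{0..<d}. scale (R v j) (act x (b j)))"
      by (simp add: act_sum[OF that] act_scale_right[OF that])
    finally show ?thesis by (simp add: R_sum_distrib R_scale mult.commute)
  qed
  have "\<rho> \<in> Ring.ring_hom A (ring_mat TYPE('k) d ())"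
  proof (rule Ring.ring_hom_memI; unfold ring_mat_simps)
    show "\<rho> x \<in> carrier_mat d d" for x by (simp add: \<rho>_def)
    show "\<rho> (x \<oplus>\<^bsub>A\<^esub> y) = \<rho> x + \<rho> y" if "x \<in> carrier A" "y \<in> carrier A" for x y
      by (rule eq_matI) (simp_all add: \<rho>_def act_add[OF that] R_add)
    show "\<rho> \<one>\<^bsub>A\<^esub> = 1\<^sub>m d"
      by (rule eq_matI) (simp_all add: \<rho>_def act_one R_b)
    show "\<rho> (x \<otimes>\<^bsub>A\<^esub> y) = \<rho> x * \<rho> y" if "x \<in> carrier A" "y \<in> carrier A" for x y
    proof (rule eq_matI)
      fix i j assume "i < dim_row (\<rho> x * \<rho> y)" "j < dim_col (\<rho> x * \<rho> y)"
      then have ij: "i < d" "j < d" by (simp_all add: \<rho>_def)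
      show "\<rho> (x \<otimes>\<^bsub>A\<^esub> y) $$ (i, j) = (\<rho> x * \<rho> y) $$ (i, j)"
        using ij by (simp add: \<rho>_def act_mult[OF that] act_R[OF that(1), of "act y (b j)"] scalar_prod_def)
    qed (simp_all add: \<rho>_def)
  qed
  moreover have "\<rho> (\<iota> c) = c \<cdot>\<^sub>m 1\<^sub>m d" for c
    by (rule eq_matI) (simp_all add: \<rho>_def act_scalar R_scale R_b)
  ultimately have "(d, \<rho>) \<in> fd_modules A \<iota>" by (simp add: fd_modules_def)
  moreover have "bij_betw \<phi> UNIV (carrier_vec d)"
  proof (rule bij_betwI[where g = "\<lambda>w :: 'k vec. \<Sum>j\<in>{0..<d}. scale (w $ j) (b j)"])
    show "(\<Sum>j\<in>{0..<d}. scale (\<phi> v $ j) (b j)) = v" for v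
      using R_sum[of v] by (simp add: \<phi>_def)
    show "\<phi> (\<Sum>j\<in>{0..<d}. scale (w $ j) (b j)) = w" if "w \<in> carrier_vec d" for w :: "'k vec"
    proof (rule eq_vecI)
      fix i assume "i < dim_vec w"
      then have i: "i < d" using that by simp
      have "R (\<Sum>j\<in>{0..<d}. scale (w $ j) (b j)) i = (\<Sum>j\<in>{0..<d}. w $ j * (if i = j then 1 else 0))"
        unfolding R_sum_distrib R_scale by (rule sum.cong) (simp_all add: R_b i)
      also have "\<dots> = w $ i" using i by (simp add: if_distrib cong: if_cong)
      finally show "\<phi> (\<Sum>j\<in>{0..<d}. scale (w $ j) (b j)) $ i = w $ i" by (simp add: \<phi>_def i)
    qed (use that in \<open>simp add: \<phi>_def\<close>)
  qed (simp_all add: \<phi>_def)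
  moreover have "\<phi> (u + v) = \<phi> u + \<phi> v" for u v
    by (rule eq_vecI) (simp_all add: \<phi>_def R_add)
  moreover have "\<phi> (scale c v) = c \<cdot>\<^sub>v \<phi> v" for c v
    by (rule eq_vecI) (simp_all add: \<phi>_def R_scale)
  moreover have "\<phi> (act x v) = \<rho> x *\<^sub>v \<phi> v" if "x \<in> carrier A" for x v
    by (rule eq_vecI) (simp_all add: \<phi>_def \<rho>_def act_R[OF that, of v] scalar_prod_def)
  ultimately show ?thesis using that by blast
qed

definition fd_module_iso ::
    "('a, 'b) ring_scheme \<Rightarrow> ('k::field \<Rightarrow> 'a) \<Rightarrow> (('a, 'k) fd_module \<times> ('a, 'k) fd_module) set" where
  "fd_module_iso A \<iota> =
    {((d, \<rho>), (e, \<sigma>)). (d, \<rho>) \<in> fd_modules A \<iota> \<and> (e, \<sigma>) \<in> fd_modules A \<iota> \<and>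
      (\<exists>P\<in>carrier_mat e d. \<exists>Q\<in>carrier_mat d e.
        P * Q = 1\<^sub>m e \<and> Q * P = 1\<^sub>m d \<and> (\<forall>x\<in>carrier A. P * \<rho> x = \<sigma> x * P))}"

fun fd_module_dsum :: "('a, 'k::field) fd_module \<Rightarrow> ('a, 'k) fd_module \<Rightarrow> ('a, 'k) fd_module" where
  "fd_module_dsum (d, \<rho>) (e, \<sigma>) =
    (d + e, \<lambda>x. four_block_mat (\<rho> x) (0\<^sub>m d e) (0\<^sub>m e d) (\<sigma> x))"


subsection \<open>Tensor products of modules over the Taft algebra\<close>

text \<open>Kronecker product: the matrix of \<open>A \<otimes> B\<close> in the basis \<open>e\<^sub>i \<otimes> e\<^sub>j\<close>, ordered lexicographically.\<close>

definition kronecker :: "'k::field mat \<Rightarrow> 'k mat \<Rightarrow> 'k mat" where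
  "kronecker A B = mat (dim_row A * dim_row B) (dim_col A * dim_col B)
    (\<lambda>(i, j). A $$ (i div dim_row B, j div dim_col B) * B $$ (i mod dim_row B, j mod dim_col B))"

text \<open>The element \<open>\<Sum> c\<^sub>u\<^sub>v u \<otimes> v\<close> acts on the outer tensor product by \<open>\<Sum> c\<^sub>u\<^sub>v \<rho>[u] \<otimes> \<sigma>[v]\<close>.\<close>

fun free_tensor_act ::
    "nat \<Rightarrow> 'k::field \<Rightarrow> ('k free_alg set, 'k) fd_module \<Rightarrow> ('k free_alg set, 'k) fd_module
      \<Rightarrow> 'k free_alg2 \<Rightarrow> 'k mat" where
  "free_tensor_act n q (d, \<rho>) (e, \<sigma>) t = mat (d * e) (d * e) (\<lambda>ij.
    \<Sum>(u, v)\<in>Poly_Mapping.keys t. Poly_Mapping.lookup t (u, v) *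
      kronecker (\<rho> (taft_class n q (Poly_Mapping.single u 1)))
                (\<sigma> (taft_class n q (Poly_Mapping.single v 1))) $$ ij)"

definition taft_tensor_act ::
    "nat \<Rightarrow> 'k::field \<Rightarrow> ('k free_alg set, 'k) fd_module \<Rightarrow> ('k free_alg set, 'k) fd_module
      \<Rightarrow> 'k free_alg2 set \<Rightarrow> 'k mat" where
  "taft_tensor_act n q M N Z = the_elem (free_tensor_act n q M N ` Z)"

definition taft_module_tensor ::
    "nat \<Rightarrow> 'k::field \<Rightarrow> ('k free_alg set, 'k) fd_module \<Rightarrow> ('k free_alg set, 'k) fd_module
      \<Rightarrow> ('k free_alg set, 'k) fd_module" where
  "taft_module_tensor n q M N =
    (fst M * fst N, \<lambda>x. taft_tensor_act n q M N (taft_comult n q x))"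

definition taft_trivial_module :: "('k free_alg set, 'k::field) fd_module" where
  "taft_trivial_module = (1, \<lambda>x. taft_counit x \<cdot>\<^sub>m 1\<^sub>m 1)"


section \<open>The Green ring\<close>

type_synonym ('a, 'k) iso_class = "('a, 'k) fd_module set"

definition iso_classes :: "('a, 'b) ring_scheme \<Rightarrow> ('k::field \<Rightarrow> 'a) \<Rightarrow> ('a, 'k) iso_class set" where
  "iso_classes A \<iota> = fd_modules A \<iota> // fd_module_iso A \<iota>"

definition iso_class ::
    "('a, 'b) ring_scheme \<Rightarrow> ('k::field \<Rightarrow> 'a) \<Rightarrow> ('a, 'k) fd_module \<Rightarrow> ('a, 'k) iso_class" where
  "iso_class A \<iota> M = fd_module_iso A \<iota> `` {M}"

text \<open>The free abelian group on the isomorphism classes, with the biadditive product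
  determined by \<open>[M][N] = [M \<otimes> N]\<close>. The tensor product \<open>T\<close> and the unit module \<open>E\<close> are parameters
  (for a Hopf algebra they come from the comultiplication and the counit).\<close>

definition iso_class_mult ::
    "('a, 'b) ring_scheme \<Rightarrow> ('k::field \<Rightarrow> 'a)
      \<Rightarrow> (('a, 'k) fd_module \<Rightarrow> ('a, 'k) fd_module \<Rightarrow> ('a, 'k) fd_module)
      \<Rightarrow> ('a, 'k) iso_class \<Rightarrow> ('a, 'k) iso_class \<Rightarrow> ('a, 'k) iso_class" where
  "iso_class_mult A \<iota> T C D = (\<Union>M\<in>C. \<Union>N\<in>D. iso_class A \<iota> (T M N))"

definition iso_class_ring ::
    "('a, 'b) ring_scheme \<Rightarrow> ('k::field \<Rightarrow> 'a)
      \<Rightarrow> (('a, 'k) fd_module \<Rightarrow> ('a, 'k) fd_module \<Rightarrow> ('a, 'k) fd_module)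
      \<Rightarrow> ('a, 'k) fd_module \<Rightarrow> (('a, 'k) iso_class \<Rightarrow>\<^sub>0 int) ring" where
  "iso_class_ring A \<iota> T E =
    \<lparr>carrier = {a. Poly_Mapping.keys a \<subseteq> iso_classes A \<iota>},
     monoid.mult = (\<lambda>a b. \<Sum>C\<in>Poly_Mapping.keys a. \<Sum>D\<in>Poly_Mapping.keys b.
       Poly_Mapping.single (iso_class_mult A \<iota> T C D)
         (Poly_Mapping.lookup a C * Poly_Mapping.lookup b D)),
     one = Poly_Mapping.single (iso_class A \<iota> E) 1,
     ring.zero = 0,
     add = (+)\<rparr>"

definition green_relators ::
    "('a, 'b) ring_scheme \<Rightarrow> ('k::field \<Rightarrow> 'a) \<Rightarrow> (('a, 'k) iso_class \<Rightarrow>\<^sub>0 int) set" where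
  "green_relators A \<iota> =
    {Poly_Mapping.single (iso_class A \<iota> (fd_module_dsum M N)) 1
       - Poly_Mapping.single (iso_class A \<iota> M) 1 - Poly_Mapping.single (iso_class A \<iota> N) 1
     | M N. M \<in> fd_modules A \<iota> \<and> N \<in> fd_modules A \<iota>}"

text \<open>Only the additive subgroup generated by the relators is divided out; it is an ideal because
  the tensor product distributes over direct sums.\<close>

definition green_ring ::
    "('a, 'b) ring_scheme \<Rightarrow> ('k::field \<Rightarrow> 'a)
      \<Rightarrow> (('a, 'k) fd_module \<Rightarrow> ('a, 'k) fd_module \<Rightarrow> ('a, 'k) fd_module)
      \<Rightarrow> ('a, 'k) fd_module \<Rightarrow> (('a, 'k) iso_class \<Rightarrow>\<^sub>0 int) set ring" where
  "green_ring A \<iota> T E =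
    iso_class_ring A \<iota> T E Quot
      generate (add_monoid (iso_class_ring A \<iota> T E)) (green_relators A \<iota>)"

definition taft_green_ring ::
    "nat \<Rightarrow> 'k::field \<Rightarrow> (('k free_alg set, 'k) iso_class \<Rightarrow>\<^sub>0 int) set ring" where
  "taft_green_ring n q =
    green_ring (taft_algebra n q) (taft_scalar n q) (taft_module_tensor n q) taft_trivial_module"


section \<open>The polynomial side\<close>

text \<open>\<open>\<int>[y,z]\<close> is \<open>\<int>[y][z]\<close>.\<close>

definition y_var :: "int poly poly" where
  "y_var = [:[:0, 1:]:]"

definition z_var :: "int poly poly" where
  "z_var = [:0, 1:]"

text \<open>The value at \<open>0\<close> is irrelevant: the polynomials are only defined for positive indices.\<close>

fun f_poly :: "nat \<Rightarrow> int poly poly" where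
  "f_poly 0 = 0"
| "f_poly (Suc 0) = 1"
| "f_poly (Suc (Suc 0)) = z_var"
| "f_poly (Suc (Suc (Suc m))) = z_var * f_poly (Suc (Suc m)) - y_var * f_poly (Suc m)"

definition green_ideal :: "nat \<Rightarrow> int poly poly set" where
  "green_ideal n =
    Idl\<^bsub>ring_of_type_algebra\<^esub> {y_var ^ n - 1, (z_var - y_var - 1) * f_poly n}"

definition primitive_root_of_unity :: "nat \<Rightarrow> 'k::field \<Rightarrow> bool" where
  "primitive_root_of_unity n q \<longleftrightarrow> 0 < n \<and> q ^ n = 1 \<and> (\<forall>m. 0 < m \<and> m < n \<longrightarrow> q ^ m \<noteq> 1)"

end

theory Submission
  imports Defs "Jordan_Normal_Form.Determinant"
begin

text \<open>Put \<open>p = 1/q\<close>. A module over the Taft algebra is a pair of matrices \<open>(G, H)\<close> with \<open>G\<^sup>n = 1\<close>, \<open>H\<^sup>n = 0\<close>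
  and \<open>HG = qGH\<close>, and isomorphisms, direct sums and tensor products of modules can be read off
  these pairs (\<open>iso_iff_pair_iso\<close>, \<open>dsum_mods\<close>, \<open>tensor_mods\<close>). Since \<open>q\<close> has order \<open>n\<close>, the matrix \<open>G\<close> is
  diagonalisable with powers of \<open>p\<close> as eigenvalues, and \<open>H\<close> moves the eigenspace of \<open>p\<^sup>i\<close> into that of
  \<open>p\<^sup>i\<^sup>+\<^sup>1\<close>. The basic modules are the chains \<open>C(l,i)\<close> with basis \<open>v\<^sub>0, \<dots>, v\<^sub>l\<^sub>-\<^sub>1\<close>, on which \<open>G v\<^sub>j = p\<^sup>i\<^sup>+\<^sup>j v\<^sub>j\<close>
  and \<open>H v\<^sub>j = v\<^sub>j\<^sub>+\<^sub>1\<close>, where \<open>1 \<le> l \<le> n\<close> and \<open>0 \<le> i < n\<close>.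

  Every module is a direct sum of chains (\<open>taft_pair_induct\<close>): if \<open>H\<^sup>l = 0 \<noteq> H\<^sup>l\<^sup>-\<^sup>1\<close>, a homogeneous
  vector \<open>v\<close> with \<open>H\<^sup>l\<^sup>-\<^sup>1 v \<noteq> 0\<close> spans a chain, and a homogeneous linear form that does not vanish on
  \<open>H\<^sup>l\<^sup>-\<^sup>1 v\<close> provides a retraction onto it (\<open>chain_summand\<close>). The multiplicity of \<open>C(l,i)\<close> does not
  depend on the decomposition, because it is an alternating sum of ranks of powers of \<open>H\<close> on
  eigenspaces of \<open>G\<close>, and these ranks are additive (\<open>chain_mult_biprod\<close>, \<open>chain_mult_chain\<close>).
  Therefore the classes of the \<open>n\<^sup>2\<close> chains form a \<open>\<int>\<close>-basis of the Green ring. On the other side the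
  \<open>n\<^sup>2\<close> classes of \<open>y\<^sup>i f\<^sub>l\<close> are linearly independent in \<open>\<int>[y,z]/I\<close>, because \<open>(z - y - 1) f\<^sub>n\<close> is monic of
  degree \<open>n\<close> in \<open>z\<close> (\<open>green_basis_independent\<close>).

  The isomorphism sends the class of \<open>C(l,i)\<close> to that of \<open>y\<^sup>i f\<^sub>l\<close>. This defines an additive map, and
  the point is that it is multiplicative (\<open>pair_poly_pair_tensor\<close>). Consider the modules \<open>M\<close> for
  which \<open>[M][N]\<close> goes to the product of the images for every \<open>N\<close>. They are closed under tensor
  products, direct sums and removal of direct summands of the same kind, and for a given \<open>M\<close> it is
  enough to test chains \<open>N\<close>. For \<open>C(1,j)\<close> the test is \<open>C(1,j) \<otimes> C(l,i) = C(l,i+j)\<close>. For \<open>C(2,0)\<close> it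
  consists of the decompositions of \<open>C(2,0) \<otimes> C(l,i)\<close> into \<open>C(l+1,i) \<oplus> C(l-1,i+1)\<close> for \<open>l < n\<close> and
  into \<open>C(n,i) \<oplus> C(n,i+1)\<close> for \<open>l = n\<close> (\<open>chain_2_tensor_chain\<close>, \<open>chain_2_tensor_chain_n\<close>): the first
  mirrors the recursion for the \<open>f\<^sub>m\<close>, the second the relation \<open>(z - y - 1) f\<^sub>n = 0\<close>. All other chains
  are obtained from these two by the closure properties. Injectivity is the independence of the
  \<open>y\<^sup>i f\<^sub>l\<close>; surjectivity holds because the image is a subring containing \<open>y\<close> and \<open>z\<close>.\<close>

section \<open>Matrices, blocks and rank\<close>

lemma mult_entry:
  "\<lbrakk>i < dim_row A; j < dim_col B; dim_col A = dim_row B\<rbrakk>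
    \<Longrightarrow> (A * B) $$ (i,j) = (\<Sum>k<dim_row B. A $$ (i,k) * B $$ (k,j))"
  by (simp add: scalar_prod_def lessThan_atLeast0)

text \<open>The ring laws for matrices are stated with equations between dimensions as premises: in this
  form they are rewrite rules whose premises the simplifier discharges by computing dimensions.\<close>

lemma mat_assoc:
  fixes A :: "'a::semiring_0 mat"
  shows "\<lbrakk>dim_col A = dim_row B; dim_col B = dim_row C\<rbrakk> \<Longrightarrow> (A * B) * C = A * (B * C)"
  by (rule assoc_mult_mat[of _ "dim_row A" "dim_row B" _ "dim_row C" _ "dim_col C"]) auto

lemma mat_distl:
  fixes A :: "'a::semiring_0 mat"
  shows "\<lbrakk>dim_col A = dim_row B; dim_row B = dim_row C; dim_col B = dim_col C\<rbrakk>
    \<Longrightarrow> A * (B + C) = A * B + A * C"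
  by (rule mult_add_distrib_mat[of _ "dim_row A" "dim_row B" _ "dim_col C"]) auto

lemma mat_distr:
  fixes A :: "'a::semiring_0 mat"
  shows "\<lbrakk>dim_col A = dim_row C; dim_row B = dim_row A; dim_col B = dim_col A\<rbrakk>
    \<Longrightarrow> (A + B) * C = A * C + B * C"
  by (rule add_mult_distrib_mat[of _ "dim_row A" "dim_row C" _ _ "dim_col C"]) auto

lemma mat_minus_distl:
  fixes A :: "'a::ring mat"
  shows "\<lbrakk>dim_col A = dim_row B; dim_row B = dim_row C; dim_col B = dim_col C\<rbrakk>
    \<Longrightarrow> A * (B - C) = A * B - A * C"
  by (rule mult_minus_distrib_mat[of _ "dim_row A" "dim_row B" _ "dim_col C"]) auto

lemma mat_minus_distr:
  fixes A :: "'a::ring mat"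
  shows "\<lbrakk>dim_col A = dim_row C; dim_row B = dim_row A; dim_col B = dim_col A\<rbrakk>
    \<Longrightarrow> (A - B) * C = A * C - B * C"
  by (rule minus_mult_distrib_mat[of _ "dim_row A" "dim_row C" _ _ "dim_col C"]) auto

lemma mat_smult_l: "dim_col A = dim_row B \<Longrightarrow> (c \<cdot>\<^sub>m A) * B = c \<cdot>\<^sub>m (A * B :: 'a::comm_semiring_0 mat)"
  by (rule eq_matI) (auto simp: mult_entry sum_distrib_left mult.assoc simp del: index_mult_mat(1))

lemma mat_smult_r: "dim_col A = dim_row B \<Longrightarrow> A * (c \<cdot>\<^sub>m B) = c \<cdot>\<^sub>m (A * B :: 'a::comm_semiring_0 mat)"
  by (rule eq_matI)
    (auto simp: mult_entry sum_distrib_left mult.left_commute simp del: index_mult_mat(1))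

lemma mat_one_l: "dim_row A = m \<Longrightarrow> 1\<^sub>m m * A = (A :: 'a::semiring_1 mat)"
  and mat_one_r: "dim_col A = m \<Longrightarrow> A * 1\<^sub>m m = A"
  and mat_zero_l: "dim_row A = m \<Longrightarrow> 0\<^sub>m r m * A = 0\<^sub>m r (dim_col A)"
  and mat_zero_r: "dim_col A = m \<Longrightarrow> A * 0\<^sub>m m r = 0\<^sub>m (dim_row A) r"
  by (auto intro: left_mult_one_mat right_mult_one_mat left_mult_zero_mat right_mult_zero_mat)

lemmas mat_ring = mat_assoc mat_distl mat_distr mat_minus_distl mat_minus_distr mat_smult_l
  mat_smult_r mat_one_l mat_one_r mat_zero_l mat_zero_r

lemma mat_add_zero:
  fixes A :: "'a::monoid_add mat"
  shows "\<lbrakk>dim_row A = r; dim_col A = c\<rbrakk> \<Longrightarrow> A + 0\<^sub>m r c = A"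
    and "\<lbrakk>dim_row A = r; dim_col A = c\<rbrakk> \<Longrightarrow> 0\<^sub>m r c + A = A"
  by auto

lemma pow_mat_add: "A \<in> carrier_mat d d \<Longrightarrow> A ^\<^sub>m (a + b) = A ^\<^sub>m a * (A ^\<^sub>m b :: 'a::semiring_1 mat)"
proof (induction b)
  case (Suc b)
  then show ?case by (simp add: mat_assoc)
qed simp

lemma smult_smult_mat: "a \<cdot>\<^sub>m (b \<cdot>\<^sub>m A) = (a * b :: 'a::semigroup_mult) \<cdot>\<^sub>m A"
  by (rule eq_matI) (auto simp: mult.assoc)

lemma mat_minus_self: "A - A = 0\<^sub>m (dim_row A) (dim_col (A :: 'a::group_add mat))"
  by (rule eq_matI) auto

definition hcat :: "'a mat \<Rightarrow> 'a mat \<Rightarrow> 'a mat" where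
  "hcat A B = mat (dim_row A) (dim_col A + dim_col B)
    (\<lambda>(i,j). if j < dim_col A then A $$ (i,j) else B $$ (i, j - dim_col A))"

definition vcat :: "'a mat \<Rightarrow> 'a mat \<Rightarrow> 'a mat" where
  "vcat A B = mat (dim_row A + dim_row B) (dim_col A)
    (\<lambda>(i,j). if i < dim_row A then A $$ (i,j) else B $$ (i - dim_row A, j))"

lemma dim_hcat[simp]: "dim_row (hcat A B) = dim_row A" "dim_col (hcat A B) = dim_col A + dim_col B"
  and dim_vcat[simp]: "dim_row (vcat A B) = dim_row A + dim_row B" "dim_col (vcat A B) = dim_col A"
  by (simp_all add: hcat_def vcat_def)

lemma sum_lessThan_split: "(\<Sum>k<m + (n::nat). f k) = (\<Sum>k<m. f k) + (\<Sum>k<n. f (m + k) :: 'a::comm_monoid_add)"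
  by (induction n) (simp_all add: add.assoc)

lemma hcat_mult_vcat:
  fixes A :: "'a::semiring_0 mat"
  assumes "dim_row B = dim_row A" "dim_col D = dim_col C" "dim_col A = dim_row C" "dim_col B = dim_row D"
  shows "hcat A B * vcat C D = A * C + B * D"
proof (rule eq_matI)
  fix i j assume "i < dim_row (A * C + B * D)" "j < dim_col (A * C + B * D)"
  then show "(hcat A B * vcat C D) $$ (i, j) = (A * C + B * D) $$ (i, j)"
    using assms
    by (simp add: mult_entry sum_lessThan_split hcat_def vcat_def del: index_mult_mat(1))
qed (use assms in auto)

lemma vcat_mult_hcat:
  fixes A :: "'a::semiring_0 mat"
  assumes "dim_col B = dim_col A" "dim_row D = dim_row C" "dim_col A = dim_row C"
  shows "vcat A B * hcat C D = four_block_mat (A * C) (A * D) (B * C) (B * D)"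
proof (rule eq_matI)
  fix i j assume "i < dim_row (four_block_mat (A * C) (A * D) (B * C) (B * D))"
    "j < dim_col (four_block_mat (A * C) (A * D) (B * C) (B * D))"
  then show "(vcat A B * hcat C D) $$ (i, j) = four_block_mat (A * C) (A * D) (B * C) (B * D) $$ (i, j)"
    using assms
    by (auto simp: mult_entry hcat_def vcat_def simp del: index_mult_mat(1))
qed (use assms in auto)

lemma vcat_mult: "dim_col B = dim_col A \<Longrightarrow> dim_col A = dim_row U \<Longrightarrow> vcat A B * U =
  vcat (A * U) (B * U :: 'a::semiring_0 mat)"
  by (rule eq_matI) (auto simp: mult_entry vcat_def simp del: index_mult_mat(1))

lemma mult_hcat: "dim_row B = dim_row A \<Longrightarrow> dim_col U = dim_row A \<Longrightarrow> U * hcat A B =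
  hcat (U * A) (U * B :: 'a::semiring_0 mat)"
  by (rule eq_matI) (auto simp: mult_entry hcat_def simp del: index_mult_mat(1))

lemma block_diag_mult_vcat:
  fixes A :: "'a::semiring_0 mat"
  assumes "dim_col A = dim_row C" "dim_col B = dim_row D" "dim_col D = dim_col C"
    and "a = dim_row A" "b = dim_col B" "c = dim_row B" "d = dim_col A"
  shows "four_block_mat A (0\<^sub>m a b) (0\<^sub>m c d) B * vcat C D = vcat (A * C) (B * D)"
proof (rule eq_matI)
  fix i j assume "i < dim_row (vcat (A * C) (B * D))" "j < dim_col (vcat (A * C) (B * D))"
  then show "(four_block_mat A (0\<^sub>m a b) (0\<^sub>m c d) B * vcat C D) $$ (i, j) = vcat (A * C) (B * D) $$ (i, j)"
    using assms
    by (auto simp: mult_entry sum_lessThan_split vcat_def simp del: index_mult_mat(1))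
qed (use assms in auto)

lemma hcat_zero: "hcat (0\<^sub>m r a) (0\<^sub>m r b) = 0\<^sub>m r (a + b)"
  by (rule eq_matI) (auto simp: hcat_def)

text \<open>Padded with zeros, \<open>A\<close> and \<open>B\<close> become square matrices with product \<open>1\<close>, so they are inverse to each
  other in both orders; but the padding gives \<open>B\<close> a zero row.\<close>

lemma mat_id_factor_le:
  fixes A :: "'a::field mat"
  assumes "A \<in> carrier_mat r s" "B \<in> carrier_mat s r" "A * B = 1\<^sub>m r"
  shows "r \<le> s"
proof (rule ccontr)
  assume "\<not> r \<le> s"
  then have rs: "s < r" by simp
  define A' where "A' = hcat A (0\<^sub>m r (r - s))"
  define B' where "B' = vcat B (0\<^sub>m (r - s) r)"
  have car: "A' \<in> carrier_mat r r" "B' \<in> carrier_mat r r"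
    using assms rs by (auto simp: A'_def B'_def)
  have "A' * B' = 1\<^sub>m r"
    using assms rs by (auto simp: A'_def B'_def hcat_mult_vcat)
  then have "B' * A' = 1\<^sub>m r" by (rule mat_mult_left_right_inverse[OF car])
  then have "(B' * A') $$ (s, s) = 1" using rs by simp
  moreover have "(B' * A') $$ (s, s) = (\<Sum>k<r. B' $$ (s,k) * A' $$ (k,s))"
    using car rs by (subst mult_entry) auto
  moreover have "B' $$ (s,k) = 0" if "k < r" for k
    using assms(2) rs that by (simp add: B'_def vcat_def)
  ultimately show False by simp
qed

text \<open>The rank of \<open>E\<close>, expressed by a factorisation \<open>E = C D\<close> with a left inverse \<open>U\<close> of \<open>C\<close> and a right
  inverse \<open>Y\<close> of \<open>D\<close>. With these witnesses both additivity of the rank and the splitting of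
  idempotents are identities between matrices.\<close>

definition has_rank :: "'a::field mat \<Rightarrow> nat \<Rightarrow> bool" where
  "has_rank E r \<longleftrightarrow> (\<exists>C\<in>carrier_mat (dim_row E) r. \<exists>U\<in>carrier_mat r (dim_row E).
     \<exists>D\<in>carrier_mat r (dim_col E). \<exists>Y\<in>carrier_mat (dim_col E) r.
     U * C = 1\<^sub>m r \<and> D * Y = 1\<^sub>m r \<and> E = C * D)"

text \<open>For two such factorisations \<open>E = C D = C' D'\<close>, the identity \<open>U E Y = 1\<close> of size \<open>r\<close> factors through
  size \<open>s\<close> as \<open>(U C') (D' Y)\<close>.\<close>

lemma has_rank_le:
  assumes "has_rank E r" "has_rank E s"
  shows "r \<le> s"
proof -
  obtain C U D Y where 1: "C\<in>carrier_mat (dim_row E) r" "U\<in>carrier_mat r (dim_row E)"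
     "D\<in>carrier_mat r (dim_col E)" "Y\<in>carrier_mat (dim_col E) r"
     "U * C = 1\<^sub>m r" "D * Y = 1\<^sub>m r" "E = C * D"
    using assms(1) unfolding has_rank_def by blast
  obtain C' U' D' Y' where 2: "C'\<in>carrier_mat (dim_row E) s" "U'\<in>carrier_mat s (dim_row E)"
     "D'\<in>carrier_mat s (dim_col E)" "Y'\<in>carrier_mat (dim_col E) s"
     "U' * C' = 1\<^sub>m s" "D' * Y' = 1\<^sub>m s" "E = C' * D'"
    using assms(2) unfolding has_rank_def by blast
  define m c where "m = dim_row E" and "c = dim_col E"
  note car = 1(1-4)[folded m_def c_def] 2(1-4)[folded m_def c_def]
  have [simp]: "dim_row C = m" "dim_col C = r" "dim_row U = r" "dim_col U = m"
    "dim_row D = r" "dim_col D = c" "dim_row Y = c" "dim_col Y = r"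
    "dim_row C' = m" "dim_col C' = s" "dim_row D' = s" "dim_col D' = c"
    using car by auto
  have "(U * C') * (D' * Y) = U * (C' * D') * Y" by (simp add: mat_assoc)
  also have "\<dots> = U * (C * D) * Y" by (simp flip: 1(7) 2(7))
  also have "\<dots> = (U * C) * (D * Y)" by (simp add: mat_assoc)
  also have "\<dots> = 1\<^sub>m r" using 1(5,6) by simp
  finally show ?thesis
    by (rule mat_id_factor_le[rotated -1]) auto
qed

lemma has_rank_unique: "has_rank E r \<Longrightarrow> has_rank E s \<Longrightarrow> r = s"
  by (meson has_rank_le le_antisym)

text \<open>Gaussian elimination: let \<open>u\<close> be the column and \<open>w\<close> the row through a nonzero entry, scaled such
  that \<open>F = E - u w\<close> vanishes in that row and column. Then \<open>F\<close> has fewer nonzero rows than \<open>E\<close>, and a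
  factorisation of \<open>F\<close> is extended by \<open>u\<close> and \<open>w\<close> to one of \<open>E\<close>.\<close>

lemma has_rank_exists: "\<exists>r. has_rank (E :: 'a::field mat) r"
proof -
  define nz where "nz F = {i. i < dim_row F \<and> (\<exists>j<dim_col F. F $$ (i,j) \<noteq> 0)}" for F :: "'a mat"
  have fin: "finite (nz F)" for F by (simp add: nz_def)
  show ?thesis
  proof (induction "card (nz E)" arbitrary: E rule: less_induct)
    case less
    show ?case
    proof (cases "nz E = {}")
      case True
      then have "E = 0\<^sub>m (dim_row E) (dim_col E)" by (intro eq_matI) (auto simp: nz_def)
      moreover have "has_rank (0\<^sub>m a b :: 'a mat) 0" for a b
        unfolding has_rank_def
        by (rule bexI[of _ "0\<^sub>m a 0"], rule bexI[of _ "0\<^sub>m 0 a"], rule bexI[of _ "0\<^sub>m 0 b"],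
          rule bexI[of _ "0\<^sub>m b 0"]) auto
      ultimately show ?thesis by metis
    next
      case False
      then obtain a b where ab: "a < dim_row E" "b < dim_col E" "E $$ (a,b) \<noteq> 0"
        by (auto simp: nz_def)
      define m where "m = dim_row E"
      define c where "c = dim_col E"
      define e where "e = E $$ (a,b)"
      define u where "u = mat m 1 (\<lambda>(i,j). E $$ (i,b))"
      define w where "w = mat 1 c (\<lambda>(i,j). E $$ (a,j) / e)"
      define F where "F = E - u * w"
      have dims[simp]: "dim_row E = m" "dim_col E = c" "dim_row u = m" "dim_col u = 1"
        "dim_row w = 1" "dim_col w = c" "dim_row F = m" "dim_col F = c"
        by (auto simp: u_def w_def F_def m_def c_def)
      have ab'[simp]: "a < m" "b < c" "e \<noteq> 0" using ab by (auto simp: e_def)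
      have F: "F $$ (i,j) = E $$ (i,j) - E $$ (i,b) * E $$ (a,j) / e" if "i < m" "j < c" for i j
        using that by (simp add: F_def mult_entry u_def w_def del: index_mult_mat(1))
      have Fa: "F $$ (a,j) = 0" if "j < c" for j using that ab(3) by (simp add: F e_def)
      have Fb: "F $$ (i,b) = 0" if "i < m" for i using that ab(3) by (simp add: F e_def)
      have "nz F \<subset> nz E"
      proof
        show "nz F \<subseteq> nz E"
        proof
          fix i assume "i \<in> nz F"
          then obtain j where ij: "i < m" "j < c" "F $$ (i,j) \<noteq> 0" by (auto simp: nz_def)
          then have "E $$ (i,j) \<noteq> 0 \<or> E $$ (i,b) \<noteq> 0" by (auto simp: F)
          with ij show "i \<in> nz E" by (auto simp: nz_def intro: exI[of _ b])
        qed
        have "a \<in> nz E" using ab by (auto simp: nz_def intro: exI[of _ b])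
        moreover have "a \<notin> nz F" by (auto simp: nz_def Fa)
        ultimately show "nz F \<noteq> nz E" by blast
      qed
      then have "card (nz F) < card (nz E)" by (simp add: fin psubset_card_mono)
      from less[OF this] obtain r C U D Y where R: "C\<in>carrier_mat m r" "U\<in>carrier_mat r m"
        "D\<in>carrier_mat r c" "Y\<in>carrier_mat c r" "U * C = 1\<^sub>m r" "D * Y = 1\<^sub>m r" "F = C * D"
        by (auto simp: has_rank_def)
      have Rd[simp]: "dim_row C = m" "dim_col C = r" "dim_row U = r" "dim_col U = m"
        "dim_row D = r" "dim_col D = c" "dim_row Y = c" "dim_col Y = r"
        using R(1-4) by auto
      \<comment> \<open>The linear forms that read off row a and column b detect u and w and vanish on C and D.\<close>
      define \<phi> where "\<phi> = mat 1 m (\<lambda>(i,j). if j = a then 1 / e else 0)"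
      define \<psi> where "\<psi> = mat c 1 (\<lambda>(i,j). if i = b then 1 else 0::'a)"
      have pd[simp]: "dim_row \<phi> = 1" "dim_col \<phi> = m" "dim_row \<psi> = c" "dim_col \<psi> = 1"
        by (auto simp: \<phi>_def \<psi>_def)
      have "C = F * Y" using R by (simp add: mat_assoc mat_one_r)
      moreover have "\<phi> * F = 0\<^sub>m 1 c"
        by (rule eq_matI) (auto simp: mult_entry \<phi>_def Fa if_distrib[of "\<lambda>x. x * _"]
            sum.delta simp del: index_mult_mat(1) cong: if_cong)
      ultimately have \<phi>C: "\<phi> * C = 0\<^sub>m 1 r" by (simp add: mat_assoc[symmetric] mat_zero_l)
      have \<phi>u: "\<phi> * u = 1\<^sub>m 1"
        by (rule eq_matI) (auto simp: mult_entry \<phi>_def u_def if_distrib[of "\<lambda>x. x * _"]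
            sum.delta e_def[symmetric] simp del: index_mult_mat(1) cong: if_cong)
      have "D = U * F" using R by (simp add: mat_assoc[symmetric] mat_one_l)
      moreover have "F * \<psi> = 0\<^sub>m m 1"
        by (rule eq_matI) (auto simp: mult_entry \<psi>_def Fb if_distrib[of "\<lambda>x. _ * x"]
            sum.delta simp del: index_mult_mat(1) cong: if_cong)
      ultimately have D\<psi>: "D * \<psi> = 0\<^sub>m r 1" by (simp add: mat_assoc mat_zero_r)
      have w\<psi>: "w * \<psi> = 1\<^sub>m 1"
        by (rule eq_matI) (auto simp: mult_entry \<psi>_def w_def if_distrib[of "\<lambda>x. _ * x"]
            sum.delta e_def[symmetric] simp del: index_mult_mat(1) cong: if_cong)
      \<comment> \<open>The old one-sided inverses are corrected so that they kill u and w.\<close>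
      define U' where "U' = U - U * (u * \<phi>)"
      define Y' where "Y' = Y - \<psi> * (w * Y)"
      have d'[simp]: "dim_row U' = r" "dim_col U' = m" "dim_row Y' = c" "dim_col Y' = r"
        by (auto simp: U'_def Y'_def)
      have 1: "U' * C = 1\<^sub>m r" "U' * u = 0\<^sub>m r 1"
        by (auto simp: U'_def mat_ring R \<phi>C \<phi>u)
      have "D * (\<psi> * (w * Y)) = (D * \<psi>) * (w * Y)" "w * (\<psi> * (w * Y)) = (w * \<psi>) * (w * Y)"
        by (simp_all add: mat_assoc)
      then have 2: "D * Y' = 1\<^sub>m r" "w * Y' = 0\<^sub>m 1 r"
        by (auto simp: Y'_def mat_minus_distl mat_one_l mat_zero_l R D\<psi> w\<psi>)
      have "vcat \<phi> U' * hcat u C = 1\<^sub>m (1 + r)" "vcat w D * hcat \<psi> Y' = 1\<^sub>m (1 + r)"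
        by (simp_all add: vcat_mult_hcat 1 2 \<phi>C \<phi>u w\<psi> D\<psi>)
      moreover have "E = hcat u C * vcat w D"
        using R(7) by (intro eq_matI) (auto simp: hcat_mult_vcat F_def simp flip: R(7) simp del:
          index_mult_mat(1))
      ultimately have "has_rank E (1 + r)" unfolding has_rank_def
        by (intro bexI[of _ "hcat u C"] bexI[of _ "vcat \<phi> U'"] bexI[of _ "vcat w D"]
            bexI[of _ "hcat \<psi> Y'"]) auto
      then show ?thesis by blast
    qed
  qed
qed

definition mrank :: "'a::field mat \<Rightarrow> nat" where "mrank E = (THE r. has_rank E r)"

lemma mrank_eq_iff: "mrank E = r \<longleftrightarrow> has_rank E r"
proof -
  have "has_rank E (mrank E)" unfolding mrank_def
    by (rule theI') (use has_rank_exists has_rank_unique in blast)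
  then show ?thesis using has_rank_unique by blast
qed

lemma has_rank_zero: "has_rank (0\<^sub>m a b :: 'a::field mat) 0"
  unfolding has_rank_def
  by (rule bexI[of _ "0\<^sub>m a 0"], rule bexI[of _ "0\<^sub>m 0 a"], rule bexI[of _ "0\<^sub>m 0 b"],
      rule bexI[of _ "0\<^sub>m b 0"]) auto

lemma has_rank_single_entry:
  fixes c :: "'a::field"
  assumes "i < l" "j < m" "c \<noteq> 0"
  shows "has_rank (mat l m (\<lambda>(a,b). if a = i \<and> b = j then c else 0)) 1"
  unfolding has_rank_def
  by (rule bexI[of _ "mat l 1 (\<lambda>(a,b). if a = i then c else 0)"],
      rule bexI[of _ "mat 1 l (\<lambda>(a,b). if b = i then inverse c else 0)"],
      rule bexI[of _ "mat 1 m (\<lambda>(a,b). if b = j then 1 else 0)"],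
      rule bexI[of _ "mat m 1 (\<lambda>(a,b). if a = j then 1 else 0)"])
    (use assms in \<open>auto intro!: eq_matI simp: mult_entry simp del: index_mult_mat(1)
      simp: if_distrib[of "\<lambda>x. _ * x"] cong: if_cong\<close>)

text \<open>Here \<open>E\<close> acts on a direct sum, given by injections \<open>A1\<close>, \<open>A2\<close> and projections \<open>B1\<close>, \<open>B2\<close>, and restricts
  to \<open>E1\<close> and \<open>E2\<close> on the summands. Factorisations of \<open>E1\<close> and \<open>E2\<close> are put side by side.\<close>

lemma has_rank_additive:
  fixes E :: "'a::field mat"
  assumes E1: "has_rank E1 r1" and E2: "has_rank E2 r2"
    and car: "E1 \<in> carrier_mat m1 m1" "E2 \<in> carrier_mat m2 m2" "E \<in> carrier_mat d d"
      "A1 \<in> carrier_mat d m1" "B1 \<in> carrier_mat m1 d" "A2 \<in> carrier_mat d m2" "B2 \<in> carrier_mat m2 d"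
    and eqs: "B1 * A1 = 1\<^sub>m m1" "B1 * A2 = 0\<^sub>m m1 m2" "B2 * A1 = 0\<^sub>m m2 m1" "B2 * A2 = 1\<^sub>m m2"
      "A1 * B1 + A2 * B2 = 1\<^sub>m d"
    and tw: "E * A1 = A1 * E1" "E * A2 = A2 * E2"
  shows "has_rank E (r1 + r2)"
proof -
  obtain C U D Y where 1: "C\<in>carrier_mat m1 r1" "U\<in>carrier_mat r1 m1"
     "D\<in>carrier_mat r1 m1" "Y\<in>carrier_mat m1 r1" "U * C = 1\<^sub>m r1" "D * Y = 1\<^sub>m r1" "E1 = C * D"
    using E1 car(1) by (auto simp: has_rank_def)
  obtain C' U' D' Y' where 2: "C'\<in>carrier_mat m2 r2" "U'\<in>carrier_mat r2 m2"
     "D'\<in>carrier_mat r2 m2" "Y'\<in>carrier_mat m2 r2" "U' * C' = 1\<^sub>m r2" "D' * Y' = 1\<^sub>m r2" "E2 = C' * D'"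
    using E2 car(2) by (auto simp: has_rank_def)
  have [simp]: "dim_row C = m1" "dim_col C = r1" "dim_row U = r1" "dim_col U = m1"
    "dim_row D = r1" "dim_col D = m1" "dim_row Y = m1" "dim_col Y = r1"
    "dim_row C' = m2" "dim_col C' = r2" "dim_row U' = r2" "dim_col U' = m2"
    "dim_row D' = r2" "dim_col D' = m2" "dim_row Y' = m2" "dim_col Y' = r2"
    "dim_row A1 = d" "dim_col A1 = m1" "dim_row B1 = m1" "dim_col B1 = d"
    "dim_row A2 = d" "dim_col A2 = m2" "dim_row B2 = m2" "dim_col B2 = d" "dim_row E = d" "dim_col E = d"
    using 1(1-4) 2(1-4) car by auto
  have mid: "B1 * (A1 * Z) = Z" "B2 * (A1 * Z) = 0\<^sub>m m2 (dim_col Z)" if "dim_row Z = m1" for Z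
    using that eqs by (simp_all add: mat_one_l mat_zero_l flip: mat_assoc)
  have mid': "B1 * (A2 * Z) = 0\<^sub>m m1 (dim_col Z)" "B2 * (A2 * Z) = Z" if "dim_row Z = m2" for Z
    using that eqs by (simp_all add: mat_one_l mat_zero_l flip: mat_assoc)
  have "E = E * (A1 * B1 + A2 * B2)" using eqs by (simp add: mat_one_r)
  also have "\<dots> = A1 * E1 * B1 + A2 * E2 * B2"
    by (simp add: mat_distl tw flip: mat_assoc)
  also have "\<dots> = hcat (A1 * C) (A2 * C') * vcat (D * B1) (D' * B2)"
    by (simp add: hcat_mult_vcat 1(7) 2(7) mat_assoc)
  finally have E: "E = hcat (A1 * C) (A2 * C') * vcat (D * B1) (D' * B2)" .
  have U: "vcat (U * B1) (U' * B2) * hcat (A1 * C) (A2 * C') = 1\<^sub>m (r1 + r2)"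
    by (simp add: vcat_mult_hcat mat_assoc mid mid' mat_zero_r 1 2)
  have Y: "vcat (D * B1) (D' * B2) * hcat (A1 * Y) (A2 * Y') = 1\<^sub>m (r1 + r2)"
    by (simp add: vcat_mult_hcat mat_assoc mid mid' mat_zero_r 1 2)
  show ?thesis unfolding has_rank_def
    by (intro bexI[of _ "hcat (A1 * C) (A2 * C')"] bexI[of _ "vcat (U * B1) (U' * B2)"]
      bexI[of _ "vcat (D * B1) (D' * B2)"] bexI[of _ "hcat (A1 * Y) (A2 * Y')"] conjI U Y E) auto
qed

text \<open>If \<open>E = C D\<close>, the equation \<open>E E = E\<close> reads \<open>C D C D = C D\<close>; cancelling \<open>C\<close> on the left and \<open>D\<close> on the
  right leaves \<open>D C = 1\<close>.\<close>

lemma idempotent_splits: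
  fixes E :: "'a::field mat"
  assumes "E \<in> carrier_mat d d" "E * E = E"
  obtains r C D where "C \<in> carrier_mat d r" "D \<in> carrier_mat r d" "E = C * D" "D * C = 1\<^sub>m r"
proof -
  obtain r C U D Y where 1: "C\<in>carrier_mat d r" "U\<in>carrier_mat r d"
     "D\<in>carrier_mat r d" "Y\<in>carrier_mat d r" "U * C = 1\<^sub>m r" "D * Y = 1\<^sub>m r" "E = C * D"
    using has_rank_exists[of E] assms(1) by (auto simp: has_rank_def)
  have [simp]: "dim_row C = d" "dim_col C = r" "dim_row U = r" "dim_col U = d"
    "dim_row D = r" "dim_col D = d" "dim_row Y = d" "dim_col Y = r" using 1 by auto
  have "U * (C * D * (C * D)) * Y = (U * C) * (D * C) * (D * Y)" by (simp add: mat_assoc)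
  moreover have "U * (C * D) * Y = (U * C) * (D * Y)" by (simp add: mat_assoc)
  ultimately have "D * C = 1\<^sub>m r" using assms(2) 1 by (simp add: mat_one_l mat_one_r)
  with 1 that show ?thesis by blast
qed

section \<open>Roots of unity and pairs of matrices\<close>

text \<open>The triple \<open>(d, G, H)\<close> stands for \<open>k\<^sup>d\<close> with the actions \<open>G\<close> of \<open>g\<close> and \<open>H\<close> of \<open>h\<close>.\<close>

type_synonym 'k mat_pair = "nat \<times> 'k mat \<times> 'k mat"

locale taft_root =
  fixes n :: nat and q :: "'k::field"
  assumes n2: "2 \<le> n" and prim: "primitive_root_of_unity n q"
begin

text \<open>From \<open>HG = qGH\<close> one gets \<open>GH = pHG\<close>: the matrix \<open>H\<close> multiplies eigenvalues of \<open>G\<close> by \<open>p\<close>.\<close>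

definition p :: 'k where "p = inverse q"

lemma q_pow_n: "q ^ n = 1" using prim by (simp add: primitive_root_of_unity_def)

lemma n_pos[simp]: "0 < n" using n2 by simp

lemma q_nz[simp]: "q \<noteq> 0"
  using q_pow_n n_pos by (metis power_0_left neq0_conv zero_neq_one)

lemma p_nz[simp]: "p \<noteq> 0" and pq: "p * q = 1" and qp: "q * p = 1"
  by (simp_all add: p_def)

lemma p_pow_n: "p ^ n = 1" by (simp add: p_def power_inverse q_pow_n)

lemma pow_mod: "p ^ (a mod n) = p ^ a" "q ^ (a mod n) = q ^ a"
proof -
  have "x ^ (a mod n) = x ^ a" if "x ^ n = 1" for x :: 'k
  proof -
    have "x ^ a = x ^ (n * (a div n) + a mod n)" by simp
    also have "\<dots> = x ^ (a mod n)" unfolding power_add power_mult that by simp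
    finally show ?thesis by simp
  qed
  then show "p ^ (a mod n) = p ^ a" "q ^ (a mod n) = q ^ a" using p_pow_n q_pow_n by auto
qed

lemma q_pow_eq_one_iff: "q ^ a = 1 \<longleftrightarrow> a mod n = 0"
proof
  assume "q ^ a = 1"
  then have 1: "q ^ (a mod n) = 1" by (simp add: pow_mod)
  have "\<not> (0 < m \<and> m < n)" if "q ^ m = 1" for m
    using prim that by (auto simp: primitive_root_of_unity_def)
  from this[OF 1] show "a mod n = 0" by simp
next
  assume "a mod n = 0" then show "q ^ a = 1" using pow_mod(2)[of a] by simp
qed

lemma qp_pow_eq_one_iff: "q ^ a * p ^ b = 1 \<longleftrightarrow> a mod n = b mod n"
proof -
  have *: "q ^ a * p ^ b = 1 \<longleftrightarrow> a mod n = b mod n" if "b \<le> a" for a b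
  proof -
    have "q ^ a * p ^ b = q ^ (a - b) * (q * p) ^ b"
      using that by (simp add: power_mult_distrib flip: power_add mult.assoc)
    also have "\<dots> = q ^ (a - b)" by (simp add: qp)
    finally show ?thesis using that by (simp add: q_pow_eq_one_iff mod_eq_dvd_iff_nat mod_eq_0_iff_dvd)
  qed
  show ?thesis
  proof (cases "b \<le> a")
    case False
    have "q ^ a * p ^ b = inverse (q ^ b * p ^ a)" by (simp add: p_def power_inverse field_simps)
    then have "q ^ a * p ^ b = 1 \<longleftrightarrow> q ^ b * p ^ a = 1" by (metis inverse_1 inverse_inverse_eq)
    moreover have "q ^ b * p ^ a = 1 \<longleftrightarrow> b mod n = a mod n" using False by (intro *) simp
    ultimately show ?thesis by metis
  qed (rule *)
qed

text \<open>If \<open>n\<close> were \<open>0\<close> in the field, the polynomial \<open>1 + x + \<dots> + x\<^sup>n\<^sup>-\<^sup>1\<close> would vanish at all \<open>n\<close> powers of \<open>q\<close>: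
  at \<open>1\<close> its value is \<open>n\<close>, and the others are roots of \<open>x\<^sup>n - 1\<close> different from \<open>1\<close>.\<close>

lemma of_nat_n_nz[simp]: "of_nat n \<noteq> (0::'k)"
proof
  assume n0: "of_nat n = (0::'k)"
  define P where "P = (\<Sum>j<n. monom (1::'k) j)"
  have cP: "coeff P i = (if i < n then 1 else 0)" for i
    by (simp add: P_def coeff_sum)
  have degP: "degree P \<le> n - 1" by (rule degree_le) (auto simp: cP)
  have P0: "P \<noteq> 0" using cP[of 0] by auto
  have poly: "poly P x = (\<Sum>j<n. x ^ j)" for x by (simp add: P_def poly_sum poly_monom)
  have "poly P (q ^ a) = 0" for a
  proof (cases "q ^ a = 1")
    case True then show ?thesis by (simp add: poly n0)
  next
    case False
    have "(q ^ a - 1) * (\<Sum>j<n. (q ^ a) ^ j) = (q ^ a) ^ n - 1"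
      by (rule power_diff_1_eq[symmetric])
    also have "(q ^ a) ^ n = (q ^ n) ^ a" by (simp only: power_mult[symmetric] mult.commute)
    also have "\<dots> - 1 = 0" by (simp add: q_pow_n)
    finally show ?thesis using False by (simp add: poly)
  qed
  then have "(\<lambda>a. q ^ a) ` {..<n} \<subseteq> {x. poly P x = 0}" by auto
  then have "card ((\<lambda>a. q ^ a) ` {..<n}) \<le> card {x. poly P x = 0}"
    by (intro card_mono poly_roots_finite P0)
  also have "\<dots> \<le> degree P" by (rule card_poly_roots_bound) (rule P0)
  also note degP
  finally have "card ((\<lambda>a. q ^ a) ` {..<n}) \<le> n - 1" .
  moreover have "inj_on (\<lambda>a. q ^ a) {..<n}"
  proof (rule inj_onI)
    fix a b assume "a \<in> {..<n}" "b \<in> {..<n}" "q ^ a = q ^ b"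
    then have "q ^ a * p ^ b = (q * p) ^ b" by (simp add: power_mult_distrib)
    then show "a = b" using qp_pow_eq_one_iff[of a b] \<open>a \<in> {..<n}\<close> \<open>b \<in> {..<n}\<close> by (simp add: qp)
  qed
  then have "card ((\<lambda>a. q ^ a) ` {..<n}) = n" by (simp add: card_image)
  ultimately show False using n_pos by linarith
qed

lemma character_sum:
  "(\<Sum>t<n. q ^ (s * t) * p ^ (u * t)) = (if s mod n = u mod n then of_nat n else 0)"
proof -
  define x where "x = q ^ s * p ^ u"
  have x: "q ^ (s * t) * p ^ (u * t) = x ^ t" for t
    by (simp add: x_def power_mult power_mult_distrib)
  have "x ^ n = (q ^ n) ^ s * (p ^ n) ^ u"
    unfolding x_def power_mult_distrib by (simp only: power_mult[symmetric] mult.commute)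
  then have "x ^ n = 1" by (simp add: q_pow_n p_pow_n)
  then have "(x - 1) * (\<Sum>t<n. x ^ t) = 0" using power_diff_1_eq[of x n] by simp
  moreover have "x = 1 \<longleftrightarrow> s mod n = u mod n" by (simp add: x_def qp_pow_eq_one_iff)
  ultimately show ?thesis by (cases "x = 1") (auto simp: x)
qed

definition taft_pairs :: "'k mat_pair set" where
  "taft_pairs = {(d,G,H). G \<in> carrier_mat d d \<and> H \<in> carrier_mat d d \<and> G ^\<^sub>m n = 1\<^sub>m d \<and>
    H ^\<^sub>m n = 0\<^sub>m d d \<and> H * G = q \<cdot>\<^sub>m (G * H)}"

fun pair_hom :: "'k mat_pair \<Rightarrow> 'k mat_pair \<Rightarrow> 'k mat \<Rightarrow> bool" where
  "pair_hom (d,G,H) (e,G',H') A \<longleftrightarrow> A \<in> carrier_mat e d \<and> A * G = G' * A \<and> A * H = H' * A"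

definition pair_iso :: "'k mat_pair \<Rightarrow> 'k mat_pair \<Rightarrow> bool" where
  "pair_iso M N \<longleftrightarrow> (\<exists>A B. pair_hom M N A \<and> pair_hom N M B \<and> A * B = 1\<^sub>m (fst N) \<and> B * A = 1\<^sub>m (fst M))"

text \<open>The direct sum of \<open>M\<close> and \<open>N\<close>, expressed by injections and projections. Tensor products act on
  these four maps directly, and explicit decompositions are given by them.\<close>

definition biprod :: "'k mat_pair \<Rightarrow> 'k mat_pair \<Rightarrow> 'k mat_pair \<Rightarrow> bool" where
  "biprod M N S \<longleftrightarrow> (\<exists>A1 B1 A2 B2. pair_hom M S A1 \<and> pair_hom S M B1 \<and> pair_hom N S A2 \<and> pair_hom S N B2 \<and>
    B1 * A1 = 1\<^sub>m (fst M) \<and> B1 * A2 = 0\<^sub>m (fst M) (fst N) \<and> B2 * A1 = 0\<^sub>m (fst N) (fst M) \<and>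
    B2 * A2 = 1\<^sub>m (fst N) \<and> A1 * B1 + A2 * B2 = 1\<^sub>m (fst S))"

fun pair_dsum :: "'k mat_pair \<Rightarrow> 'k mat_pair \<Rightarrow> 'k mat_pair" where
  "pair_dsum (d,G,H) (e,G',H') =
    (d + e, four_block_mat G (0\<^sub>m d e) (0\<^sub>m e d) G', four_block_mat H (0\<^sub>m d e) (0\<^sub>m e d) H')"

definition zero_pair :: "'k mat_pair" where "zero_pair = (0, 0\<^sub>m 0 0, 0\<^sub>m 0 0)"

lemma pow_commute_pair_hom:
  assumes "A * G = G' * A" "A \<in> carrier_mat e d" "G \<in> carrier_mat d d" "G' \<in> carrier_mat e (e::nat)"
  shows "A * G ^\<^sub>m k = G' ^\<^sub>m k * (A :: 'k mat)"
proof (induction k)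
  case 0
  then show ?case using assms by simp
next
  case (Suc k)
  have "A * G ^\<^sub>m Suc k = (A * G ^\<^sub>m k) * G" using assms by (simp add: mat_assoc)
  also have "\<dots> = G' ^\<^sub>m k * (A * G)" using assms by (simp add: Suc mat_assoc)
  also have "\<dots> = G' ^\<^sub>m k * (G' * A)" by (simp add: assms(1))
  also have "\<dots> = G' ^\<^sub>m Suc k * A" using assms by (simp add: mat_assoc)
  finally show ?case .
qed

lemma taft_pairsD:
  assumes "(d,G,H) \<in> taft_pairs"
  shows "G \<in> carrier_mat d d" "H \<in> carrier_mat d d" "dim_row G = d" "dim_col G = d"
    "dim_row H = d" "dim_col H = d"
    "G ^\<^sub>m n = 1\<^sub>m d" "H ^\<^sub>m n = 0\<^sub>m d d" "H * G = q \<cdot>\<^sub>m (G * H)"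
  using assms by (auto simp: taft_pairs_def)

lemma pair_hom_one: "M \<in> taft_pairs \<Longrightarrow> pair_hom M M (1\<^sub>m (fst M))"
  by (cases M) (auto simp: taft_pairs_def)

lemma pair_hom_comp:
  assumes "pair_hom M N A" "pair_hom N L B" "M \<in> taft_pairs" "N \<in> taft_pairs" "L \<in> taft_pairs"
  shows "pair_hom M L (B * A)"
proof -
  obtain d G H d' G' H' d'' G'' H'' where [simp]: "M = (d,G,H)" "N = (d',G',H')" "L = (d'',G'',H'')"
    by (metis prod.collapse)
  have h: "A * G = G' * A" "A * H = H' * A" "B * G' = G'' * B" "B * H' = H'' * B"
    and car: "A \<in> carrier_mat d' d" "B \<in> carrier_mat d'' d'" using assms by auto
  have [simp]: "dim_row A = d'" "dim_col A = d" "dim_row B = d''" "dim_col B = d'" using car by auto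
  note [simp] = taft_pairsD(3-6)[OF assms(3)[simplified]] taft_pairsD(3-6)[OF assms(4)[simplified]]
    taft_pairsD(3-6)[OF assms(5)[simplified]]
  have "B * A * G = (B * G') * A" "B * A * H = (B * H') * A" by (simp_all add: mat_assoc h(1,2))
  then show ?thesis using car by (simp add: h mat_assoc)
qed

lemma pair_iso_refl: "M \<in> taft_pairs \<Longrightarrow> pair_iso M M"
  unfolding pair_iso_def using pair_hom_one by fastforce

lemma pair_iso_sym: "pair_iso M N \<Longrightarrow> pair_iso N M"
  unfolding pair_iso_def by blast

lemma biprod_commute:
  assumes "biprod M N S" shows "biprod N M S"
proof -
  obtain A1 B1 A2 B2 where h: "pair_hom M S A1" "pair_hom S M B1" "pair_hom N S A2" "pair_hom S N B2"
    "B1 * A1 = 1\<^sub>m (fst M)" "B1 * A2 = 0\<^sub>m (fst M) (fst N)" "B2 * A1 = 0\<^sub>m (fst N) (fst M)"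
    "B2 * A2 = 1\<^sub>m (fst N)" "A1 * B1 + A2 * B2 = 1\<^sub>m (fst S)"
    using assms unfolding biprod_def by blast
  have "A2 * B2 + A1 * B1 = A1 * B1 + A2 * B2"
    using h(1-4) by (cases M; cases N; cases S) (auto intro!: comm_add_mat[of _ "fst S" "fst S"])
  then show ?thesis unfolding biprod_def using h by metis
qed

lemma zero_taft_pair: "zero_pair \<in> taft_pairs"
  by (auto simp: taft_pairs_def zero_pair_def intro!: eq_matI)

text \<open>An isomorphism is a direct sum decomposition with second summand \<open>0\<close>, so that additive
  invariants are invariant under isomorphism.\<close>

lemma pair_iso_biprod_zero_pair:
  assumes "pair_iso M N" "M \<in> taft_pairs" "N \<in> taft_pairs"
  shows "biprod M zero_pair N"
proof -
  obtain A B where h: "pair_hom M N A" "pair_hom N M B" "A * B = 1\<^sub>m (fst N)" "B * A = 1\<^sub>m (fst M)"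
    using assms(1) unfolding pair_iso_def by blast
  show ?thesis unfolding biprod_def
    by (rule exI[of _ A], rule exI[of _ B], rule exI[of _ "0\<^sub>m (fst N) 0"],
        rule exI[of _ "0\<^sub>m 0 (fst N)"]) 
      (use h assms in \<open>cases M; cases N; auto simp: zero_pair_def taft_pairs_def intro!: eq_matI\<close>)
qed

text \<open>The stacked maps are inverse to each other, so both inequalities follow from \<open>mat_id_factor_le\<close>.\<close>

lemma biprod_dim:
  assumes "biprod M N S" shows "fst S = fst M + fst N"
proof -
  obtain A1 B1 A2 B2 where h: "pair_hom M S A1" "pair_hom S M B1" "pair_hom N S A2" "pair_hom S N B2"
    "B1 * A1 = 1\<^sub>m (fst M)" "B1 * A2 = 0\<^sub>m (fst M) (fst N)" "B2 * A1 = 0\<^sub>m (fst N) (fst M)"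
    "B2 * A2 = 1\<^sub>m (fst N)" "A1 * B1 + A2 * B2 = 1\<^sub>m (fst S)"
    using assms unfolding biprod_def by blast
  have car: "A1 \<in> carrier_mat (fst S) (fst M)" "B1 \<in> carrier_mat (fst M) (fst S)"
    "A2 \<in> carrier_mat (fst S) (fst N)" "B2 \<in> carrier_mat (fst N) (fst S)"
    using h(1-4) by (cases M; cases N; cases S; simp)+
  have "vcat B1 B2 * hcat A1 A2 = 1\<^sub>m (fst M + fst N)"
    using car h by (subst vcat_mult_hcat) auto
  then have "fst M + fst N \<le> fst S" using car by (rule_tac mat_id_factor_le[rotated -1]) auto
  moreover have "hcat A1 A2 * vcat B1 B2 = 1\<^sub>m (fst S)"
    using car h by (subst hcat_mult_vcat) auto
  then have "fst S \<le> fst M + fst N" using car by (rule_tac mat_id_factor_le[rotated -1]) auto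
  ultimately show ?thesis by simp
qed

lemma biprod_iso_pair_dsum:
  assumes "biprod M N S" "M \<in> taft_pairs" "N \<in> taft_pairs" "S \<in> taft_pairs"
  shows "pair_iso S (pair_dsum M N)"
proof -
  obtain d G H d' G' H' e K L where [simp]: "M = (d,G,H)" "N = (d',G',H')" "S = (e,K,L)"
    by (metis prod.collapse)
  note [simp] = taft_pairsD(3-6)[OF assms(2)[simplified]] taft_pairsD(3-6)[OF assms(3)[simplified]]
    taft_pairsD(3-6)[OF assms(4)[simplified]]
  obtain A1 B1 A2 B2 where h: "pair_hom M S A1" "pair_hom S M B1" "pair_hom N S A2" "pair_hom S N B2"
    "B1 * A1 = 1\<^sub>m (fst M)" "B1 * A2 = 0\<^sub>m (fst M) (fst N)" "B2 * A1 = 0\<^sub>m (fst N) (fst M)"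
    "B2 * A2 = 1\<^sub>m (fst N)" "A1 * B1 + A2 * B2 = 1\<^sub>m (fst S)"
    using assms(1) unfolding biprod_def by blast
  define P where "P = vcat B1 B2"
  define Q where "Q = hcat A1 A2"
  have [simp]: "dim_row A1 = e" "dim_col A1 = d" "dim_row A2 = e" "dim_col A2 = d'"
    "dim_row B1 = d" "dim_col B1 = e" "dim_row B2 = d'" "dim_col B2 = e"
    using h(1-4) by auto
  have [simp]: "dim_row P = d + d'" "dim_col P = e" "dim_row Q = e" "dim_col Q = d + d'"
    by (simp_all add: P_def Q_def)
  have PQ: "P * Q = 1\<^sub>m (d + d')" and QP: "Q * P = 1\<^sub>m e"
    using h by (simp_all add: P_def Q_def vcat_mult_hcat hcat_mult_vcat)
  have P: "P * K = four_block_mat G (0\<^sub>m d d') (0\<^sub>m d' d) G' * P"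
    "P * L = four_block_mat H (0\<^sub>m d d') (0\<^sub>m d' d) H' * P"
    using h(2,4) by (simp_all add: P_def vcat_mult block_diag_mult_vcat)
  have Q: "Q * Z' = Z * Q" if "P * Z = Z' * P" "Z \<in> carrier_mat e e" "Z' \<in> carrier_mat (d+d') (d+d')" for Z Z'
  proof -
    have "Q * Z' = Q * (Z' * (P * Q))" using that by (simp add: PQ mat_one_r)
    also have "\<dots> = (Q * (Z' * P)) * Q" using that by (simp add: mat_assoc)
    also have "\<dots> = (Q * P) * Z * Q" using that by (simp add: mat_assoc flip: that(1))
    also have "\<dots> = Z * Q" using that by (simp add: QP mat_one_l)
    finally show ?thesis .
  qed
  show ?thesis unfolding pair_iso_def
    by (rule exI[of _ P], rule exI[of _ Q]) (auto simp: PQ QP P intro!: Q)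
qed

lemma pair_dsum_biprod:
  assumes "M \<in> taft_pairs" "N \<in> taft_pairs"
  shows "biprod M N (pair_dsum M N)"
proof -
  obtain d G H d' G' H' where [simp]: "M = (d,G,H)" "N = (d',G',H')" by (metis prod.collapse)
  note [simp] = taft_pairsD(3-6)[OF assms(1)[simplified]] taft_pairsD(3-6)[OF assms(2)[simplified]]
  have L: "vcat (1\<^sub>m d) (0\<^sub>m d' d) * Z = four_block_mat Z (0\<^sub>m d d') (0\<^sub>m d' d) Z' * vcat (1\<^sub>m d) (0\<^sub>m d' d)"
    "vcat (0\<^sub>m d d') (1\<^sub>m d') * Z' = four_block_mat Z (0\<^sub>m d d') (0\<^sub>m d' d) Z' * vcat (0\<^sub>m d d') (1\<^sub>m d')"
    if "Z \<in> carrier_mat d d" "Z' \<in> carrier_mat d' d'" for Z Z' :: "'k mat"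
    using that by (simp_all add: vcat_mult block_diag_mult_vcat mat_ring)
  have bd: "four_block_mat Z (0\<^sub>m d d') (0\<^sub>m d' d) Z' = vcat (hcat Z (0\<^sub>m d d')) (hcat (0\<^sub>m d' d) Z')"
    if "Z \<in> carrier_mat d d" "Z' \<in> carrier_mat d' d'" for Z Z' :: "'k mat"
    using that by (intro eq_matI) (auto simp: vcat_def hcat_def)
  have R: "hcat (1\<^sub>m d) (0\<^sub>m d d') * four_block_mat Z (0\<^sub>m d d') (0\<^sub>m d' d) Z' = Z * hcat (1\<^sub>m d) (0\<^sub>m d d')"
    "hcat (0\<^sub>m d' d) (1\<^sub>m d') * four_block_mat Z (0\<^sub>m d d') (0\<^sub>m d' d) Z' = Z' * hcat (0\<^sub>m d' d) (1\<^sub>m d')"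
    if "Z \<in> carrier_mat d d" "Z' \<in> carrier_mat d' d'" for Z Z' :: "'k mat"
    using that by (simp_all add: bd[OF that] hcat_mult_vcat mult_hcat mat_ring mat_add_zero hcat_zero)
  have id: "vcat (1\<^sub>m d) (0\<^sub>m d' d) * hcat (1\<^sub>m d) (0\<^sub>m d d') + vcat (0\<^sub>m d d') (1\<^sub>m d') * hcat (0\<^sub>m d'
    d) (1\<^sub>m d') = (1\<^sub>m (d + d') :: 'k mat)"
    by (subst (1 2) vcat_mult_hcat) (auto intro!: eq_matI)
  have C: "G \<in> carrier_mat d d" "H \<in> carrier_mat d d" "G' \<in> carrier_mat d' d'" "H' \<in> carrier_mat d' d'"
    using assms by (simp_all add: taft_pairs_def)
  have cv: "vcat (1\<^sub>m d) (0\<^sub>m d' d) \<in> carrier_mat (d + d') d" "hcat (1\<^sub>m d) (0\<^sub>m d d') \<in> carrier_mat d (d + d')"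
    "vcat (0\<^sub>m d d') (1\<^sub>m d') \<in> carrier_mat (d + d') d'" "hcat (0\<^sub>m d' d) (1\<^sub>m d') \<in> carrier_mat d' (d + d')"
    by (auto intro!: carrier_matI)
  have t: "pair_hom M (pair_dsum M N) (vcat (1\<^sub>m d) (0\<^sub>m d' d))" "pair_hom (pair_dsum M N) M (hcat (1\<^sub>m
    d) (0\<^sub>m d d'))"
    "pair_hom N (pair_dsum M N) (vcat (0\<^sub>m d d') (1\<^sub>m d'))" "pair_hom (pair_dsum M N) N (hcat (0\<^sub>m d' d) (1\<^sub>m d'))"
    unfolding \<open>M = _\<close> \<open>N = _\<close> pair_dsum.simps pair_hom.simps
    using cv L[OF C(1,3)] L[OF C(2,4)] R[OF C(1,3)] R[OF C(2,4)] by blast+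
  show ?thesis unfolding biprod_def
    by (intro exI conjI, rule t(1), rule t(2), rule t(3), rule t(4))
      (simp_all add: id hcat_mult_vcat mat_ring mat_add_zero)
qed

section \<open>Eigenspaces of G and additive invariants\<close>

text \<open>This is \<open>n\<close> times the projection onto the eigenspace of \<open>G\<close> for \<open>p\<^sup>s\<close>. Being a polynomial in \<open>G\<close>, it
  commutes with intertwiners.\<close>

definition eproj :: "'k mat \<Rightarrow> nat \<Rightarrow> 'k mat" where
  "eproj G s = mat (dim_row G) (dim_row G) (\<lambda>(i,j). \<Sum>t<n. q ^ (s * t) * (G ^\<^sub>m t) $$ (i,j))"

lemma dim_eproj[simp]: "dim_row (eproj G s) = dim_row G" "dim_col (eproj G s) = dim_row G"
  by (simp_all add: eproj_def)

lemma mult_eproj: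
  assumes "A \<in> carrier_mat e d" "G \<in> carrier_mat d d" "i < e" "j < d"
  shows "(A * eproj G s) $$ (i,j) = (\<Sum>t<n. q ^ (s * t) * (A * G ^\<^sub>m t) $$ (i,j))"
proof -
  have "(A * eproj G s) $$ (i,j) = (\<Sum>k<d. \<Sum>t<n. A $$ (i,k) * (q ^ (s * t) * (G ^\<^sub>m t) $$ (k,j)))"
    using assms by (subst mult_entry) (auto simp: eproj_def sum_distrib_left)
  also have "\<dots> = (\<Sum>t<n. \<Sum>k<d. A $$ (i,k) * (q ^ (s * t) * (G ^\<^sub>m t) $$ (k,j)))"
    by (rule sum.swap)
  also have "\<dots> = (\<Sum>t<n. q ^ (s * t) * (A * G ^\<^sub>m t) $$ (i,j))"
    using assms by (intro sum.cong refl, subst mult_entry) (auto simp: sum_distrib_left mult.left_commute)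
  finally show ?thesis .
qed

lemma eproj_mult:
  assumes "A \<in> carrier_mat d e" "G \<in> carrier_mat d d" "i < d" "j < e"
  shows "(eproj G s * A) $$ (i,j) = (\<Sum>t<n. q ^ (s * t) * (G ^\<^sub>m t * A) $$ (i,j))"
proof -
  have "(eproj G s * A) $$ (i,j) = (\<Sum>k<d. \<Sum>t<n. (q ^ (s * t) * (G ^\<^sub>m t) $$ (i,k)) * A $$ (k,j))"
    using assms by (subst mult_entry) (auto simp: eproj_def sum_distrib_right)
  also have "\<dots> = (\<Sum>t<n. \<Sum>k<d. (q ^ (s * t) * (G ^\<^sub>m t) $$ (i,k)) * A $$ (k,j))"
    by (rule sum.swap)
  also have "\<dots> = (\<Sum>t<n. q ^ (s * t) * (G ^\<^sub>m t * A) $$ (i,j))"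
    using assms by (intro sum.cong refl, subst mult_entry) (auto simp: sum_distrib_left mult.assoc)
  finally show ?thesis .
qed

lemma eproj_pair_hom:
  assumes "A * G = G' * A" "A \<in> carrier_mat e d" "G \<in> carrier_mat d d" "G' \<in> carrier_mat e e"
  shows "A * eproj G s = eproj G' s * A"
proof (rule eq_matI)
  fix i j assume "i < dim_row (eproj G' s * A)" "j < dim_col (eproj G' s * A)"
  then have ij: "i < e" "j < d" using assms by auto
  show "(A * eproj G s) $$ (i,j) = (eproj G' s * A) $$ (i,j)"
    by (simp only: mult_eproj[OF assms(2,3) ij] eproj_mult[OF assms(2,4) ij] pow_commute_pair_hom[OF assms])
qed (use assms in auto)

lemma eproj_eigenvector:
  assumes "G * V = p ^ u \<cdot>\<^sub>m V" "G \<in> carrier_mat d d" "V \<in> carrier_mat d e"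
  shows "eproj G s * V = (if s mod n = u mod n then of_nat n else 0) \<cdot>\<^sub>m V"
proof -
  have pow: "G ^\<^sub>m t * V = p ^ (u * t) \<cdot>\<^sub>m V" for t
  proof (induction t)
    case 0 then show ?case using assms by (auto intro!: eq_matI simp: mat_one_l)
  next
    case (Suc t)
    have "G ^\<^sub>m Suc t * V = G ^\<^sub>m t * (G * V)" using assms by (simp add: mat_assoc)
    also have "\<dots> = p ^ u \<cdot>\<^sub>m (G ^\<^sub>m t * V)" using assms by (simp add: mat_smult_r)
    finally show ?case by (simp add: Suc power_add smult_smult_mat)
  qed
  show ?thesis
  proof (rule eq_matI)
    fix i j assume "i < dim_row ((if s mod n = u mod n then of_nat n else 0) \<cdot>\<^sub>m V)"
      "j < dim_col ((if s mod n = u mod n then of_nat n else 0) \<cdot>\<^sub>m V)"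
    then have ij: "i < d" "j < e" using assms by auto
    have "(eproj G s * V) $$ (i,j) = (\<Sum>t<n. q ^ (s * t) * p ^ (u * t) * V $$ (i,j))"
      using assms ij by (simp only: eproj_mult[OF assms(3,2) ij] pow) (simp add: mult.assoc)
    also have "\<dots> = (\<Sum>t<n. q ^ (s * t) * p ^ (u * t)) * V $$ (i,j)" by (simp add: sum_distrib_right)
    finally show "(eproj G s * V) $$ (i,j) = ((if s mod n = u mod n then of_nat n else 0) \<cdot>\<^sub>m V) $$ (i,j)"
      using ij assms(3) by (simp add: character_sum)
  qed (use assms in auto)
qed

text \<open>Multiplication by \<open>G\<close> shifts the summation index by one, up to the factor \<open>p\<^sup>s\<close>; since the summand
  for \<open>t = n\<close> equals the one for \<open>t = 0\<close>, the shift does not change the sum.\<close>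

lemma eproj_weight:
  assumes "G \<in> carrier_mat d d" "G ^\<^sub>m n = 1\<^sub>m d"
  shows "G * eproj G s = p ^ s \<cdot>\<^sub>m eproj G s" "eproj G s * G = p ^ s \<cdot>\<^sub>m eproj G s"
proof -
  show 1: "eproj G s * G = p ^ s \<cdot>\<^sub>m eproj G s"
  proof (rule eq_matI)
    fix i j assume "i < dim_row (p ^ s \<cdot>\<^sub>m eproj G s)" "j < dim_col (p ^ s \<cdot>\<^sub>m eproj G s)"
    then have ij: "i < d" "j < d" using assms by auto
    define f where "f t = q ^ (s * t) * (G ^\<^sub>m t) $$ (i,j)" for t
    have "q ^ (s * n) = (q ^ n) ^ s" by (simp only: power_mult[symmetric] mult.commute)
    then have "f n = f 0" using assms by (simp add: f_def q_pow_n)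
    have "(eproj G s * G) $$ (i,j) = (\<Sum>t<n. q ^ (s * t) * (G ^\<^sub>m Suc t) $$ (i,j))"
      by (simp only: eproj_mult[OF assms(1,1) ij] pow_mat.simps)
    also have "\<dots> = (\<Sum>t<n. p ^ s * f (Suc t))"
    proof (rule sum.cong[OF refl])
      fix t
      have "p ^ s * q ^ (s * Suc t) = (p * q) ^ s * q ^ (s * t)"
        by (simp add: power_add power_mult_distrib)
      then show "q ^ (s * t) * (G ^\<^sub>m Suc t) $$ (i,j) = p ^ s * f (Suc t)"
        by (simp only: f_def mult.assoc[symmetric]) (simp add: pq)
    qed
    also have "\<dots> = p ^ s * (\<Sum>t<n. f (Suc t))" by (simp add: sum_distrib_left)
    also have "(\<Sum>t<n. f (Suc t)) = (\<Sum>t<n. f t)"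
      using sum.lessThan_Suc_shift[of f n] \<open>f n = f 0\<close> by simp
    finally show "(eproj G s * G) $$ (i,j) = (p ^ s \<cdot>\<^sub>m eproj G s) $$ (i,j)"
      using ij assms by (simp add: eproj_def f_def)
  qed (use assms in auto)
  have "G * eproj G s = eproj G s * G" by (rule eproj_pair_hom[of _ _ _ d d]) (use assms in auto)
  with 1 show "G * eproj G s = p ^ s \<cdot>\<^sub>m eproj G s" by simp
qed

text \<open>The sum of all \<open>eproj G s\<close> is \<open>n\<close> times the identity, and \<open>n \<noteq> 0\<close> in the field.\<close>

lemma eproj_complete:
  assumes "K \<in> carrier_mat e d" "G \<in> carrier_mat d d" and 0: "\<And>s. s < n \<Longrightarrow> K * eproj G s = 0\<^sub>m e d"
  shows "K = 0\<^sub>m e d"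
proof (rule eq_matI)
  fix i j assume "i < dim_row (0\<^sub>m e d)" "j < dim_col (0\<^sub>m e d)"
  then have ij: "i < e" "j < d" by auto
  have "0 = (\<Sum>s<n. (K * eproj G s) $$ (i,j))" using ij by (simp add: 0)
  also have "\<dots> = (\<Sum>s<n. \<Sum>t<n. q ^ (s * t) * (K * G ^\<^sub>m t) $$ (i,j))"
    by (simp only: mult_eproj[OF assms(1,2) ij])
  also have "\<dots> = (\<Sum>t<n. \<Sum>s<n. q ^ (s * t) * (K * G ^\<^sub>m t) $$ (i,j))" by (rule sum.swap)
  also have "\<dots> = (\<Sum>t<n. (if t = 0 then of_nat n else 0) * (K * G ^\<^sub>m t) $$ (i,j))"
  proof (rule sum.cong[OF refl])
    fix t assume "t \<in> {..<n}"
    then have "(\<Sum>s<n. q ^ (t * s)) = (if t = 0 then of_nat n else 0)"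
      using character_sum[of t 0] by simp
    then show "(\<Sum>s<n. q ^ (s * t) * (K * G ^\<^sub>m t) $$ (i,j)) = (if t =
      0 then of_nat n else 0) * (K * G ^\<^sub>m t) $$ (i,j)"
      by (simp only: sum_distrib_right[symmetric] mult.commute[of _ t])
  qed
  also have "\<dots> = of_nat n * (K * G ^\<^sub>m 0) $$ (i,j)"
    by (subst sum.remove[of _ 0]) auto
  also have "K * G ^\<^sub>m 0 = K" using assms by (simp add: mat_one_r)
  finally show "K $$ (i,j) = 0\<^sub>m e d $$ (i,j)" using ij by simp
qed (use assms in auto)

text \<open>The dimension of \<open>H\<^sup>j V\<^sub>s\<close>, where \<open>V\<^sub>s\<close> is the eigenspace of \<open>G\<close> for \<open>p\<^sup>s\<close>.\<close>

fun layer_rank :: "nat \<Rightarrow> nat \<Rightarrow> 'k mat_pair \<Rightarrow> nat" where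
  "layer_rank j s (d,G,H) = mrank (H ^\<^sub>m j * eproj G s)"

lemma layer_rank_biprod:
  assumes "biprod M N S" "M \<in> taft_pairs" "N \<in> taft_pairs" "S \<in> taft_pairs"
  shows "layer_rank j s S = layer_rank j s M + layer_rank j s N"
proof -
  obtain d G H d' G' H' e K L where [simp]: "M = (d,G,H)" "N = (d',G',H')" "S = (e,K,L)"
    by (metis prod.collapse)
  obtain A1 B1 A2 B2 where h: "pair_hom M S A1" "pair_hom S M B1" "pair_hom N S A2" "pair_hom S N B2"
    "B1 * A1 = 1\<^sub>m d" "B1 * A2 = 0\<^sub>m d d'" "B2 * A1 = 0\<^sub>m d' d"
    "B2 * A2 = 1\<^sub>m d'" "A1 * B1 + A2 * B2 = 1\<^sub>m e"
    using assms(1) unfolding biprod_def by auto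
  have tw: "(L ^\<^sub>m j * eproj K s) * A = A * (Z ^\<^sub>m j * eproj Y s)"
    if "pair_hom (c,Y,Z) (e,K,L) A" "(c,Y,Z) \<in> taft_pairs" for A c Y Z
  proof -
    note [simp] = taft_pairsD(3-6)[OF that(2)] taft_pairsD(3-6)[OF assms(4)[simplified]]
    have A: "A \<in> carrier_mat e c" "A * Y = K * A" "A * Z = L * A" using that(1) by auto
    have [simp]: "dim_row A = e" "dim_col A = c" using A by auto
    have "(L ^\<^sub>m j * eproj K s) * A = L ^\<^sub>m j * (A * eproj Y s)"
      using eproj_pair_hom[OF A(2,1), of s] taft_pairsD(1)[OF that(2)] taft_pairsD(1)[OF assms(4)[simplified]]
      by (simp add: mat_assoc)
    also have "\<dots> = (A * Z ^\<^sub>m j) * eproj Y s"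
      using pow_commute_pair_hom[OF A(3,1), of j] taft_pairsD(2)[OF that(2)] taft_pairsD(2)[OF
        assms(4)[simplified]]
      by (simp add: mat_assoc)
    finally show ?thesis by (simp add: mat_assoc)
  qed
  note c = taft_pairsD(1,2)[OF assms(2)[simplified]] taft_pairsD(1,2)[OF assms(3)[simplified]]
    taft_pairsD(1,2)[OF assms(4)[simplified]]
  have ep: "eproj X' s \<in> carrier_mat m m" if "X' \<in> carrier_mat m m" for X' m
    using that by (auto intro!: carrier_matI)
  have "has_rank (L ^\<^sub>m j * eproj K s) (mrank (H ^\<^sub>m j * eproj G s) + mrank (H' ^\<^sub>m j * eproj G' s))"
  proof (rule has_rank_additive[where ?A1.0 = A1 and ?A2.0 = A2 and ?B1.0 = B1 and ?B2.0 = B2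
      and ?E1.0 = "H ^\<^sub>m j * eproj G s" and ?E2.0 = "H' ^\<^sub>m j * eproj G' s"])
    show "has_rank (H ^\<^sub>m j * eproj G s) (mrank (H ^\<^sub>m j * eproj G s))"
      "has_rank (H' ^\<^sub>m j * eproj G' s) (mrank (H' ^\<^sub>m j * eproj G' s))"
      using mrank_eq_iff by blast+
    show "L ^\<^sub>m j * eproj K s * A1 = A1 * (H ^\<^sub>m j * eproj G s)" using h(1) assms(2) by (intro tw) auto
    show "L ^\<^sub>m j * eproj K s * A2 = A2 * (H' ^\<^sub>m j * eproj G' s)" using h(3) assms(3) by (intro tw) auto
  qed (use h c in \<open>auto intro!: mult_carrier_mat[OF _ ep]\<close>)
  then show ?thesis by (simp add: mrank_eq_iff)
qed

section \<open>Chains and their multiplicities\<close>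

definition chainG :: "nat \<Rightarrow> nat \<Rightarrow> 'k mat" where
  "chainG l i = mat l l (\<lambda>(a,b). if a = b then p ^ (i + a) else 0)"

definition chainH :: "nat \<Rightarrow> 'k mat" where
  "chainH l = mat l l (\<lambda>(a,b). if a = Suc b then 1 else 0)"

text \<open>The chain of length \<open>l\<close> with basis \<open>v\<^sub>0, \<dots>, v\<^sub>l\<^sub>-\<^sub>1\<close>, where \<open>G v\<^sub>j = p\<^sup>i\<^sup>+\<^sup>j v\<^sub>j\<close> and \<open>H v\<^sub>j = v\<^sub>j\<^sub>+\<^sub>1\<close> (with
  \<open>v\<^sub>l = 0\<close>). Length \<open>0\<close> is the zero module, in accordance with the value \<open>0\<close> of \<open>f_poly 0\<close>.\<close>

definition chain :: "nat \<Rightarrow> nat \<Rightarrow> 'k mat_pair" where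
  "chain l i = (l, chainG l i, chainH l)"

lemma dim_chain[simp]: "dim_row (chainG l i) = l" "dim_col (chainG l i) = l"
  "dim_row (chainH l) = l" "dim_col (chainH l) = l" "fst (chain l i) = l"
  by (simp_all add: chainG_def chainH_def chain_def)

lemma chainG_pow: "chainG l i ^\<^sub>m t = mat l l (\<lambda>(a,b). if a = b then p ^ ((i + a) * t) else 0)"
proof (induction t)
  case 0
  then show ?case by (auto intro!: eq_matI)
next
  case (Suc t)
  show ?case unfolding pow_mat.simps Suc
  proof (rule eq_matI)
    fix a b assume "a < dim_row (mat l l (\<lambda>(a,b). if a = b then p ^ ((i + a) * Suc t) else 0))"
      "b < dim_col (mat l l (\<lambda>(a,b). if a = b then p ^ ((i + a) * Suc t) else 0))"
    then have "a < l" "b < l" by auto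
    then show "(mat l l (\<lambda>(a,b). if a = b then p ^ ((i + a) * t) else 0) * chainG l i) $$ (a,b) =
      mat l l (\<lambda>(a,b). if a = b then p ^ ((i + a) * Suc t) else 0) $$ (a,b)"
      by (subst mult_entry) (auto simp: chainG_def if_distrib[of "\<lambda>x. _ * x"] power_add mult.commute
        cong: if_cong)
  qed auto
qed

lemma chainH_pow: "chainH l ^\<^sub>m t = mat l l (\<lambda>(a,b). if a = b + t then 1 else 0)"
proof (induction t)
  case 0
  then show ?case by (auto intro!: eq_matI)
next
  case (Suc t)
  show ?case unfolding pow_mat.simps Suc
  proof (rule eq_matI)
    fix a b assume "a < dim_row (mat l l (\<lambda>(a,b). if a = b + Suc t then 1 else 0::'k))"
      "b < dim_col (mat l l (\<lambda>(a,b). if a = b + Suc t then 1 else 0::'k))"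
    then have "a < l" "b < l" by auto
    then show "(mat l l (\<lambda>(a,b). if a = b + t then 1 else 0) * chainH l) $$ (a,b) =
      mat l l (\<lambda>(a,b). if a = b + Suc t then 1 else 0) $$ (a,b)"
      by (subst mult_entry) (auto simp: chainH_def if_distrib[of "\<lambda>x. _ * x"] cong: if_cong)
  qed auto
qed

lemma chain_taft_pair: assumes "l \<le> n" shows "chain l i \<in> taft_pairs"
proof -
  have "p ^ (m * n) = 1" for m using power_mult[of p n m] p_pow_n by (simp add: mult.commute)
  then have "chainG l i ^\<^sub>m n = 1\<^sub>m l" by (auto intro!: eq_matI simp: chainG_pow)
  moreover have "chainH l ^\<^sub>m n = 0\<^sub>m l l" using assms by (auto intro!: eq_matI simp: chainH_pow)
  moreover have "chainH l * chainG l i = q \<cdot>\<^sub>m (chainG l i * chainH l)"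
  proof (rule eq_matI)
    fix a b assume "a < dim_row (q \<cdot>\<^sub>m (chainG l i * chainH l))" "b < dim_col (q \<cdot>\<^sub>m (chainG l i * chainH l))"
    then have ab: "a < l" "b < l" by auto
    have 1: "(chainH l * chainG l i) $$ (a,b) = (if a = Suc b then p ^ (i + b) else 0)"
      using ab by (subst mult_entry) (auto simp: chainH_def chainG_def if_distrib[of "\<lambda>x. _ * x"] cong: if_cong)
    have 2: "(chainG l i * chainH l) $$ (a,b) = (if a = Suc b then p ^ (i + a) else 0)"
      using ab by (subst mult_entry) (auto simp: chainH_def chainG_def if_distrib[of "\<lambda>x. _ * x"] cong: if_cong)
    have 3: "q * p ^ (i + Suc b) = p ^ (i + b)" by (simp add: qp)
    show "(chainH l * chainG l i) $$ (a,b) = (q \<cdot>\<^sub>m (chainG l i * chainH l)) $$ (a,b)"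
      using ab by (subst index_smult_mat(1)) (auto simp: 1 2 3 simp del: index_mult_mat(1) power_Suc
        add_Suc_right)
  qed auto
  moreover have "chainG l i \<in> carrier_mat l l" "chainH l \<in> carrier_mat l l" by (rule carrier_matI; simp)+
  ultimately show ?thesis unfolding taft_pairs_def chain_def by blast
qed

lemma eproj_chain: "eproj (chainG l i) s =
    mat l l (\<lambda>(a,b). if a = b \<and> s mod n = (i + a) mod n then of_nat n else 0)"
proof (rule eq_matI)
  fix a b assume "a < dim_row (mat l l (\<lambda>(a,b). if a = b \<and> s mod n = (i + a) mod n then of_nat n else 0::'k))"
    "b < dim_col (mat l l (\<lambda>(a,b). if a = b \<and> s mod n = (i + a) mod n then of_nat n else 0::'k))"
  then have ab: "a < l" "b < l" by auto
  have "eproj (chainG l i) s $$ (a,b) = (\<Sum>t<n. q ^ (s * t) * (if a = b then p ^ ((i + a) * t) else 0))"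
    using ab by (simp add: eproj_def chainG_pow)
  also have "\<dots> = (if a = b then (\<Sum>t<n. q ^ (s * t) * p ^ ((i + a) * t)) else 0)" by simp
  finally show "eproj (chainG l i) s $$ (a,b) =
      mat l l (\<lambda>(a,b). if a = b \<and> s mod n = (i + a) mod n then of_nat n else 0) $$ (a,b)"
    using ab by (simp add: character_sum)
qed auto

text \<open>At most one basis vector of a chain of length at most \<open>n\<close> has weight \<open>s\<close>, namely \<open>v\<^sub>t\<close>, and \<open>H\<^sup>j\<close> kills
  it if and only if \<open>t + j \<ge> l\<close>.\<close>

lemma layer_rank_chain:
  assumes "l \<le> n" "t < n" "s mod n = (i + t) mod n"
  shows "layer_rank j s (chain l i) = (if t + j < l then 1 else 0)"
proof -
  let ?E = "chainH l ^\<^sub>m j * eproj (chainG l i) s"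
  have uniq: "s mod n = (i + b) mod n \<longleftrightarrow> b = t" if "b < l" for b
  proof
    assume "s mod n = (i + b) mod n"
    then have "(i + b) mod n = (i + t) mod n" using assms by simp
    then have "b mod n = t mod n" by (simp add: mod_add_cong nat_mod_eq_iff)
    then show "b = t" using that assms by simp
  qed (use assms in simp)
  have E: "?E = mat l l (\<lambda>(a,b). if a = t + j \<and> b = t then of_nat n else 0)"
  proof (rule eq_matI)
    fix a b assume "a < dim_row (mat l l (\<lambda>(a,b). if a = t + j \<and> b = t then of_nat n else 0::'k))"
      "b < dim_col (mat l l (\<lambda>(a,b). if a = t + j \<and> b = t then of_nat n else 0::'k))"
    then have ab: "a < l" "b < l" by auto
    have "?E $$ (a,b) = (\<Sum>k<l. (if a = k + j then 1 else 0) * (if k = b then (if s mod n =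
      (i + b) mod n then of_nat n else 0) else 0))"
    proof -
      have "?E $$ (a,b) = (\<Sum>k<l. (chainH l ^\<^sub>m j) $$ (a,k) * eproj (chainG l i) s $$ (k,b))"
        using ab by (subst mult_entry) simp_all
      also have "\<dots> = (\<Sum>k<l. (if a = k + j then 1 else 0) * (if k = b then (if s mod n =
        (i + b) mod n then of_nat n else 0) else 0))"
        by (rule sum.cong[OF refl]) (use ab in \<open>auto simp: chainH_pow eproj_chain\<close>)
      finally show ?thesis .
    qed
    also have "\<dots> = (if a = b + j then 1 else 0) * (if s mod n = (i + b) mod n then of_nat n else 0)"
      using ab by (simp add: if_distrib[of "\<lambda>x. _ * x"] cong: if_cong)
    finally show "?E $$ (a,b) = mat l l (\<lambda>(a,b). if a = t + j \<and> b = t then of_nat n else 0) $$ (a,b)"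
      using ab uniq[of b] by auto
  qed auto
  show ?thesis
  proof (cases "t + j < l")
    case True
    then have "has_rank ?E 1" unfolding E by (intro has_rank_single_entry) auto
    with True show ?thesis by (simp add: chain_def mrank_eq_iff)
  next
    case False
    then have "?E = 0\<^sub>m l l" unfolding E by (auto intro!: eq_matI)
    with False show ?thesis by (simp add: chain_def mrank_eq_iff has_rank_zero)
  qed
qed

text \<open>In a direct sum of chains, the difference of the first two ranks is the number of basis
  vectors \<open>v\<close> of weight \<open>i\<close> with \<open>H\<^sup>l\<^sup>-\<^sup>1 v \<noteq> 0 = H\<^sup>l v\<close>. Those that are not the first vector of their
  chain have a predecessor of weight \<open>i - 1\<close> that is killed by \<open>H\<^sup>l\<^sup>+\<^sup>1\<close> but not by \<open>H\<^sup>l\<close>, and are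
  subtracted. The index \<open>i + n - 1\<close> represents \<open>i - 1\<close> modulo \<open>n\<close>.\<close>

definition chain_mult :: "nat \<Rightarrow> nat \<Rightarrow> 'k mat_pair \<Rightarrow> int" where
  "chain_mult l i M = int (layer_rank (l - 1) i M) - int (layer_rank l i M)
     - int (layer_rank l (i + n - 1) M) + int (layer_rank (l + 1) (i + n - 1) M)"

lemma chain_mult_biprod:
  "\<lbrakk>biprod M N S; M \<in> taft_pairs; N \<in> taft_pairs; S \<in> taft_pairs\<rbrakk> \<Longrightarrow> chain_mult l i S =
    chain_mult l i M + chain_mult l i N"
  by (simp add: chain_mult_def layer_rank_biprod)

lemma chain_mult_chain:
  assumes "1 \<le> l" "i < n" "l' \<le> n" "i' < n"
  shows "chain_mult l i (chain l' i') = (if l = l' \<and> i = i' then 1 else 0)"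
proof -
  \<comment> \<open>The positions at which the weights i and i - 1 occur are called t and u.\<close>
  define t where "t = (i + n - i') mod n"
  have t: "t < n" by (simp add: t_def)
  have "(i' + t) mod n = (i' + (i + n - i')) mod n" by (simp add: t_def mod_add_right_eq)
  also have "\<dots> = i mod n" using assms by simp
  finally have t1: "i mod n = (i' + t) mod n" by simp
  have t0: "t = 0 \<longleftrightarrow> i = i'"
  proof (cases "i' \<le> i")
    case True
    then have "i + n - i' = (i - i') + n" by simp
    then have "t = i - i'" using assms unfolding t_def by (simp only: mod_add_self2) simp
    then show ?thesis using True by simp
  next
    case False
    then have "t = i + n - i'" using assms by (simp add: t_def)
    then show ?thesis using False assms by simp
  qed
  define u where "u = (if t = 0 then n - 1 else t - 1)"
  have u: "u < n" using t by (auto simp: u_def)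
  have "(i' + u) mod n = (i' + t + (n - 1)) mod n"
  proof (cases "t = 0")
    case False
    then have "i' + t + (n - 1) = (i' + u) + n" using n2 by (simp add: u_def)
    then show ?thesis by (simp only: mod_add_self2)
  qed (simp add: u_def)
  also have "\<dots> = ((i' + t) mod n + (n - 1)) mod n" by (simp only: mod_add_left_eq)
  also have "\<dots> = (i + (n - 1)) mod n" by (simp only: t1[symmetric] mod_add_left_eq)
  also have "i + (n - 1) = i + n - 1" using n2 by simp
  finally have u1: "(i + n - 1) mod n = (i' + u) mod n" by simp
  show ?thesis
    unfolding chain_mult_def layer_rank_chain[OF assms(3) t t1] layer_rank_chain[OF assms(3) u u1]
    using assms t u t0 by (auto simp: u_def)
qed

lemma chain_mod: "chain l (i mod n) = chain l i"
proof -
  show ?thesis by (auto simp: chain_def chainG_def power_add pow_mod intro!: eq_matI)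
qed

section \<open>Decomposition into chains\<close>

lemma q_commute_pow:
  assumes "V * Y = q \<cdot>\<^sub>m (Y * V)" "V \<in> carrier_mat d d" "Y \<in> carrier_mat d d"
  shows "V ^\<^sub>m t * Y = q ^ t \<cdot>\<^sub>m (Y * V ^\<^sub>m t)"
proof -
  have [simp]: "dim_row V = d" "dim_col V = d" "dim_row Y = d" "dim_col Y = d" using assms by auto
  show ?thesis
  proof (induction t)
    case 0 then show ?case by (auto simp: mat_ring intro!: eq_matI)
  next
    case (Suc t)
    have "V ^\<^sub>m Suc t * Y = q \<cdot>\<^sub>m ((V ^\<^sub>m t * Y) * V)"
      by (simp add: mat_assoc assms(1) mat_smult_r)
    also have "\<dots> = q ^ Suc t \<cdot>\<^sub>m (Y * V ^\<^sub>m Suc t)"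
      by (simp add: Suc mat_smult_l smult_smult_mat mat_assoc)
    finally show ?case .
  qed
qed

lemma H_pow_G:
  assumes "(d,G,H) \<in> taft_pairs"
  shows "H ^\<^sub>m t * G = q ^ t \<cdot>\<^sub>m (G * H ^\<^sub>m t)" "G * H ^\<^sub>m t = p ^ t \<cdot>\<^sub>m (H ^\<^sub>m t * G)"
proof -
  note [simp] = taft_pairsD(3-6)[OF assms]
  show 1: "H ^\<^sub>m t * G = q ^ t \<cdot>\<^sub>m (G * H ^\<^sub>m t)"
    by (rule q_commute_pow[OF taft_pairsD(9)[OF assms] taft_pairsD(2,1)[OF assms]])
  have "p ^ t * q ^ t = 1" by (simp add: pq flip: power_mult_distrib)
  then show "G * H ^\<^sub>m t = p ^ t \<cdot>\<^sub>m (H ^\<^sub>m t * G)" unfolding 1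
    by (auto simp: smult_smult_mat intro!: eq_matI)
qed

text \<open>The idempotent \<open>1 - A B\<close> commutes with the action, so its image, made explicit by
  \<open>idempotent_splits\<close>, is a complement of \<open>N\<close>.\<close>

lemma retract_summand:
  assumes "M \<in> taft_pairs" "N \<in> taft_pairs" "pair_hom N M A" "pair_hom M N B" "B * A = 1\<^sub>m (fst N)"
  obtains U where "U \<in> taft_pairs" "biprod N U M"
proof -
  obtain d G H m Y Z where [simp]: "M = (d,G,H)" "N = (m,Y,Z)" by (metis prod.collapse)
  note M = assms(1)[simplified] and N = assms(2)[simplified]
  note [simp] = taft_pairsD(3-6)[OF M] taft_pairsD(3-6)[OF N]
  have AB: "A \<in> carrier_mat d m" "A * Y = G * A" "A * Z = H * A"
    "B \<in> carrier_mat m d" "B * G = Y * B" "B * H = Z * B" "B * A = 1\<^sub>m m" using assms by auto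
  have [simp]: "dim_row A = d" "dim_col A = m" "dim_row B = m" "dim_col B = d" using AB by auto
  define E where "E = 1\<^sub>m d - A * B"
  have BAx: "B * (A * W) = W" if "dim_row W = m" for W
    using that AB(7) by (simp add: mat_one_l flip: mat_assoc)
  have [simp]: "dim_row E = d" "dim_col E = d" by (simp_all add: E_def)
  have BE: "B * E = 0\<^sub>m m d" by (simp add: E_def mat_ring BAx mat_minus_self)
  have EA: "E * A = 0\<^sub>m d m" by (simp add: E_def mat_ring AB(7) mat_minus_self)
  have "E * E = E - A * (B * E)" by (subst (1) E_def) (simp add: mat_ring)
  also have "\<dots> = E" by (auto simp: BE mat_zero_r intro!: eq_matI)
  finally have "E * E = E" .
  then obtain r C D where CD: "C \<in> carrier_mat d r" "D \<in> carrier_mat r d" "E = C * D" "D * C = 1\<^sub>m r"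
    by (rule idempotent_splits[rotated]) auto
  have [simp]: "dim_row C = d" "dim_col C = r" "dim_row D = r" "dim_col D = d" using CD by auto
  have "B * C = (B * E) * C" unfolding CD(3) by (simp add: mat_assoc CD(4) mat_one_r)
  then have BC: "B * C = 0\<^sub>m m r" by (simp add: BE mat_zero_l)
  have "D * A = D * (E * A)" unfolding CD(3) by (simp add: CD(4) mat_one_l flip: mat_assoc)
  then have DA: "D * A = 0\<^sub>m r m" by (simp add: EA mat_zero_r)
  have sum: "A * B + C * D = 1\<^sub>m d" unfolding CD(3)[symmetric] E_def by (auto intro!: eq_matI)
  have sumx: "C * (D * W) = W - A * (B * W)" if "dim_row W = d" for W
  proof -
    have "C * (D * W) = E * W" using that by (simp add: CD(3) mat_assoc)
    also have "\<dots> = W - A * (B * W)" using that by (simp add: E_def mat_ring)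
    finally show ?thesis .
  qed
  have Chom: "C * (D * W * C) = W * C" if "B * W = V * B" "W \<in> carrier_mat d d" "V \<in> carrier_mat m m" for W V
  proof -
    have "C * (D * W * C) = W * C - A * (B * W * C)" using that(2) by (simp add: mat_assoc sumx)
    also have "B * W * C = V * (B * C)" using that by (simp add: mat_assoc)
    also have "W * C - A * (V * (B * C)) = W * C" using that by (auto simp: BC mat_zero_r intro!: eq_matI)
    finally show ?thesis .
  qed
  have Dhom: "D * W = D * W * C * D" if "A * V = W * A" "W \<in> carrier_mat d d" "V \<in> carrier_mat m m" for W V
  proof -
    have "D * W * C * D = D * W * E" using that(2) by (simp add: CD(3) mat_assoc)
    also have "\<dots> = D * W - D * (W * A) * B" using that(2) by (simp add: E_def mat_ring)
    also have "D * (W * A) * B = (D * A) * (V * B)" using that by (simp add: mat_assoc flip: that(1))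
    also have "D * W - (D * A) * (V * B) = D * W" using that by (auto simp: DA mat_zero_l intro!: eq_matI)
    finally show ?thesis by simp
  qed
  note CG = Chom[OF AB(5) taft_pairsD(1)[OF M] taft_pairsD(1)[OF N]]
  note CH = Chom[OF AB(6) taft_pairsD(2)[OF M] taft_pairsD(2)[OF N]]
  note DG = Dhom[OF AB(2) taft_pairsD(1)[OF M] taft_pairsD(1)[OF N]]
  note DH = Dhom[OF AB(3) taft_pairsD(2)[OF M] taft_pairsD(2)[OF N]]
  define G' H' where "G' = D * G * C" and "H' = D * H * C"
  have [simp]: "dim_row G' = r" "dim_col G' = r" "dim_row H' = r" "dim_col H' = r"
    by (simp_all add: G'_def H'_def)
  have pw: "W' ^\<^sub>m n = D * (W ^\<^sub>m n * C)" if "C * W' = W * C" "W' \<in> carrier_mat r r"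
    "W \<in> carrier_mat d d" for W W'
  proof -
    have "W' ^\<^sub>m n = D * (C * W' ^\<^sub>m n)" using that CD(4) by (simp add: mat_one_l flip: mat_assoc)
    then show ?thesis using pow_commute_pair_hom[OF that(1) CD(1) that(2,3)] by simp
  qed
  have U: "(r, G', H') \<in> taft_pairs"
  proof -
    have cg: "C * G' = G * C" "C * H' = H * C" by (simp_all only: G'_def H'_def CG CH)
    have "G' ^\<^sub>m n = D * (G ^\<^sub>m n * C)" by (rule pw[OF cg(1)]) auto
    then have 1: "G' ^\<^sub>m n = 1\<^sub>m r" by (simp add: taft_pairsD(7)[OF M] mat_one_l CD(4))
    have "H' ^\<^sub>m n = D * (H ^\<^sub>m n * C)" by (rule pw[OF cg(2)]) auto
    then have 2: "H' ^\<^sub>m n = 0\<^sub>m r r" by (simp add: taft_pairsD(8)[OF M] mat_zero_l mat_zero_r)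
    have "H' * G' = D * H * (C * G')" by (simp add: H'_def mat_assoc)
    then have "H' * G' = D * (H * G) * C" by (simp add: cg mat_assoc)
    also have "\<dots> = q \<cdot>\<^sub>m (D * (G * H) * C)" by (simp add: taft_pairsD(9)[OF M] mat_smult_l mat_smult_r)
    also have "D * (G * H) * C = D * G * (C * H')" by (simp add: cg mat_assoc)
    also have "\<dots> = G' * H'" by (simp add: G'_def mat_assoc)
    finally have 3: "H' * G' = q \<cdot>\<^sub>m (G' * H')" .
    have "G' \<in> carrier_mat r r" "H' \<in> carrier_mat r r" by (rule carrier_matI; simp)+
    then show ?thesis unfolding taft_pairs_def using 1 2 3 by blast
  qed
  have "biprod N (r,G',H') M" unfolding biprod_def
  proof (intro exI conjI)
    show "pair_hom N M A" "pair_hom M N B" by fact+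
    show "pair_hom (r,G',H') M C"
      unfolding \<open>M = _\<close> pair_hom.simps using CG[folded G'_def] CH[folded H'_def] CD(1) by simp
    show "pair_hom M (r,G',H') D"
      unfolding \<open>M = _\<close> pair_hom.simps using DG[folded G'_def] DH[folded H'_def] CD(2) by simp
  qed (simp_all add: AB(7) BC DA CD(4) sum)
  with U that show ?thesis by blast
qed

text \<open>Choose \<open>l\<close> with \<open>H\<^sup>l = 0 \<noteq> H\<^sup>l\<^sup>-\<^sup>1\<close>. Since the eigenspaces of \<open>G\<close> span the whole space, there is an
  eigenvector \<open>v\<close>, of weight \<open>s\<close> say, with \<open>w = H\<^sup>l\<^sup>-\<^sup>1 v \<noteq> 0\<close>; it generates a chain of length \<open>l\<close>. Let \<open>\<phi>\<close>
  be a linear form with \<open>\<phi>(w) = 1\<close> that vanishes on all eigenspaces other than the one of \<open>w\<close>. Then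
  \<open>x \<mapsto> (\<phi>(H\<^sup>l\<^sup>-\<^sup>1 x), \<dots>, \<phi>(H x), \<phi>(x))\<close> is a map of modules onto the chain. It is left inverse to the
  inclusion: \<open>\<phi>(H\<^sup>t v)\<close> is \<open>0\<close> for \<open>t \<ge> l\<close> because \<open>H\<^sup>l = 0\<close>, and for \<open>t < l - 1\<close> because \<open>l \<le> n\<close>, so that the
  weights \<open>s + t\<close> and \<open>s + l - 1\<close> are different modulo \<open>n\<close>. Below, \<open>v\<close> is column \<open>b\<close> of \<open>E\<close> and \<open>\<phi>\<close> is \<open>\<kappa>\<close> times
  row \<open>a\<close> of \<open>F\<close>.\<close>

lemma chain_summand:
  assumes M: "M \<in> taft_pairs" and "fst M \<noteq> 0"
  obtains l i U where "1 \<le> l" "l \<le> n" "i < n" "U \<in> taft_pairs" "biprod (chain l i) U M"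
proof -
  obtain d G H where Md: "M = (d,G,H)" by (metis prod.collapse)
  have M': "(d,G,H) \<in> taft_pairs" and d: "d \<noteq> 0" using assms by (simp_all add: Md)
  note car = taft_pairsD(1,2)[OF M'] and [simp] = taft_pairsD(3-6)[OF M']
  note Gn = taft_pairsD(7)[OF M'] and Hn = taft_pairsD(8)[OF M']
  define l where "l = (LEAST l. H ^\<^sub>m l = 0\<^sub>m d d)"
  have Hl: "H ^\<^sub>m l = 0\<^sub>m d d" unfolding l_def by (rule LeastI[of _ n]) (rule Hn)
  have ln: "l \<le> n" unfolding l_def by (rule Least_le) (rule Hn)
  have "l \<noteq> 0"
  proof
    assume "l = 0"
    then have "1\<^sub>m d $$ (0,0) = (0\<^sub>m d d $$ (0,0) :: 'k)" using Hl by simp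
    then show False using d by simp
  qed
  then have l1: "1 \<le> l" by simp
  have Hl1: "H ^\<^sub>m (l - 1) \<noteq> 0\<^sub>m d d"
    using not_less_Least[of "l - 1" "\<lambda>l. H ^\<^sub>m l = 0\<^sub>m d d"] l1 unfolding l_def[symmetric] by simp
  have Hge: "H ^\<^sub>m t = 0\<^sub>m d d" if "l \<le> t" for t
    using pow_mat_add[OF car(2), of l "t - l"] that by (simp add: Hl mat_zero_l)
  obtain s where s: "s < n" "H ^\<^sub>m (l - 1) * eproj G s \<noteq> 0\<^sub>m d d"
    using eproj_complete[of "H ^\<^sub>m (l - 1)" d d G] car Hl1 by (metis pow_carrier_mat)
  define E where "E = eproj G s"
  define F where "F = eproj G (s + (l - 1))"
  have EFd[simp]: "dim_row E = d" "dim_col E = d" "dim_row F = d" "dim_col F = d"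
    by (simp_all add: E_def F_def)
  have "\<exists>a b. a < d \<and> b < d \<and> (H ^\<^sub>m (l - 1) * E) $$ (a,b) \<noteq> 0"
  proof (rule ccontr)
    assume "\<not> ?thesis"
    then have "H ^\<^sub>m (l - 1) * E = 0\<^sub>m d d" by (intro eq_matI) (auto simp del: index_mult_mat(1))
    with s(2) show False by (simp add: E_def)
  qed
  then obtain a b where ab: "a < d" "b < d" "(H ^\<^sub>m (l - 1) * E) $$ (a,b) \<noteq> 0" by blast
  define w where "w = (H ^\<^sub>m (l - 1) * E) $$ (a,b)"
  define \<kappa> where "\<kappa> = inverse (of_nat n * w)"
  have \<kappa>: "\<kappa> * (of_nat n * w) = 1" unfolding \<kappa>_def
  proof (rule left_inverse)
    have "w \<noteq> 0" using ab(3) unfolding w_def .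
    then show "of_nat n * w \<noteq> 0" by simp
  qed
  have GE: "G * E = p ^ s \<cdot>\<^sub>m E" and FG: "F * G = p ^ (s + (l - 1)) \<cdot>\<^sub>m F"
    by (simp_all add: E_def F_def eproj_weight[OF car(1) Gn])
  have GHE: "G * (H ^\<^sub>m t * E) = p ^ (s + t) \<cdot>\<^sub>m (H ^\<^sub>m t * E)" for t
  proof -
    have "G * (H ^\<^sub>m t * E) = (G * H ^\<^sub>m t) * E" by (simp add: mat_assoc)
    also have "\<dots> = p ^ t \<cdot>\<^sub>m (H ^\<^sub>m t * (G * E))"
      by (subst H_pow_G(2)[OF M']) (simp add: mat_smult_l mat_assoc)
    also have "\<dots> = p ^ (s + t) \<cdot>\<^sub>m (H ^\<^sub>m t * E)"
      by (simp add: GE mat_smult_r smult_smult_mat power_add mult.commute)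
    finally show ?thesis .
  qed
  have FHG: "F * H ^\<^sub>m u * G = p ^ (s + m) \<cdot>\<^sub>m (F * H ^\<^sub>m u)" if "u + m = l - 1" for u m
  proof -
    have "F * H ^\<^sub>m u * G = q ^ u \<cdot>\<^sub>m ((F * G) * H ^\<^sub>m u)"
      by (simp add: mat_assoc H_pow_G(1)[OF M'] mat_smult_r)
    also have "\<dots> = (q ^ u * p ^ (s + (l - 1))) \<cdot>\<^sub>m (F * H ^\<^sub>m u)"
      by (simp add: FG mat_smult_l smult_smult_mat)
    also have "q ^ u * p ^ (s + (l - 1)) = (q * p) ^ u * p ^ (s + m)"
      unfolding that[symmetric] by (simp add: power_add power_mult_distrib)
    finally show ?thesis by (simp add: qp)
  qed
  have FHE: "F * (H ^\<^sub>m t * E) = (if (s + (l - 1)) mod n =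
    (s + t) mod n then of_nat n else 0) \<cdot>\<^sub>m (H ^\<^sub>m t * E)" for t
    unfolding F_def by (rule eproj_eigenvector[OF GHE car(1), of _ d]) (auto intro!: carrier_matI)
  define A where "A = mat d l (\<lambda>(r,j). (H ^\<^sub>m j * E) $$ (r,b))"
  define B where "B = mat l d (\<lambda>(m,c). \<kappa> * (F * H ^\<^sub>m (l - 1 - m)) $$ (a,c))"
  have [simp]: "dim_row A = d" "dim_col A = l" "dim_row B = l" "dim_col B = d"
    by (simp_all add: A_def B_def)
  have left: "(K * A) $$ (r,j) = (K * (H ^\<^sub>m j * E)) $$ (r,b)"
    if "K \<in> carrier_mat e d" "r < e" "j < l" for K e r j
  proof -
    have "(K * A) $$ (r,j) = (\<Sum>k<d. K $$ (r,k) * (H ^\<^sub>m j * E) $$ (k,b))"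
      using that by (subst mult_entry) (auto simp: A_def simp del: index_mult_mat(1))
    also have "\<dots> = (K * (H ^\<^sub>m j * E)) $$ (r,b)"
      using that ab by (subst (2) mult_entry) auto
    finally show ?thesis .
  qed
  have right: "(B * K) $$ (m,c) = \<kappa> * (F * H ^\<^sub>m (l - 1 - m) * K) $$ (a,c)"
    if "K \<in> carrier_mat d e" "m < l" "c < e" for K e m c
  proof -
    have "(B * K) $$ (m,c) = (\<Sum>k<d. \<kappa> * (F * H ^\<^sub>m (l - 1 - m)) $$ (a,k) * K $$ (k,c))"
      using that by (subst mult_entry) (auto simp: B_def simp del: index_mult_mat(1))
    also have "\<dots> = \<kappa> * (F * H ^\<^sub>m (l - 1 - m) * K) $$ (a,c)"
      using that ab by (subst (2) mult_entry) (auto simp: sum_distrib_left mult.assoc simp del: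
        index_mult_mat(1))
    finally show ?thesis .
  qed
  have BA: "B * A = 1\<^sub>m l"
  proof (rule eq_matI)
    fix m j assume "m < dim_row (1\<^sub>m l)" "j < dim_col (1\<^sub>m l)"
    then have mj: "m < l" "j < l" by auto
    define t where "t = l - 1 - m + j"
    have "(B * A) $$ (m,j) = (B * (H ^\<^sub>m j * E)) $$ (m,b)"
      by (rule left[of _ l]) (use mj in \<open>auto intro!: carrier_matI\<close>)
    also have "\<dots> = \<kappa> * (F * H ^\<^sub>m (l - 1 - m) * (H ^\<^sub>m j * E)) $$ (a,b)"
      by (rule right[of _ d]) (use mj ab in \<open>auto intro!: carrier_matI\<close>)
    also have "F * H ^\<^sub>m (l - 1 - m) * (H ^\<^sub>m j * E) = F * ((H ^\<^sub>m (l - 1 - m) * H ^\<^sub>m j) * E)"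
      by (simp add: mat_assoc)
    also have "H ^\<^sub>m (l - 1 - m) * H ^\<^sub>m j = H ^\<^sub>m t"
      unfolding t_def by (rule pow_mat_add[OF car(2), symmetric])
    also have "F * (H ^\<^sub>m t * E) = (if m = j then of_nat n else 0) \<cdot>\<^sub>m (H ^\<^sub>m t * E)"
    proof (cases "t < l")
      case True
      have "(s + (l - 1)) mod n = (s + t) mod n \<longleftrightarrow> m = j"
      proof
        assume "(s + (l - 1)) mod n = (s + t) mod n"
        then have "(l - 1) mod n = t mod n" by (simp add: nat_mod_eq_iff)
        then have "l - 1 = t" using True ln by simp
        then show "m = j" using mj by (simp add: t_def)
      qed (use mj in \<open>simp add: t_def\<close>)
      then show ?thesis by (simp add: FHE)
    next
      case False
      then have "H ^\<^sub>m t * E = 0\<^sub>m d d" by (simp add: Hge mat_zero_l)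
      then show ?thesis by (auto simp: mat_zero_r)
    qed
    also have "\<kappa> * ((if m = j then of_nat n else 0) \<cdot>\<^sub>m (H ^\<^sub>m t * E)) $$ (a,b) = (if m =
      j then \<kappa> * (of_nat n * (H ^\<^sub>m t * E) $$ (a,b)) else 0)"
      using ab by (subst index_smult_mat(1)) (auto simp del: index_mult_mat(1))
    also have "\<dots> = (if m = j then 1 else 0)"
    proof (cases "m = j")
      case True
      then have "t = l - 1" using mj by (simp add: t_def)
      then show ?thesis using \<kappa> by (simp add: w_def del: index_mult_mat(1))
    qed simp
    finally show "(B * A) $$ (m,j) = 1\<^sub>m l $$ (m,j)" using mj by simp
  qed auto
  have A: "pair_hom (chain l s) M A" unfolding chain_def Md pair_hom.simps
  proof (intro conjI)
    show "A \<in> carrier_mat d l" by (rule carrier_matI) auto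
    show "A * chainG l s = G * A"
    proof (rule eq_matI)
      fix r j assume "r < dim_row (G * A)" "j < dim_col (G * A)"
      then have rj: "r < d" "j < l" by auto
      have "(A * chainG l s) $$ (r,j) = (H ^\<^sub>m j * E) $$ (r,b) * p ^ (s + j)"
        using rj by (subst mult_entry) (auto simp: A_def chainG_def if_distrib[of "\<lambda>x. _ * x"] simp del:
          index_mult_mat(1) cong: if_cong)
      also have "\<dots> = (G * (H ^\<^sub>m j * E)) $$ (r,b)"
        using rj ab unfolding GHE by (subst index_smult_mat(1)) (auto simp del: index_mult_mat(1))
      also have "\<dots> = (G * A) $$ (r,j)" by (rule left[symmetric, of _ d]) (use rj car in auto)
      finally show "(A * chainG l s) $$ (r,j) = (G * A) $$ (r,j)" .
    qed auto
    show "A * chainH l = H * A"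
    proof (rule eq_matI)
      fix r j assume "r < dim_row (H * A)" "j < dim_col (H * A)"
      then have rj: "r < d" "j < l" by auto
      have "(A * chainH l) $$ (r,j) = (if Suc j < l then (H ^\<^sub>m Suc j * E) $$ (r,b) else 0)"
        using rj by (subst mult_entry) (auto simp: A_def chainH_def if_distrib[of "\<lambda>x. _ * x"] simp del:
          index_mult_mat(1) pow_mat.simps cong: if_cong)
      also have "\<dots> = (H ^\<^sub>m Suc j * E) $$ (r,b)"
        using rj ab Hge[of "Suc j"] by (auto simp: mat_zero_l simp del: pow_mat.simps index_mult_mat(1))
      also have "H ^\<^sub>m Suc j * E = H * (H ^\<^sub>m j * E)"
        using pow_mat_add[OF car(2), of 1 j] by (simp add: mat_assoc mat_one_l)
      also have "\<dots> $$ (r,b) = (H * A) $$ (r,j)" by (rule left[symmetric, of _ d]) (use rj car in auto)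
      finally show "(A * chainH l) $$ (r,j) = (H * A) $$ (r,j)" .
    qed auto
  qed
  have B: "pair_hom M (chain l s) B" unfolding chain_def Md pair_hom.simps
  proof (intro conjI)
    show "B \<in> carrier_mat l d" by (rule carrier_matI) auto
    show "B * G = chainG l s * B"
    proof (rule eq_matI)
      fix m c assume "m < dim_row (chainG l s * B)" "c < dim_col (chainG l s * B)"
      then have mc: "m < l" "c < d" by auto
      have "(B * G) $$ (m,c) = \<kappa> * (F * H ^\<^sub>m (l - 1 - m) * G) $$ (a,c)"
        by (rule right[OF car(1) mc])
      also have "F * H ^\<^sub>m (l - 1 - m) * G = p ^ (s + m) \<cdot>\<^sub>m (F * H ^\<^sub>m (l - 1 - m))"
        using mc by (intro FHG) simp
      also have "\<kappa> * \<dots> $$ (a,c) = p ^ (s + m) * B $$ (m,c)"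
        using mc ab by (subst index_smult_mat(1)) (auto simp: B_def simp del: index_mult_mat(1))
      also have "\<dots> = (chainG l s * B) $$ (m,c)"
        using mc by (subst mult_entry) (auto simp: chainG_def if_distrib[of "\<lambda>x. x * _"] cong: if_cong)
      finally show "(B * G) $$ (m,c) = (chainG l s * B) $$ (m,c)" .
    qed auto
    show "B * H = chainH l * B"
    proof (rule eq_matI)
      fix m c assume "m < dim_row (chainH l * B)" "c < dim_col (chainH l * B)"
      then have mc: "m < l" "c < d" by auto
      have "(B * H) $$ (m,c) = \<kappa> * (F * H ^\<^sub>m (l - 1 - m) * H) $$ (a,c)"
        by (rule right[OF car(2) mc])
      also have "F * H ^\<^sub>m (l - 1 - m) * H = F * H ^\<^sub>m Suc (l - 1 - m)" by (simp add: mat_assoc)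
      also have "\<kappa> * \<dots> $$ (a,c) = (if m = 0 then 0 else B $$ (m - 1, c))"
      proof (cases "m = 0")
        case True
        then have "F * H ^\<^sub>m Suc (l - 1 - m) = 0\<^sub>m d d"
          using l1 Hge[of "Suc (l - 1 - m)"] by (simp add: mat_zero_r del: pow_mat.simps)
        with True mc ab show ?thesis by simp
      next
        case False
        then have "Suc (l - 1 - m) = l - 1 - (m - 1)" using mc by simp
        with False mc show ?thesis by (simp add: B_def del: pow_mat.simps index_mult_mat(1))
      qed
      also have "\<dots> = (\<Sum>k<l. if k = m - 1 then if m = 0 then 0 else B $$ (k,c) else 0)"
        using mc by auto
      also have "\<dots> = (\<Sum>k<l. chainH l $$ (m,k) * B $$ (k,c))"
        by (rule sum.cong[OF refl]) (use mc in \<open>auto simp: chainH_def\<close>)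
      also have "\<dots> = (chainH l * B) $$ (m,c)"
        using mc by (subst mult_entry) simp_all
      finally show "(B * H) $$ (m,c) = (chainH l * B) $$ (m,c)" .
    qed auto
  qed
  obtain U where "U \<in> taft_pairs" "biprod (chain l s) U M"
    by (rule retract_summand[OF M chain_taft_pair[OF ln, of s] A B]) (simp_all add: BA)
  with that l1 ln s(1) show ?thesis by blast
qed

text \<open>The decomposition of every module into chains, as an induction rule.\<close>

lemma taft_pair_induct [consumes 1, case_names zero step]:
  assumes "M \<in> taft_pairs" "P zero_pair"
    and step: "\<And>l i U S. \<lbrakk>1 \<le> l; l \<le> n; i < n; U \<in> taft_pairs; S \<in> taft_pairs; biprod (chain l i) U S;
      P U\<rbrakk> \<Longrightarrow> P S"
  shows "P M"
  using assms(1)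
proof (induction "fst M" arbitrary: M rule: less_induct)
  case less
  show ?case
  proof (cases "fst M = 0")
    case True
    then have "M = zero_pair" using less(2) by (auto simp: zero_pair_def taft_pairs_def intro!: eq_matI)
    with assms(2) show ?thesis by simp
  next
    case False
    obtain l i U where U: "1 \<le> l" "l \<le> n" "i < n" "U \<in> taft_pairs" "biprod (chain l i) U M"
      by (rule chain_summand[OF less(2) False])
    have "fst U < fst M" using biprod_dim[OF U(5)] U(1) by simp
    from less(1)[OF this U(4)] show ?thesis using step U less(2) by blast
  qed
qed

end

section \<open>Kronecker products\<close>

lemma dim_kronecker[simp]: "dim_row (kronecker A B) = dim_row A * dim_row B"
  "dim_col (kronecker A B) = dim_col A * dim_col B"
  by (simp_all add: kronecker_def)

lemma kronecker_carrier: "A \<in> carrier_mat a b \<Longrightarrow> B \<in> carrier_mat c d \<Longrightarrow>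
  kronecker A B \<in> carrier_mat (a * c) (b * d)"
  by (rule carrier_matI) auto

lemma kronecker_entry: "i < dim_row A * dim_row B \<Longrightarrow> j < dim_col A * dim_col B \<Longrightarrow>
  kronecker A B $$ (i,j) = A $$ (i div dim_row B, j div dim_col B) * B $$ (i mod dim_row B, j mod dim_col B)"
  by (simp add: kronecker_def)

lemma pair_index_bounds:
  assumes "(i::nat) < a * b" shows "i div b < a" "i mod b < b"
proof -
  have "0 < b" using assms by (cases b) auto
  then show "i div b < a" "i mod b < b" using assms by (auto simp: less_mult_imp_div_less)
qed

lemma sum_pair_index: "(\<Sum>k<m * e. f (k div e) (k mod e)) = (\<Sum>a<m. \<Sum>b<(e::nat). f a b :: 'a::comm_monoid_add)"
proof (induction m)
  case (Suc m)
  have "(\<Sum>k<Suc m * e. f (k div e) (k mod e)) = (\<Sum>k<m * e + e. f (k div e) (k mod e))"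
    by (simp add: add.commute)
  also have "\<dots> = (\<Sum>k<m * e. f (k div e) (k mod e)) + (\<Sum>b<e. f ((m * e + b) div e) ((m * e + b) mod e))"
    by (rule sum_lessThan_split)
  also have "(\<Sum>b<e. f ((m * e + b) div e) ((m * e + b) mod e)) = (\<Sum>b<e. f m b)"
    by (rule sum.cong) auto
  finally show ?case by (simp add: Suc)
qed simp

lemma kronecker_mult:
  assumes "dim_col A = dim_row C" "dim_col B = dim_row D"
  shows "kronecker A B * kronecker C D = kronecker (A * C) (B * (D :: 'a::field mat))"
proof (rule eq_matI)
  fix i j assume "i < dim_row (kronecker (A * C) (B * D))" "j < dim_col (kronecker (A * C) (B * D))"
  then have ij: "i < dim_row A * dim_row B" "j < dim_col C * dim_col D" by auto
  define r c where "r = dim_row B" and "c = dim_col D"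
  let ?f = "\<lambda>a b. A $$ (i div r, a) * B $$ (i mod r, b) * (C $$ (a, j div c) * D $$ (b, j mod c))"
  have "(kronecker A B * kronecker C D) $$ (i,j) =
      (\<Sum>k<dim_row C * dim_row D. ?f (k div dim_row D) (k mod dim_row D))"
    using ij assms by (subst mult_entry) (auto simp: kronecker_entry r_def c_def intro!: sum.cong)
  also have "\<dots> = (\<Sum>a<dim_row C. \<Sum>b<dim_row D. ?f a b)" by (rule sum_pair_index)
  also have "\<dots> = (\<Sum>a<dim_row C. A $$ (i div r, a) * C $$ (a, j div c)) * (\<Sum>b<dim_row D. B $$ (i mod r,
    b) * D $$ (b, j mod c))"
    by (simp add: sum_product mult_ac)
  also have "\<dots> = kronecker (A * C) (B * D) $$ (i,j)"
    using ij assms pair_index_bounds[OF ij(1)] pair_index_bounds[OF ij(2)]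
    by (simp add: kronecker_entry mult_entry r_def c_def del: index_mult_mat(1))
  finally show "(kronecker A B * kronecker C D) $$ (i,j) = kronecker (A * C) (B * D) $$ (i,j)" .
qed simp_all

lemma kronecker_add_l: "dim_row A = dim_row B \<Longrightarrow> dim_col A = dim_col B \<Longrightarrow> kronecker (A + B) C =
  kronecker A C + kronecker B C"
  by (rule eq_matI) (auto simp: kronecker_entry pair_index_bounds distrib_right)

lemma kronecker_add_r: "dim_row A = dim_row B \<Longrightarrow> dim_col A = dim_col B \<Longrightarrow> kronecker C (A + B) =
  kronecker C A + kronecker C B"
  by (rule eq_matI) (auto simp: kronecker_entry pair_index_bounds distrib_left)

lemma kronecker_smult_l: "kronecker (c \<cdot>\<^sub>m A) B = c \<cdot>\<^sub>m kronecker A B"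
  by (rule eq_matI) (auto simp: kronecker_entry pair_index_bounds)

lemma kronecker_smult_r: "kronecker A (c \<cdot>\<^sub>m B) = c \<cdot>\<^sub>m kronecker A B"
  by (rule eq_matI) (auto simp: kronecker_entry pair_index_bounds)

lemma kronecker_zero: "kronecker (0\<^sub>m a b) B = 0\<^sub>m (a * dim_row B) (b * dim_col B)"
  "kronecker B (0\<^sub>m a b) = 0\<^sub>m (dim_row B * a) (dim_col B * b)"
  by (rule eq_matI; auto simp: kronecker_entry pair_index_bounds)+

lemma kronecker_one: "kronecker (1\<^sub>m a) (1\<^sub>m b) = 1\<^sub>m (a * b)"
proof (rule eq_matI)
  fix i j assume "i < dim_row (1\<^sub>m (a * b))" "j < dim_col (1\<^sub>m (a * b))"
  then have ij: "i < a * b" "j < a * b" by auto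
  have "i div b = j div b \<and> i mod b = j mod b \<longleftrightarrow> i = j" by (metis div_mult_mod_eq)
  then show "kronecker (1\<^sub>m a) (1\<^sub>m b) $$ (i,j) = (1\<^sub>m (a * b)) $$ (i,j)"
    using ij pair_index_bounds[OF ij(1)] pair_index_bounds[OF ij(2)] by (auto simp: kronecker_entry)
qed auto

lemma kronecker_assoc: "kronecker (kronecker A B) C = kronecker A (kronecker B C)"
proof (rule eq_matI)
  fix i j assume "i < dim_row (kronecker A (kronecker B C))" "j < dim_col (kronecker A (kronecker B C))"
  then have ij: "i < dim_row A * (dim_row B * dim_row C)" "j < dim_col A * (dim_col B * dim_col C)" by auto
  have *: "(x div c) div b = x div (b * c)" "(x mod (b * c)) div c =
    (x div c) mod b" "(x mod (b * c)) mod c = x mod c"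
    if "x < a * (b * c)" for x a b c :: nat
  proof -
    have "0 < c" using that by (cases c) auto
    then show "(x div c) div b = x div (b * c)" "(x mod (b * c)) div c =
      (x div c) mod b" "(x mod (b * c)) mod c = x mod c"
      using mod_mult2_eq[of x c b] by (simp_all add: div_mult2_eq mult.commute[of b c])
  qed
  have ij': "i < dim_row A * dim_row B * dim_row C" "j < dim_col A * dim_col B * dim_col C"
    using ij by (simp_all add: mult.assoc)
  show "kronecker (kronecker A B) C $$ (i,j) = kronecker A (kronecker B C) $$ (i,j)"
    using ij ij' pair_index_bounds[OF ij'(1)] pair_index_bounds[OF ij'(2)] pair_index_bounds[OF ij(1)]
      pair_index_bounds[OF ij(2)]
    by (simp add: kronecker_entry *[OF ij(1)] *[OF ij(2)] mult.assoc)
qed (simp_all add: mult.assoc)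

lemma kronecker_scalar: "A \<in> carrier_mat 1 1 \<Longrightarrow> kronecker A B = A $$ (0,0) \<cdot>\<^sub>m B"
  by (rule eq_matI) (auto simp: kronecker_entry)

lemma kronecker_pow:
  assumes "dim_row A = dim_col A" "dim_row B = dim_col B"
  shows "kronecker A B ^\<^sub>m k = kronecker (A ^\<^sub>m k) (B ^\<^sub>m k)"
proof (induction k)
  case (Suc k)
  show ?case unfolding pow_mat.simps Suc by (rule kronecker_mult) (use assms in auto)
qed (simp add: kronecker_one)

context taft_root begin

section \<open>Tensor products of pairs\<close>

text \<open>The Gaussian binomial coefficients at \<open>q\<close>, in the recursion that comes from multiplying \<open>Y\<^sup>k V\<^sup>m\<^sup>-\<^sup>k\<close>
  by \<open>V + Y\<close> from the right when \<open>V Y = q Y V\<close>.\<close>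

fun qbinom :: "nat \<Rightarrow> nat \<Rightarrow> 'k" where
  "qbinom m 0 = 1"
| "qbinom 0 (Suc k) = 0"
| "qbinom (Suc m) (Suc k) = qbinom m (Suc k) + q ^ (m - k) * qbinom m k"

lemma qbinom_gt: "m < k \<Longrightarrow> qbinom m k = 0"
proof (induction m arbitrary: k)
  case 0 then show ?case by (cases k) auto
next
  case (Suc m) then show ?case by (cases k) auto
qed

lemma qbinom_step: "k \<le> m \<Longrightarrow> (1 - q ^ Suc k) * qbinom m (Suc k) = (1 - q ^ (m - k)) * qbinom m k"
proof (induction m arbitrary: k)
  case (Suc m)
  show ?case
  proof (cases "k \<le> m")
    case True
    have "(1 - q ^ Suc k) * qbinom (Suc m) (Suc k) =
        (1 - q ^ Suc k) * qbinom m (Suc k) + (1 - q ^ Suc k) * (q ^ (m - k) * qbinom m k)"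
      by (simp only: qbinom.simps distrib_left)
    also have "\<dots> = (1 - q ^ Suc m) * qbinom m k"
    proof -
      have "q ^ Suc m = q ^ Suc k * q ^ (m - k)" using True by (simp flip: power_add)
      then show ?thesis unfolding Suc.IH[OF True] by (simp add: algebra_simps)
    qed
    also have "\<dots> = (1 - q ^ (Suc m - k)) * qbinom (Suc m) k"
    proof (cases k)
      case (Suc k')
      have IH: "(1 - q ^ Suc k') * qbinom m (Suc k') = (1 - q ^ (m - k')) * qbinom m k'"
        using True Suc by (intro Suc.IH) simp
      have e: "q ^ Suc m = q ^ (m - k') * q ^ Suc k'" using True Suc by (simp flip: power_add)
      have "(1 - q ^ (m - k')) * qbinom (Suc m) (Suc k') =
          (1 - q ^ (m - k')) * qbinom m (Suc k') + q ^ (m - k') * ((1 - q ^ (m - k')) * qbinom m k')"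
        by (simp add: algebra_simps)
      also have "\<dots> = (1 - q ^ Suc m) * qbinom m (Suc k')"
        unfolding IH[symmetric] e by (simp add: algebra_simps)
      finally show ?thesis using Suc by simp
    qed simp
    finally show ?thesis .
  next
    case False
    with Suc have "k = Suc m" by simp
    then show ?thesis by (simp add: qbinom_gt)
  qed
qed simp

text \<open>In \<open>qbinom_step\<close> for \<open>m = n\<close>, the right-hand side vanishes for \<open>k = 0\<close> since \<open>q\<^sup>n = 1\<close>, and then
  inductively for all larger \<open>k\<close>, while \<open>1 - q\<^sup>k\<^sup>+\<^sup>1\<close> is not zero for \<open>k + 1 < n\<close>.\<close>

lemma qbinom_n: "0 < k \<Longrightarrow> k < n \<Longrightarrow> qbinom n k = 0"
proof (induction k)
  case (Suc k)
  have "(1 - q ^ Suc k) * qbinom n (Suc k) = (1 - q ^ (n - k)) * qbinom n k"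
    using Suc by (intro qbinom_step) simp
  also have "\<dots> = 0" using Suc by (cases k) (auto simp: q_pow_n)
  finally show ?case using Suc.prems q_pow_eq_one_iff[of "Suc k"] by simp
qed simp

lemma q_binomial_theorem:
  assumes VY: "V * Y = q \<cdot>\<^sub>m (Y * V)" and car: "V \<in> carrier_mat d d" "Y \<in> carrier_mat d d"
    and ij: "i < d" "j < d"
  shows "((V + Y) ^\<^sub>m m) $$ (i,j) = (\<Sum>k\<le>m. qbinom m k * (Y ^\<^sub>m k * V ^\<^sub>m (m - k)) $$ (i,j))"
  using ij
proof (induction m arbitrary: i j)
  case (Suc m)
  have [simp]: "dim_row V = d" "dim_col V = d" "dim_row Y = d" "dim_col Y = d" using car by auto
  define W where "W k t = (Y ^\<^sub>m k * V ^\<^sub>m t) $$ (i,j)" for k t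
  have expand: "((V + Y) ^\<^sub>m m * Z) $$ (i,j) = (\<Sum>k\<le>m. qbinom m k * (Y ^\<^sub>m k * V ^\<^sub>m (m - k) * Z) $$ (i,j))"
    if "Z \<in> carrier_mat d d" for Z
  proof -
    have "((V + Y) ^\<^sub>m m * Z) $$ (i,j) = (\<Sum>b<d. ((V + Y) ^\<^sub>m m) $$ (i,b) * Z $$ (b,j))"
      using that Suc.prems by (subst mult_entry) auto
    also have "\<dots> = (\<Sum>b<d. \<Sum>k\<le>m. qbinom m k * (Y ^\<^sub>m k * V ^\<^sub>m (m - k)) $$ (i,b) * Z $$ (b,j))"
      using Suc.prems by (intro sum.cong refl) (simp add: Suc.IH sum_distrib_right del: index_mult_mat(1))
    also have "\<dots> = (\<Sum>k\<le>m. \<Sum>b<d. qbinom m k * (Y ^\<^sub>m k * V ^\<^sub>m (m - k)) $$ (i,b) * Z $$ (b,j))"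
      by (rule sum.swap)
    also have "\<dots> = (\<Sum>k\<le>m. qbinom m k * (Y ^\<^sub>m k * V ^\<^sub>m (m - k) * Z) $$ (i,j))"
      using that Suc.prems by (intro sum.cong refl, subst (2) mult_entry)
        (auto simp: sum_distrib_left mult.assoc simp del: index_mult_mat(1))
    finally show ?thesis .
  qed
  have 1: "((V + Y) ^\<^sub>m m * V) $$ (i,j) = (\<Sum>k\<le>m. qbinom m k * W k (Suc m - k))"
  proof -
    have "Y ^\<^sub>m k * V ^\<^sub>m (m - k) * V = Y ^\<^sub>m k * V ^\<^sub>m (Suc m - k)" if "k \<le> m" for k
      using that by (simp add: mat_assoc Suc_diff_le)
    then show ?thesis unfolding expand[OF car(1)] W_def by simp
  qed
  have 2: "((V + Y) ^\<^sub>m m * Y) $$ (i,j) = (\<Sum>k\<le>m. q ^ (m - k) * qbinom m k * W (Suc k) (m - k))"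
  proof -
    have "Y ^\<^sub>m k * V ^\<^sub>m (m - k) * Y = q ^ (m - k) \<cdot>\<^sub>m (Y ^\<^sub>m Suc k * V ^\<^sub>m (m - k))" for k
      by (simp add: mat_assoc q_commute_pow[OF VY car] mat_smult_r)
    then show ?thesis unfolding expand[OF car(2)] W_def
      using Suc.prems by (simp add: mult_ac del: index_mult_mat(1) pow_mat.simps)
  qed
  have "((V + Y) ^\<^sub>m Suc m) $$ (i,j) = ((V + Y) ^\<^sub>m m * V) $$ (i,j) + ((V + Y) ^\<^sub>m m * Y) $$ (i,j)"
    using Suc.prems by (simp add: mat_distl del: index_mult_mat(1))
  also have "(\<Sum>k\<le>m. qbinom m k * W k (Suc m - k)) = (\<Sum>k\<le>Suc m. qbinom m k * W k (Suc m - k))"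
    by (simp add: qbinom_gt)
  then have "((V + Y) ^\<^sub>m m * V) $$ (i,j) = W 0 (Suc m) + (\<Sum>k\<le>m. qbinom m (Suc k) * W (Suc k) (m - k))"
    unfolding 1 by (simp only: sum.atMost_Suc_shift) simp
  also have "W 0 (Suc m) + (\<Sum>k\<le>m. qbinom m (Suc k) * W (Suc k) (m - k)) + ((V + Y) ^\<^sub>m m * Y) $$ (i,j)
    = W 0 (Suc m) + (\<Sum>k\<le>m. qbinom (Suc m) (Suc k) * W (Suc k) (m - k))"
    unfolding 2 by (simp add: sum.distrib distrib_right add.assoc)
  also have "\<dots> = (\<Sum>k\<le>Suc m. qbinom (Suc m) k * W k (Suc m - k))"
    by (simp only: sum.atMost_Suc_shift) simp
  finally show ?case by (simp add: W_def)
qed (use car in auto)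

text \<open>In the \<open>q\<close>-binomial expansion of \<open>(V + Y)\<^sup>n\<close> only the terms \<open>V\<^sup>n\<close> and \<open>Y\<^sup>n\<close> have a nonzero coefficient.\<close>

lemma q_binomial_nilpotent:
  assumes "V * Y = q \<cdot>\<^sub>m (Y * V)" "V \<in> carrier_mat d d" "Y \<in> carrier_mat d d"
    "V ^\<^sub>m n = 0\<^sub>m d d" "Y ^\<^sub>m n = 0\<^sub>m d d"
  shows "(V + Y) ^\<^sub>m n = 0\<^sub>m d d"
proof (rule eq_matI)
  fix i j assume "i < dim_row (0\<^sub>m d d)" "j < dim_col (0\<^sub>m d d)"
  then have ij: "i < d" "j < d" by auto
  have "qbinom n k * (Y ^\<^sub>m k * V ^\<^sub>m (n - k)) $$ (i,j) = 0" if "k \<le> n" for k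
  proof (cases "k = 0 \<or> k = n")
    case True
    then have "Y ^\<^sub>m k * V ^\<^sub>m (n - k) = 0\<^sub>m d d" using assms by (auto simp: mat_zero_l mat_zero_r)
    then show ?thesis using ij by simp
  next
    case False
    then show ?thesis using that qbinom_n[of k] by simp
  qed
  then have "(\<Sum>k\<le>n. qbinom n k * (Y ^\<^sub>m k * V ^\<^sub>m (n - k)) $$ (i,j)) = 0"
    by (intro sum.neutral ballI) auto
  then show "((V + Y) ^\<^sub>m n) $$ (i,j) = 0\<^sub>m d d $$ (i,j)"
    using ij by (simp add: q_binomial_theorem[OF assms(1-3) ij])
qed (use assms in auto)

text \<open>The formulas come from \<open>\<Delta>(g) = g \<otimes> g\<close> and \<open>\<Delta>(h) = 1 \<otimes> h + h \<otimes> g\<close>.\<close>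

fun pair_tensor :: "'k mat_pair \<Rightarrow> 'k mat_pair \<Rightarrow> 'k mat_pair" where
  "pair_tensor (d,G,H) (e,G',H') = (d * e, kronecker G G', kronecker (1\<^sub>m d) H' + kronecker H G')"

lemma one_pow_mat: "1\<^sub>m d ^\<^sub>m k = (1\<^sub>m d :: 'k mat)"
  by (induction k) (simp_all add: mat_one_r)

text \<open>The two summands \<open>1 \<otimes> H'\<close> and \<open>H \<otimes> G'\<close> of the action of \<open>h\<close> commute up to the factor \<open>q\<close> and are
  nilpotent, so \<open>q_binomial_nilpotent\<close> applies.\<close>

lemma pair_tensor_taft_pair:
  assumes "M \<in> taft_pairs" "N \<in> taft_pairs" shows "pair_tensor M N \<in> taft_pairs"
proof -
  obtain d G H e G' H' where Md: "M = (d,G,H)" "N = (e,G',H')" by (metis prod.collapse)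
  note M = assms(1)[unfolded Md] and N = assms(2)[unfolded Md]
  note [simp] = taft_pairsD(3-6)[OF M] taft_pairsD(3-6)[OF N]
  let ?V = "kronecker (1\<^sub>m d) H'" and ?Y = "kronecker H G'"
  have car: "kronecker G G' \<in> carrier_mat (d * e) (d * e)" "?V \<in> carrier_mat (d * e) (d * e)"
    "?Y \<in> carrier_mat (d * e) (d * e)" by (auto intro!: carrier_matI)
  have "kronecker G G' ^\<^sub>m n = 1\<^sub>m (d * e)"
    by (simp add: kronecker_pow taft_pairsD(7)[OF M] taft_pairsD(7)[OF N] kronecker_one)
  moreover have "(?V + ?Y) ^\<^sub>m n = 0\<^sub>m (d * e) (d * e)"
  proof (rule q_binomial_nilpotent[OF _ car(2,3)])
    show "?V * ?Y = q \<cdot>\<^sub>m (?Y * ?V)"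
      by (simp add: kronecker_mult taft_pairsD(9)[OF N] kronecker_smult_r mat_one_l mat_one_r)
    show "?V ^\<^sub>m n = 0\<^sub>m (d * e) (d * e)"
      by (simp add: kronecker_pow taft_pairsD(8)[OF N] kronecker_zero one_pow_mat)
    show "?Y ^\<^sub>m n = 0\<^sub>m (d * e) (d * e)"
      by (simp add: kronecker_pow taft_pairsD(8)[OF M] kronecker_zero)
  qed
  moreover have "(?V + ?Y) * kronecker G G' = q \<cdot>\<^sub>m (kronecker G G' * (?V + ?Y))"
    by (simp add: mat_distl mat_distr kronecker_mult taft_pairsD(9)[OF N] taft_pairsD(9)[OF M] kronecker_smult_r
      kronecker_smult_l mat_one_l mat_one_r add_smult_distrib_left_mat[of _ "d * e" "d * e"] carrier_matI)
  moreover have "?V + ?Y \<in> carrier_mat (d * e) (d * e)" using car by simp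
  ultimately show ?thesis unfolding Md pair_tensor.simps taft_pairs_def using car(1) by blast
qed

lemma pair_tensor_hom:
  assumes "pair_hom M M' A" "pair_hom N N' B" "M \<in> taft_pairs" "N \<in> taft_pairs" "M' \<in> taft_pairs"
    "N' \<in> taft_pairs"
  shows "pair_hom (pair_tensor M N) (pair_tensor M' N') (kronecker A B)"
proof -
  obtain d G H e Y Z where Md: "M = (d,G,H)" "N = (e,Y,Z)" by (metis prod.collapse)
  obtain d' G' H' e' Y' Z' where Md': "M' = (d',G',H')" "N' = (e',Y',Z')" by (metis prod.collapse)
  note [simp] = taft_pairsD(3-6)[OF assms(3)[unfolded Md]] taft_pairsD(3-6)[OF assms(4)[unfolded Md]]
    taft_pairsD(3-6)[OF assms(5)[unfolded Md']] taft_pairsD(3-6)[OF assms(6)[unfolded Md']]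
  have A: "A \<in> carrier_mat d' d" "A * G = G' * A" "A * H = H' * A"
    and B: "B \<in> carrier_mat e' e" "B * Y = Y' * B" "B * Z = Z' * B"
    using assms(1,2) unfolding Md Md' by auto
  have [simp]: "dim_row A = d'" "dim_col A = d" "dim_row B = e'" "dim_col B = e" using A B by auto
  show ?thesis unfolding Md Md' pair_tensor.simps pair_hom.simps
  proof (intro conjI)
    show "kronecker A B \<in> carrier_mat (d' * e') (d * e)" by (rule carrier_matI) simp_all
    show "kronecker A B * kronecker G Y = kronecker G' Y' * kronecker A B"
      by (simp add: kronecker_mult A B)
    show "kronecker A B * (kronecker (1\<^sub>m d) Z + kronecker H Y) =
      (kronecker (1\<^sub>m d') Z' + kronecker H' Y') * kronecker A B"
      by (simp add: mat_distl mat_distr kronecker_mult A B mat_one_l mat_one_r)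
  qed
qed

lemma pair_tensor_pair_iso:
  assumes "pair_iso M M'" "pair_iso N N'" "M \<in> taft_pairs" "N \<in> taft_pairs" "M' \<in> taft_pairs" "N' \<in> taft_pairs"
  shows "pair_iso (pair_tensor M N) (pair_tensor M' N')"
proof -
  obtain A B where AB: "pair_hom M M' A" "pair_hom M' M B" "A * B = 1\<^sub>m (fst M')" "B * A = 1\<^sub>m (fst M)"
    using assms(1) unfolding pair_iso_def by blast
  obtain C D where CD: "pair_hom N N' C" "pair_hom N' N D" "C * D = 1\<^sub>m (fst N')" "D * C = 1\<^sub>m (fst N)"
    using assms(2) unfolding pair_iso_def by blast
  have d: "dim_col A = dim_row B" "dim_col C = dim_row D" "dim_col B = dim_row A" "dim_col D = dim_row C"
    using AB CD by (cases M; cases M'; cases N; cases N'; auto)+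
  have f: "fst (pair_tensor M' N') = fst M' * fst N'" "fst (pair_tensor M N) = fst M * fst N"
    by (cases M; cases M'; cases N; cases N'; simp)+
  show ?thesis unfolding pair_iso_def
    by (intro exI conjI, rule pair_tensor_hom[OF AB(1) CD(1) assms(3-6)],
      rule pair_tensor_hom[OF AB(2) CD(2) assms(5,6,3,4)])
      (simp_all add: kronecker_mult d AB(3,4) CD(3,4) kronecker_one f)
qed

lemma fst_pair_tensor[simp]: "fst (pair_tensor M N) = fst M * fst N"
  by (cases M; cases N) simp

lemma pair_hom_dim: "pair_hom M N A \<Longrightarrow> dim_row A = fst N" "pair_hom M N A \<Longrightarrow> dim_col A = fst M"
  by (cases M; cases N; auto)+

lemma pair_tensor_biprod_right:
  assumes "biprod N1 N2 S" "V \<in> taft_pairs" "N1 \<in> taft_pairs" "N2 \<in> taft_pairs" "S \<in> taft_pairs"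
  shows "biprod (pair_tensor V N1) (pair_tensor V N2) (pair_tensor V S)"
proof -
  obtain A1 B1 A2 B2 where h: "pair_hom N1 S A1" "pair_hom S N1 B1" "pair_hom N2 S A2" "pair_hom S N2 B2"
    "B1 * A1 = 1\<^sub>m (fst N1)" "B1 * A2 = 0\<^sub>m (fst N1) (fst N2)" "B2 * A1 = 0\<^sub>m (fst N2) (fst N1)"
    "B2 * A2 = 1\<^sub>m (fst N2)" "A1 * B1 + A2 * B2 = 1\<^sub>m (fst S)"
    using assms(1) unfolding biprod_def by blast
  note [simp] = pair_hom_dim[OF h(1)] pair_hom_dim[OF h(2)] pair_hom_dim[OF h(3)] pair_hom_dim[OF h(4)]
  note one = pair_hom_one[OF assms(2)]
  show ?thesis unfolding biprod_def
    by (intro exI conjI, rule pair_tensor_hom[OF one h(1)], (fact assms)+,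
      rule pair_tensor_hom[OF one h(2)], (fact assms)+, rule pair_tensor_hom[OF one h(3)], (fact assms)+,
      rule pair_tensor_hom[OF one h(4)], (fact assms)+)
      (simp_all add: kronecker_mult mat_one_l h(5-9) kronecker_one kronecker_zero flip: kronecker_add_r)
qed

lemma pair_tensor_biprod_left:
  assumes "biprod N1 N2 S" "V \<in> taft_pairs" "N1 \<in> taft_pairs" "N2 \<in> taft_pairs" "S \<in> taft_pairs"
  shows "biprod (pair_tensor N1 V) (pair_tensor N2 V) (pair_tensor S V)"
proof -
  obtain A1 B1 A2 B2 where h: "pair_hom N1 S A1" "pair_hom S N1 B1" "pair_hom N2 S A2" "pair_hom S N2 B2"
    "B1 * A1 = 1\<^sub>m (fst N1)" "B1 * A2 = 0\<^sub>m (fst N1) (fst N2)" "B2 * A1 = 0\<^sub>m (fst N2) (fst N1)"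
    "B2 * A2 = 1\<^sub>m (fst N2)" "A1 * B1 + A2 * B2 = 1\<^sub>m (fst S)"
    using assms(1) unfolding biprod_def by blast
  note [simp] = pair_hom_dim[OF h(1)] pair_hom_dim[OF h(2)] pair_hom_dim[OF h(3)] pair_hom_dim[OF h(4)]
  note one = pair_hom_one[OF assms(2)]
  show ?thesis unfolding biprod_def
    by (intro exI conjI, rule pair_tensor_hom[OF h(1) one], (fact assms)+,
      rule pair_tensor_hom[OF h(2) one], (fact assms)+, rule pair_tensor_hom[OF h(3) one], (fact assms)+,
      rule pair_tensor_hom[OF h(4) one], (fact assms)+)
      (simp_all add: kronecker_mult mat_one_l h(5-9) kronecker_one kronecker_zero flip: kronecker_add_l)
qed

lemma pair_tensor_assoc:
  assumes "M \<in> taft_pairs" "N \<in> taft_pairs" "L \<in> taft_pairs"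
  shows "pair_tensor (pair_tensor M N) L = pair_tensor M (pair_tensor N L)"
proof -
  obtain d G H e G' H' f G'' H'' where Md: "M = (d,G,H)" "N = (e,G',H')" "L = (f,G'',H'')"
    by (metis prod.collapse)
  note [simp] = taft_pairsD(3-6)[OF assms(1)[unfolded Md]] taft_pairsD(3-6)[OF assms(2)[unfolded Md]]
    taft_pairsD(3-6)[OF assms(3)[unfolded Md]]
  have "kronecker (1\<^sub>m d) (kronecker (1\<^sub>m e) H'') = kronecker (1\<^sub>m (d * e)) H''"
    by (simp add: kronecker_one flip: kronecker_assoc)
  then show ?thesis unfolding Md
    by (simp add: kronecker_assoc kronecker_add_l kronecker_add_r mult.assoc)
      (rule assoc_add_mat[symmetric, of _ "d * (e * f)" "d * (e * f)"]; rule carrier_matI; simp add: mult.assoc)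
qed

lemma one_dim_pair_tensor:
  assumes "N \<in> taft_pairs" shows "pair_tensor (chain 1 i) N = (fst N, p ^ i \<cdot>\<^sub>m fst (snd N), snd (snd N))"
proof -
  obtain e G H where Nd: "N = (e,G,H)" by (metis prod.collapse)
  note [simp] = taft_pairsD(3-6)[OF assms[unfolded Nd]]
  have "kronecker (chainG 1 i) G = p ^ i \<cdot>\<^sub>m G" "kronecker (1\<^sub>m 1) H = H"
    "kronecker (chainH 1) G = 0\<^sub>m e e"
    by (subst kronecker_scalar; auto simp: chainG_def chainH_def intro!: eq_matI)+
  then show ?thesis by (simp add: Nd chain_def mat_add_zero)
qed

lemma chain_1_pair_tensor_chain: "l \<le> n \<Longrightarrow> pair_tensor (chain 1 j) (chain l i) = chain l (j + i)"
  by (subst one_dim_pair_tensor, erule chain_taft_pair)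
    (auto simp: chain_def chainG_def power_add intro!: eq_matI)

end

section \<open>Tensor products with the chain of length two\<close>

text \<open>All maps between chains below have entries on one shifted diagonal \<open>r + a = c + b\<close>, with a
  weight \<open>f c\<close> that depends on the column. The two offsets allow shifts in both directions on
  natural numbers.\<close>

definition shift_mat :: "nat \<Rightarrow> nat \<Rightarrow> nat \<Rightarrow> nat \<Rightarrow> (nat \<Rightarrow> 'a::zero) \<Rightarrow> 'a mat" where
  "shift_mat l m a b f = mat l m (\<lambda>(r,c). if r + a = c + b then f c else 0)"

lemma dim_shift_mat[simp]: "dim_row (shift_mat l m a b f) = l" "dim_col (shift_mat l m a b f) = m"
  by (simp_all add: shift_mat_def)

lemma shift_mat_entry: "r < l \<Longrightarrow> c < m \<Longrightarrow> shift_mat l m a b f $$ (r,c) = (if r + a = c + b then f c else 0)"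
  by (simp add: shift_mat_def)

lemma shift_mat_mult_entry:
  fixes f g :: "nat \<Rightarrow> 'a::semiring_0"
  assumes "r < l" "c < k"
  shows "(shift_mat l m a b f * shift_mat m k a' b' g) $$ (r,c) =
    (if a' \<le> c + b' \<and> c + b' - a' < m \<and> r + a = c + b' - a' + b then f (c + b' - a') * g c else 0)"
proof -
  have "(shift_mat l m a b f * shift_mat m k a' b' g) $$ (r,c) =
      (\<Sum>j<m. shift_mat l m a b f $$ (r,j) * shift_mat m k a' b' g $$ (j,c))"
    using assms by (subst mult_entry) simp_all
  also have "\<dots> = (\<Sum>j<m. if j = c + b' - a' then
      (if a' \<le> c + b' \<and> r + a = c + b' - a' + b then f (c + b' - a') * g c else 0) else 0)"
    by (rule sum.cong[OF refl]) (use assms in \<open>auto simp: shift_mat_entry\<close>)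
  finally show ?thesis by simp
qed

text \<open>Column \<open>0\<close> is treated separately because subtractions on column indices truncate there.\<close>

lemma mat_eqI_column:
  assumes "\<And>r. r < dim_row B \<Longrightarrow> 0 < dim_col B \<Longrightarrow> A $$ (r,0) = B $$ (r,0)"
    and "\<And>r c. r < dim_row B \<Longrightarrow> Suc c < dim_col B \<Longrightarrow> A $$ (r,Suc c) = B $$ (r,Suc c)"
    and "dim_row A = dim_row B" "dim_col A = dim_col B"
  shows "A = B"
proof (rule eq_matI)
  fix i j assume "i < dim_row B" "j < dim_col B"
  then show "A $$ (i,j) = B $$ (i,j)" using assms(1,2) by (cases j) auto
qed (use assms in auto)

context taft_root begin

text \<open>For a square matrix a one-sided inverse is two-sided, and the inverse of an intertwiner is an
  intertwiner. Hence it is enough that the injections are intertwiners and that one of the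
  equations between injections and projections holds.\<close>

lemma biprod_squareI:
  assumes tm: "M \<in> taft_pairs" "N \<in> taft_pairs" "S \<in> taft_pairs" and hom: "pair_hom M S A1" "pair_hom N S A2"
    and dim: "fst S = fst M + fst N"
    and B: "B1 \<in> carrier_mat (fst M) (fst S)" "B2 \<in> carrier_mat (fst N) (fst S)"
    and id: "A1 * B1 + A2 * B2 = 1\<^sub>m (fst S)"
  shows "biprod M N S"
proof -
  obtain d G H d' G' H' e K L where Md: "M = (d,G,H)" "N = (d',G',H')" "S = (e,K,L)"
    by (metis prod.collapse)
  have e: "e = d + d'" using dim by (simp add: Md)
  note [simp] = taft_pairsD(3-6)[OF tm(1)[unfolded Md]] taft_pairsD(3-6)[OF tm(2)[unfolded Md]]
    taft_pairsD(3-6)[OF tm(3)[unfolded Md]]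
  have [simp]: "dim_row A1 = e" "dim_col A1 = d" "dim_row A2 = e" "dim_col A2 = d'"
    "dim_row B1 = d" "dim_col B1 = e" "dim_row B2 = d'" "dim_col B2 = e"
    using hom B unfolding Md by auto
  have "hcat A1 A2 * vcat B1 B2 = 1\<^sub>m e" using id by (simp add: hcat_mult_vcat Md)
  then have "vcat B1 B2 * hcat A1 A2 = 1\<^sub>m e"
    by (rule mat_mult_left_right_inverse[rotated -1]) (auto simp: e intro!: carrier_matI)
  then have fb: "four_block_mat (B1 * A1) (B1 * A2) (B2 * A1) (B2 * A2) = 1\<^sub>m (d + d')"
    by (simp add: vcat_mult_hcat e)
  have fe: "four_block_mat (B1 * A1) (B1 * A2) (B2 * A1) (B2 * A2) $$ (i,j) = (if i = j then 1 else 0)"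
    if "i < d + d'" "j < d + d'" for i j using that by (simp add: fb)
  have eqs: "B1 * A1 = 1\<^sub>m d" "B1 * A2 = 0\<^sub>m d d'" "B2 * A1 = 0\<^sub>m d' d" "B2 * A2 = 1\<^sub>m d'"
  proof -
    show "B1 * A1 = 1\<^sub>m d"
    proof (rule eq_matI)
      fix i j assume "i < dim_row (1\<^sub>m d :: 'k mat)" "j < dim_col (1\<^sub>m d :: 'k mat)"
      then show "(B1 * A1) $$ (i,j) = 1\<^sub>m d $$ (i,j)" using fe[of i j] by (simp del: index_mult_mat(1))
    qed auto
    show "B1 * A2 = 0\<^sub>m d d'"
    proof (rule eq_matI)
      fix i j assume "i < dim_row (0\<^sub>m d d' :: 'k mat)" "j < dim_col (0\<^sub>m d d' :: 'k mat)"
      then show "(B1 * A2) $$ (i,j) = 0\<^sub>m d d' $$ (i,j)" using fe[of i "d + j"] by (simp del: index_mult_mat(1))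
    qed auto
    show "B2 * A1 = 0\<^sub>m d' d"
    proof (rule eq_matI)
      fix i j assume "i < dim_row (0\<^sub>m d' d :: 'k mat)" "j < dim_col (0\<^sub>m d' d :: 'k mat)"
      then show "(B2 * A1) $$ (i,j) = 0\<^sub>m d' d $$ (i,j)" using fe[of "d + i" j] by (simp del: index_mult_mat(1))
    qed auto
    show "B2 * A2 = 1\<^sub>m d'"
    proof (rule eq_matI)
      fix i j assume "i < dim_row (1\<^sub>m d' :: 'k mat)" "j < dim_col (1\<^sub>m d' :: 'k mat)"
      then show "(B2 * A2) $$ (i,j) = 1\<^sub>m d' $$ (i,j)" using fe[of "d + i" "d + j"]
        by (simp del: index_mult_mat(1))
    qed auto
  qed
  have L1: "B1 * (A1 * W) = W" "B2 * (A1 * W) = 0\<^sub>m d' (dim_col W)" if "dim_row W = d" for W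
    using that eqs by (simp_all add: mat_one_l mat_zero_l flip: mat_assoc)
  have L2: "B1 * (A2 * W) = 0\<^sub>m d (dim_col W)" "B2 * (A2 * W) = W" if "dim_row W = d'" for W
    using that eqs by (simp_all add: mat_one_l mat_zero_l flip: mat_assoc)
  have tw: "B1 * W = W1 * B1" "B2 * W = W2 * B2"
    if "A1 * W1 = W * A1" "A2 * W2 = W * A2" "W \<in> carrier_mat e e" "W1 \<in> carrier_mat d d"
      "W2 \<in> carrier_mat d' d'"
    for W W1 W2
  proof -
    have "W = W * (A1 * B1 + A2 * B2)" using that id by (simp add: Md mat_one_r)
    also have "\<dots> = (W * A1) * B1 + (W * A2) * B2" using that(3) by (simp add: mat_distl mat_assoc)
    also have "\<dots> = A1 * (W1 * B1) + A2 * (W2 * B2)"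
      unfolding that(1,2)[symmetric] using that(4,5) by (simp add: mat_assoc)
    finally have W: "W = A1 * (W1 * B1) + A2 * (W2 * B2)" .
    show "B1 * W = W1 * B1" "B2 * W = W2 * B2"
      using that(4,5) by (subst W, simp add: mat_distl L1 L2 mat_add_zero)+
  qed
  have "B1 * K = G * B1" "B2 * K = G' * B2" "B1 * L = H * B1" "B2 * L = H' * B2"
    using hom unfolding Md by (auto intro!: tw carrier_matI)
  then have "pair_hom S M B1" "pair_hom S N B2" using B unfolding Md by auto
  then show ?thesis unfolding biprod_def using hom eqs id by (auto simp: Md)
qed

lemma chainG_shift: "chainG l i = shift_mat l l 0 0 (\<lambda>c. p ^ (i + c))"
  and chainH_shift: "chainH l = shift_mat l l 0 1 (\<lambda>_. 1)"
  by (auto simp: chainG_def chainH_def shift_mat_def intro!: eq_matI)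

text \<open>Let \<open>a\<^sub>0, a\<^sub>1\<close> be the basis of the chain \<open>C(2,0)\<close>. A map from a chain into \<open>C(2,0) \<otimes> C(l,i)\<close> has the
  form \<open>x \<mapsto> a\<^sub>0 \<otimes> V x + a\<^sub>1 \<otimes> Y x\<close>; the premises express, in terms of these components, that two
  such maps are intertwiners and that the maps with components \<open>V1', Y1', V2', Y2'\<close> form an
  inverse of their sum.\<close>

lemma chain_2_tensor_biprod:
  assumes le: "l \<le> n" "m \<le> n" "m' \<le> n" "2 * l = m + m'"
    and car: "V1 \<in> carrier_mat l m" "Y1 \<in> carrier_mat l m" "V2 \<in> carrier_mat l m'" "Y2 \<in> carrier_mat l m'"
      "V1' \<in> carrier_mat m l" "Y1' \<in> carrier_mat m l" "V2' \<in> carrier_mat m' l" "Y2' \<in> carrier_mat m' l"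
    and h1: "chainG l i * V1 = V1 * chainG m j" "p \<cdot>\<^sub>m (chainG l i * Y1) = Y1 * chainG m j"
      "chainH l * V1 = V1 * chainH m" "chainH l * Y1 + chainG l i * V1 = Y1 * chainH m"
    and h2: "chainG l i * V2 = V2 * chainG m' j'" "p \<cdot>\<^sub>m (chainG l i * Y2) = Y2 * chainG m' j'"
      "chainH l * V2 = V2 * chainH m'" "chainH l * Y2 + chainG l i * V2 = Y2 * chainH m'"
    and id: "V1 * V1' + V2 * V2' = 1\<^sub>m l" "V1 * Y1' + V2 * Y2' = 0\<^sub>m l l"
      "Y1 * V1' + Y2 * V2' = 0\<^sub>m l l" "Y1 * Y1' + Y2 * Y2' = 1\<^sub>m l"
  shows "biprod (chain m j) (chain m' j') (pair_tensor (chain 2 0) (chain l i))"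
proof -
  define a0 a1 where "a0 = mat 2 1 (\<lambda>(r,c). if r = 0 then 1 else 0 :: 'k)"
    and "a1 = mat 2 1 (\<lambda>(r,c). if r = 1 then 1 else 0 :: 'k)"
  define b0 b1 where "b0 = mat 1 2 (\<lambda>(r,c). if c = 0 then 1 else 0 :: 'k)"
    and "b1 = mat 1 2 (\<lambda>(r,c). if c = 1 then 1 else 0 :: 'k)"
  have ad[simp]: "dim_row a0 = 2" "dim_col a0 = 1" "dim_row a1 = 2" "dim_col a1 = 1"
    "dim_row b0 = 1" "dim_col b0 = 2" "dim_row b1 = 1" "dim_col b1 = 2"
    by (simp_all add: a0_def a1_def b0_def b1_def)
  have two: "{..<2} = {0, 1::nat}" by auto
  have e: "chainG 2 0 * a0 = a0" "chainG 2 0 * a1 = p \<cdot>\<^sub>m a1" "chainH 2 * a0 = a1" "chainH 2 * a1 = 0\<^sub>m 2 1"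
    by (rule eq_matI; auto simp: mult_entry chainG_def chainH_def a0_def a1_def two less_2_cases_iff
      simp del: index_mult_mat(1))+
  have [simp]: "dim_row V1 = l" "dim_col V1 = m" "dim_row Y1 = l" "dim_col Y1 = m"
    "dim_row V2 = l" "dim_col V2 = m'" "dim_row Y2 = l" "dim_col Y2 = m'"
    "dim_row V1' = m" "dim_col V1' = l" "dim_row Y1' = m" "dim_col Y1' = l"
    "dim_row V2' = m'" "dim_col V2' = l" "dim_row Y2' = m'" "dim_col Y2' = l"
    using car by auto
  have hom: "pair_hom (chain k u) (pair_tensor (chain 2 0) (chain l i)) (kronecker a0 V + kronecker a1 Y)"
    if h: "chainG l i * V = V * chainG k u" "p \<cdot>\<^sub>m (chainG l i * Y) = Y * chainG k u"
      "chainH l * V = V * chainH k" "chainH l * Y + chainG l i * V = Y * chainH k"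
      and c: "V \<in> carrier_mat l k" "Y \<in> carrier_mat l k" for k u V Y
  proof -
    have [simp]: "dim_row V = l" "dim_col V = k" "dim_row Y = l" "dim_col Y = k" using c by auto
    have 1: "kronecker (chainG 2 0) (chainG l i) * (kronecker a0 V + kronecker a1 Y) =
        (kronecker a0 V + kronecker a1 Y) * kronecker (1\<^sub>m 1) (chainG k u)"
      by (simp add: mat_distl mat_distr kronecker_mult e mat_one_r kronecker_smult_l h(1) flip: h(2)
        kronecker_smult_r)
    have 2: "(kronecker (1\<^sub>m 2) (chainH l) + kronecker (chainH 2) (chainG l i)) * (kronecker a0 V
      + kronecker a1 Y)
        = (kronecker a0 V + kronecker a1 Y) * kronecker (1\<^sub>m 1) (chainH k)"
    proof -
      have "(kronecker (1\<^sub>m 2) (chainH l) + kronecker (chainH 2) (chainG l i)) * (kronecker a0 V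
        + kronecker a1 Y)
        = kronecker a0 (V * chainH k) + (kronecker a1 (chainH l * Y) + kronecker a1 (chainG l i * V))"
        by (auto simp: mat_distl mat_distr kronecker_mult e mat_one_l kronecker_zero h(3) intro!: eq_matI)
      also have "kronecker a1 (chainH l * Y) + kronecker a1 (chainG l i * V) = kronecker a1 (Y * chainH k)"
        by (simp add: h(4) flip: kronecker_add_r)
      finally show ?thesis by (simp add: mat_distr kronecker_mult mat_one_r)
    qed
    have one: "kronecker (1\<^sub>m 1) W = W" for W :: "'k mat"
      by (subst kronecker_scalar) (auto intro!: eq_matI)
    show ?thesis using 1 2 unfolding one chain_def by (auto intro!: carrier_matI)
  qed
  have f: "fst (pair_tensor (chain 2 0) (chain l i)) = 2 * l" by simp
  show ?thesis
  proof (rule biprod_squareI[of _ _ _ "kronecker a0 V1 + kronecker a1 Y1" "kronecker a0 V2 + kronecker a1 Y2"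
        "kronecker b0 V1' + kronecker b1 Y1'" "kronecker b0 V2' + kronecker b1 Y2'"])
    show "chain m j \<in> taft_pairs" "chain m' j' \<in> taft_pairs" "pair_tensor (chain 2 0) (chain l i) \<in> taft_pairs"
      using le n2 by (auto intro!: pair_tensor_taft_pair chain_taft_pair)
    show "pair_hom (chain m j) (pair_tensor (chain 2 0) (chain l i)) (kronecker a0 V1 + kronecker a1 Y1)"
      by (rule hom[OF h1 car(1,2)])
    show "pair_hom (chain m' j') (pair_tensor (chain 2 0) (chain l i)) (kronecker a0 V2 + kronecker a1 Y2)"
      by (rule hom[OF h2 car(3,4)])
    have "(kronecker a0 V1 + kronecker a1 Y1) * (kronecker b0 V1' + kronecker b1 Y1')
      + (kronecker a0 V2 + kronecker a1 Y2) * (kronecker b0 V2' + kronecker b1 Y2')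
      = (kronecker (a0 * b0) (V1 * V1') + kronecker (a0 * b0) (V2 * V2'))
      + (kronecker (a0 * b1) (V1 * Y1') + kronecker (a0 * b1) (V2 * Y2'))
      + (kronecker (a1 * b0) (Y1 * V1') + kronecker (a1 * b0) (Y2 * V2'))
      + (kronecker (a1 * b1) (Y1 * Y1') + kronecker (a1 * b1) (Y2 * Y2'))"
      by (rule eq_matI) (auto simp: mat_distl mat_distr kronecker_mult simp del: index_mult_mat(1))
    also have "\<dots> = kronecker (a0 * b0) (1\<^sub>m l) + kronecker (a0 * b1) (0\<^sub>m l l)
      + kronecker (a1 * b0) (0\<^sub>m l l) + kronecker (a1 * b1) (1\<^sub>m l)"
      by (simp add: id flip: kronecker_add_r)
    also have "\<dots> = kronecker (a0 * b0 + a1 * b1) (1\<^sub>m l)"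
      by (simp add: kronecker_zero kronecker_add_l mat_add_zero)
    also have "a0 * b0 + a1 * b1 = 1\<^sub>m 2"
      by (rule eq_matI) (auto simp: mult_entry a0_def a1_def b0_def b1_def less_2_cases_iff simp del:
        index_mult_mat(1))
    finally show "(kronecker a0 V1 + kronecker a1 Y1) * (kronecker b0 V1' + kronecker b1 Y1')
      + (kronecker a0 V2 + kronecker a1 Y2) * (kronecker b0 V2' + kronecker b1 Y2')
      = 1\<^sub>m (fst (pair_tensor (chain 2 0) (chain l i)))"
      by (simp add: kronecker_one)
  qed (use le in \<open>auto intro!: carrier_matI\<close>)
qed

text \<open>These sums occur in \<open>H\<^sup>j (a\<^sub>0 \<otimes> v\<^sub>0) = a\<^sub>0 \<otimes> v\<^sub>j + weight_sum i j (a\<^sub>1 \<otimes> v\<^sub>j\<^sub>-\<^sub>1)\<close>.\<close>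

definition weight_sum :: "nat \<Rightarrow> nat \<Rightarrow> 'k" where
  "weight_sum i j = (\<Sum>t<j. p ^ (i + t))"

lemma weight_sum_simps[simp]: "weight_sum i 0 = 0" "weight_sum i (Suc j) = weight_sum i j + p ^ (i + j)"
  by (simp_all add: weight_sum_def)

lemma weight_sum_eq_0_iff: "weight_sum i l = 0 \<longleftrightarrow> l mod n = 0"
proof -
  have p1: "p \<noteq> 1"
  proof
    assume "p = 1" then have "q = 1" using pq by simp
    then show False using q_pow_eq_one_iff[of 1] n2 by simp
  qed
  have "weight_sum i l = p ^ i * (\<Sum>t<l. p ^ t)" by (simp add: weight_sum_def power_add sum_distrib_left)
  moreover have "(p - 1) * (\<Sum>t<l. p ^ t) = p ^ l - 1" by (rule power_diff_1_eq[symmetric])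
  moreover have "p ^ l = 1 \<longleftrightarrow> l mod n = 0" using qp_pow_eq_one_iff[of 0 l] by auto
  ultimately show ?thesis using p1 by auto
qed

text \<open>Write \<open>c\<^sub>j\<close> for \<open>weight_sum i j\<close> and \<open>z = c\<^sub>l\<close>, which is not zero since \<open>0 < l < n\<close>. The vectors
  \<open>x\<^sub>j = a\<^sub>0 \<otimes> v\<^sub>j + c\<^sub>j (a\<^sub>1 \<otimes> v\<^sub>j\<^sub>-\<^sub>1)\<close> for \<open>0 \<le> j \<le> l\<close> form a chain starting at \<open>a\<^sub>0 \<otimes> v\<^sub>0\<close>, and the vectors
  \<open>y\<^sub>j = a\<^sub>0 \<otimes> v\<^sub>j\<^sub>+\<^sub>1 + (c\<^sub>j\<^sub>+\<^sub>1 - z) (a\<^sub>1 \<otimes> v\<^sub>j)\<close> for \<open>0 \<le> j < l - 1\<close> form another one. Because of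
  \<open>x\<^sub>j\<^sub>+\<^sub>1 - y\<^sub>j = z (a\<^sub>1 \<otimes> v\<^sub>j)\<close> (with \<open>y\<^sub>l\<^sub>-\<^sub>1 = 0\<close>), they form a basis together, and the inverse is
  explicit.\<close>

lemma chain_2_tensor_chain:
  assumes "1 \<le> l" "l < n"
  shows "biprod (chain (l + 1) i) (chain (l - 1) (i + 1)) (pair_tensor (chain 2 0) (chain l i))"
proof -
  define c where "c = weight_sum i"
  define z where "z = c l"
  define w where "w = inverse z"
  have "z \<noteq> 0" using assms by (simp add: z_def c_def weight_sum_eq_0_iff)
  then have zw: "z * w = 1" by (simp add: w_def)
  have c: "c 0 = 0" "\<And>j. c (Suc j) = c j + p ^ (i + j)" by (simp_all add: c_def)
  obtain k where k: "l = Suc k" using assms by (cases l) auto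
  have zk: "c k + p ^ (i + k) = z" using c(2)[of k] by (simp add: z_def k)
  have zwk: "c k * w + p ^ (i + k) * w = 1" using zw by (simp flip: zk add: distrib_right)
  let ?V1 = "shift_mat l (l + 1) 0 0 (\<lambda>_. 1)" and ?Y1 = "shift_mat l (l + 1) 1 0 c"
    and ?V2 = "shift_mat l (l - 1) 0 1 (\<lambda>_. 1)" and ?Y2 = "shift_mat l (l - 1) 0 0 (\<lambda>j. c (Suc j) - z)"
    and ?V1' = "shift_mat (l + 1) l 0 0 (\<lambda>j. 1 - c j * w)" and ?Y1' = "shift_mat (l + 1) l 0 1 (\<lambda>j. w)"
    and ?V2' = "shift_mat (l - 1) l 1 0 (\<lambda>j. c j * w)" and ?Y2' = "shift_mat (l - 1) l 0 0 (\<lambda>j. - w)"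
  note sh = chainG_shift chainH_shift shift_mat_mult_entry shift_mat_entry k less_Suc_eq
  show ?thesis
  proof (rule chain_2_tensor_biprod)
    show "?V1 \<in> carrier_mat l (l + 1)" "?Y1 \<in> carrier_mat l (l + 1)" "?V2 \<in> carrier_mat l (l - 1)"
      "?Y2 \<in> carrier_mat l (l - 1)" "?V1' \<in> carrier_mat (l + 1) l" "?Y1' \<in> carrier_mat (l + 1) l"
      "?V2' \<in> carrier_mat (l - 1) l" "?Y2' \<in> carrier_mat (l - 1) l" by (rule carrier_matI; simp)+
    show "chainG l i * ?V1 = ?V1 * chainG (l + 1) i" "p \<cdot>\<^sub>m (chainG l i * ?Y1) = ?Y1 * chainG (l + 1) i"
      "chainH l * ?V1 = ?V1 * chainH (l + 1)" "chainH l * ?Y1 + chainG l i * ?V1 = ?Y1 * chainH (l + 1)"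
      "chainG l i * ?V2 = ?V2 * chainG (l - 1) (i + 1)" "p \<cdot>\<^sub>m (chainG l i * ?Y2) = ?Y2 * chainG (l - 1) (i + 1)"
      "chainH l * ?V2 = ?V2 * chainH (l - 1)"
      by (rule mat_eqI_column; auto simp: sh c algebra_simps simp del: index_mult_mat(1))+
    show "chainH l * ?Y2 + chainG l i * ?V2 = ?Y2 * chainH (l - 1)"
      by (rule mat_eqI_column; use zk in \<open>auto simp: sh c algebra_simps simp del: index_mult_mat(1)\<close>)
    show "?V1 * ?V1' + ?V2 * ?V2' = 1\<^sub>m l" "?V1 * ?Y1' + ?V2 * ?Y2' = 0\<^sub>m l l"
      by (rule mat_eqI_column; auto simp: sh c algebra_simps simp del: index_mult_mat(1))+
    have zwx: "x * (z * w) = x" "z * (x * w) = x" for x using zw by (simp_all add: mult.left_commute[of z])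
    show "?Y1 * ?V1' + ?Y2 * ?V2' = 0\<^sub>m l l"
      by (rule mat_eqI_column; auto simp: sh c ring_distribs mult.assoc zwx simp del: index_mult_mat(1))
    show "?Y1 * ?Y1' + ?Y2 * ?Y2' = 1\<^sub>m l"
      by (rule mat_eqI_column; use zwk in \<open>auto simp: sh c ring_distribs zw simp del: index_mult_mat(1)\<close>)
  qed (use assms in auto)
qed

text \<open>For \<open>l = n\<close> the sum \<open>c\<^sub>n\<close> vanishes, so the chain starting at \<open>a\<^sub>0 \<otimes> v\<^sub>0\<close> has length \<open>n\<close>; the vectors
  \<open>a\<^sub>1 \<otimes> v\<^sub>j\<close> form a second chain of length \<open>n\<close>, and together they are a basis.\<close>

lemma chain_2_tensor_chain_n:
  "biprod (chain n i) (chain n (i + 1)) (pair_tensor (chain 2 0) (chain n i))"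
proof -
  define c where "c = weight_sum i"
  obtain k where k: "n = Suc k" using n2 by (cases n) auto
  have z: "c n = 0" by (simp add: c_def weight_sum_eq_0_iff)
  have c: "c 0 = 0" "\<And>j. c (Suc j) = c j + p ^ (i + j)" by (simp_all add: c_def)
  have z': "c k = - (p ^ (i + k))" using z c(2)[of k] k by (simp add: eq_neg_iff_add_eq_0)
  show ?thesis
  proof (rule chain_2_tensor_biprod[where ?V1.0 = "shift_mat n n 0 0 (\<lambda>_. 1)" and ?Y1.0 = "shift_mat n n 1 0 c"
        and ?V2.0 = "shift_mat n n 0 0 (\<lambda>_. 0)" and ?Y2.0 = "shift_mat n n 0 0 (\<lambda>j. 1)"
        and V1' = "shift_mat n n 0 0 (\<lambda>j. 1)" and Y1' = "shift_mat n n 0 0 (\<lambda>j. 0)"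
        and V2' = "shift_mat n n 1 0 (\<lambda>j. - c j)" and Y2' = "shift_mat n n 0 0 (\<lambda>j. 1)"])
  qed (use z' in \<open>auto intro!: mat_eqI_column carrier_matI simp: chainG_shift chainH_shift
    shift_mat_mult_entry shift_mat_entry c k less_Suc_eq
        simp del: index_mult_mat(1)\<close>)
qed

end

section \<open>Ideals and quotients of rings given by a type\<close>

lemma type_ring_simps: "carrier (ring_of_type_algebra :: 'a::ring_1 ring) = UNIV"
  "x \<oplus>\<^bsub>ring_of_type_algebra\<^esub> y = x + (y::'a)" "x \<otimes>\<^bsub>ring_of_type_algebra\<^esub> y = x * (y::'a)"
  "\<one>\<^bsub>ring_of_type_algebra\<^esub> = (1::'a)" "\<zero>\<^bsub>ring_of_type_algebra\<^esub> = (0::'a)"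
  by (simp_all add: ring_of_type_algebra_def)

lemma ring_type_ring: "ring (ring_of_type_algebra :: 'a::ring_1 ring)"
proof -
  have "\<exists>y. x + y = 0" for x :: 'a
    using add.right_inverse by blast
  then show ?thesis
    unfolding ring_of_type_algebra_def using add.right_inverse
    by unfold_locales (auto simp: algebra_simps Units_def)
qed

text \<open>Ideals of \<open>ring_of_type_algebra\<close>, expressed by the operations of the type class.\<close>

definition type_ideal :: "'a::ring_1 set \<Rightarrow> bool" where
  "type_ideal I \<longleftrightarrow> 0 \<in> I \<and> (\<forall>a\<in>I. \<forall>b\<in>I. a + b \<in> I) \<and> (\<forall>a\<in>I. \<forall>r. r * a \<in> I \<and> a * r \<in> I)"

lemma type_ring_minus: "\<ominus>\<^bsub>ring_of_type_algebra\<^esub> x = - (x::'a::ring_1)"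
proof -
  interpret ring "ring_of_type_algebra :: 'a ring" by (rule ring_type_ring)
  show ?thesis using minus_equality[of "-x" x] by (simp add: type_ring_simps)
qed

lemma type_ideal_iff: "ideal I (ring_of_type_algebra :: 'a::ring_1 ring) \<longleftrightarrow> type_ideal I"
proof
  interpret ring "ring_of_type_algebra :: 'a ring" by (rule ring_type_ring)
  {
    assume "ideal I (ring_of_type_algebra :: 'a ring)"
    then interpret ideal I "ring_of_type_algebra :: 'a ring" .
    show "type_ideal I" unfolding type_ideal_def
      using additive_subgroup.zero_closed[OF is_additive_subgroup]
        a_closed I_l_closed I_r_closed by (simp add: type_ring_simps)
  next
    assume I: "type_ideal I"
    have neg: "- a \<in> I" if "a \<in> I" for a
    proof -
      have "(-1) * a \<in> I" using I that unfolding type_ideal_def by blast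
      then show ?thesis by simp
    qed
    show "ideal I (ring_of_type_algebra :: 'a ring)"
    proof (rule idealI)
      show "subgroup I (add_monoid (ring_of_type_algebra :: 'a ring))"
        by (rule add.subgroupI) (use I neg in \<open>auto simp: type_ideal_def type_ring_simps type_ring_minus\<close>)
    qed (use I in \<open>auto simp: type_ideal_def type_ring_simps intro: ring_axioms\<close>)
  }
qed

lemma type_ideal_Idl: "type_ideal (Idl\<^bsub>ring_of_type_algebra\<^esub> (S :: 'a::ring_1 set))"
proof -
  interpret ring "ring_of_type_algebra :: 'a ring" by (rule ring_type_ring)
  show ?thesis using genideal_ideal[of S] by (simp add: type_ideal_iff type_ring_simps)
qed

lemma Idl_superset: "S \<subseteq> Idl\<^bsub>ring_of_type_algebra\<^esub> (S :: 'a::ring_1 set)"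
proof -
  interpret ring "ring_of_type_algebra :: 'a ring" by (rule ring_type_ring)
  show ?thesis using genideal_self[of S] by (simp add: type_ring_simps)
qed

lemma Idl_least: "type_ideal I \<Longrightarrow> S \<subseteq> I \<Longrightarrow> Idl\<^bsub>ring_of_type_algebra\<^esub> (S :: 'a::ring_1 set) \<subseteq> I"
proof -
  interpret ring "ring_of_type_algebra :: 'a ring" by (rule ring_type_ring)
  show "type_ideal I \<Longrightarrow> S \<subseteq> I \<Longrightarrow> Idl\<^bsub>ring_of_type_algebra\<^esub> S \<subseteq> I"
    using genideal_minimal[of I S] by (simp add: type_ideal_iff)
qed

lemma type_idealD:
  assumes "type_ideal (I :: 'a::ring_1 set)"
  shows "0 \<in> I" "a \<in> I \<Longrightarrow> b \<in> I \<Longrightarrow> a + b \<in> I" "a \<in> I \<Longrightarrow> r * a \<in> I" "a \<in> I \<Longrightarrow> a * r \<in> I"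
    "a \<in> I \<Longrightarrow> - a \<in> I" "a \<in> I \<Longrightarrow> b \<in> I \<Longrightarrow> a - b \<in> I"
proof -
  show 1: "0 \<in> I" "a \<in> I \<Longrightarrow> b \<in> I \<Longrightarrow> a + b \<in> I" "a \<in> I \<Longrightarrow> r * a \<in> I" "a \<in> I \<Longrightarrow> a * r \<in> I" for a b r
    using assms unfolding type_ideal_def by blast+
  show 2: "a \<in> I \<Longrightarrow> - a \<in> I" for a using 1(3)[of a "-1"] by simp
  show "a \<in> I \<Longrightarrow> b \<in> I \<Longrightarrow> a - b \<in> I" using 1(2)[of a "-b"] 2[of b] by simp
qed

lemma type_coset: "(I :: 'a::ring_1 set) +>\<^bsub>ring_of_type_algebra\<^esub> a = {x. x - a \<in> I}"
proof -
  have "I +>\<^bsub>ring_of_type_algebra\<^esub> a = {i + a | i. i \<in> I}"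
    unfolding a_r_coset_def r_coset_def by (auto simp: ring_of_type_algebra_def)
  also have "\<dots> = {x. x - a \<in> I}" by (auto intro!: exI[of _ "_ - a"])
  finally show ?thesis .
qed

section \<open>Linear independence in the quotient of the polynomial ring\<close>

text \<open>With the value \<open>0\<close> at \<open>0\<close> the recursion also produces \<open>f_poly 2\<close>.\<close>

lemma f_poly_rec: "f_poly (Suc (Suc m)) = z_var * f_poly (Suc m) - y_var * f_poly m"
  by (cases m) simp_all

lemma coeff_z_var_mult: "coeff (z_var * f) k = (case k of 0 \<Rightarrow> 0 | Suc k' \<Rightarrow> coeff f k')"
  by (cases k) (simp_all add: z_var_def)

lemma coeff_y_var_mult: "coeff (y_var * f) k = [:0, 1:] * coeff f k"
  by (simp add: y_var_def)

lemma coeff_f_poly: "coeff (f_poly (Suc m)) m = 1 \<and> (\<forall>k>m. coeff (f_poly (Suc m)) k = 0)"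
proof (induction m rule: less_induct)
  case (less m)
  show ?case
  proof (cases m)
    case (Suc m')
    have IH: "coeff (f_poly (Suc m')) m' = 1" "\<And>k. k > m' \<Longrightarrow> coeff (f_poly (Suc m')) k = 0"
      using less[of m'] Suc by auto
    have IH2: "coeff (f_poly m') k = 0" if "k > m'" for k
      using less[of "m' - 1"] Suc that by (cases m') auto
    show ?thesis unfolding Suc f_poly_rec coeff_diff coeff_z_var_mult coeff_y_var_mult
      using IH IH2 by (auto split: nat.splits)
  qed simp
qed

definition top_poly :: "nat \<Rightarrow> int poly poly" where
  "top_poly n = (z_var - y_var - 1) * f_poly n"

lemma coeff_top_poly:
  assumes "n \<ge> 1"
  shows "coeff (top_poly n) n = 1" "k > n \<Longrightarrow> coeff (top_poly n) k = 0"
proof -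
  obtain m where m: "n = Suc m" using assms by (cases n) auto
  have e: "top_poly n = z_var * f_poly n - y_var * f_poly n - f_poly n"
    by (simp add: top_poly_def left_diff_distrib)
  show "coeff (top_poly n) n = 1" "k > n \<Longrightarrow> coeff (top_poly n) k = 0"
    unfolding e coeff_diff coeff_z_var_mult coeff_y_var_mult unfolding m
    using coeff_f_poly[of m] by (auto split: nat.splits)
qed

lemma y_var_power: "y_var ^ i = [:monom 1 i:]"
  by (induction i) (simp_all add: y_var_def one_poly_def[symmetric] monom_Suc)

text \<open>Modulo \<open>y\<^sup>n - 1\<close>, an element of the ideal is a multiple \<open>b g\<close> of a polynomial \<open>g\<close> that is monic of
  degree \<open>n\<close> in \<open>z\<close>. If the degree of the multiple is less than \<open>n\<close>, comparison of leading
  coefficients shows that \<open>b\<close> vanishes modulo \<open>y\<^sup>n - 1\<close>.\<close>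

lemma green_ideal_coeffs:
  assumes r: "r \<in> green_ideal n" and n: "n \<ge> 1" and deg: "\<And>k. k \<ge> n \<Longrightarrow> coeff r k = 0"
  shows "monom 1 n - 1 dvd coeff r k"
proof -
  define Y where "Y = (monom 1 n - 1 :: int poly)"
  let ?g = "top_poly n"
  \<comment> \<open>This contains the ideal, since it is an ideal containing the generators.\<close>
  define J where "J = {r. \<exists>b. \<forall>k. Y dvd coeff (r - b * ?g) k}"
  have J: "type_ideal J" unfolding type_ideal_def
  proof (intro conjI ballI allI)
    show "0 \<in> J" unfolding J_def by (auto intro!: exI[of _ 0])
    fix a assume "a \<in> J"
    then obtain b where b: "\<And>k. Y dvd coeff (a - b * ?g) k" by (auto simp: J_def)
    {
      fix a' assume "a' \<in> J"
      then obtain b' where b': "\<And>k. Y dvd coeff (a' - b' * ?g) k" by (auto simp: J_def)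
      have "a + a' - (b + b') * ?g = (a - b * ?g) + (a' - b' * ?g)" by (simp add: algebra_simps)
      then have "Y dvd coeff (a + a' - (b + b') * ?g) k" for k
        using dvd_add[OF b[of k] b'[of k]] by (simp only: coeff_add)
      then show "a + a' \<in> J" unfolding J_def by blast
    next
      fix s
      have "s * a - (s * b) * ?g = s * (a - b * ?g)" by (simp add: algebra_simps)
      moreover have "Y dvd coeff (s * (a - b * ?g)) k" for k
        unfolding coeff_mult by (intro dvd_sum dvd_mult b)
      ultimately have "Y dvd coeff (s * a - (s * b) * ?g) k" for k by (simp only:)
      then show "s * a \<in> J" unfolding J_def by blast
      then show "a * s \<in> J" by (simp add: mult.commute)
    }
  qed
  have "{y_var ^ n - 1, (z_var - y_var - 1) * f_poly n} \<subseteq> J"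
  proof -
    have "y_var ^ n - 1 = [:Y:]" by (simp add: y_var_power Y_def one_pCons)
    then have "Y dvd coeff (y_var ^ n - 1 - 0 * ?g) k" for k by (simp add: coeff_pCons split: nat.splits)
    then have "y_var ^ n - 1 \<in> J" unfolding J_def by blast
    moreover have "?g \<in> J" unfolding J_def by (auto intro!: exI[of _ 1])
    ultimately show ?thesis by (simp add: top_poly_def)
  qed
  from Idl_least[OF J this] have "r \<in> J" using r unfolding green_ideal_def by blast
  then obtain b where b: "\<And>k. Y dvd coeff (r - b * ?g) k" by (auto simp: J_def)
  have Yb: "Y dvd coeff b k" for k
  proof (rule ccontr)
    assume nd: "\<not> Y dvd coeff b k"
    \<comment> \<open>The largest index m of a coefficient of b that is not divisible by Y;
      in coefficient m + n of b times the monic polynomial all other terms are divisible by Y.\<close>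
    define K where "K = {k. \<not> Y dvd coeff b k}"
    have "K \<subseteq> {..degree b}"
    proof
      fix k assume "k \<in> K"
      then have "coeff b k \<noteq> 0" by (auto simp: K_def)
      then show "k \<in> {..degree b}" by (simp add: le_degree)
    qed
    then have finK: "finite K" by (rule finite_subset) simp
    have "K \<noteq> {}" using nd by (auto simp: K_def)
    define m where "m = Max K"
    have mK: "m \<in> K" unfolding m_def by (rule Max_in) fact+
    have above: "Y dvd coeff b j" if "j > m" for j
      using Max_ge[OF finK, of j] that unfolding m_def[symmetric] by (auto simp: K_def)
    have "coeff (b * ?g) (m + n) = (\<Sum>i\<le>m + n. coeff b i * coeff ?g (m + n - i))" by (rule coeff_mult)
    also have "\<dots> = coeff b m * coeff ?g n + (\<Sum>i\<in>{..m + n} - {m}. coeff b i * coeff ?g (m + n - i))"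
      by (subst sum.remove[of _ m]) auto
    finally have eq: "coeff (b * ?g) (m + n) = coeff b m + (\<Sum>i\<in>{..m + n} - {m}. coeff b i * coeff ?g (m
      + n - i))"
      by (simp add: coeff_top_poly(1)[OF n])
    have "Y dvd (\<Sum>i\<in>{..m + n} - {m}. coeff b i * coeff ?g (m + n - i))"
    proof (rule dvd_sum)
      fix i assume "i \<in> {..m + n} - {m}"
      then show "Y dvd coeff b i * coeff ?g (m + n - i)"
        using above[of i] coeff_top_poly(2)[OF n, of "m + n - i"] by (cases "i > m") auto
    qed
    moreover have "Y dvd coeff (b * ?g) (m + n)"
      using b[of "m + n"] deg[of "m + n"] by simp
    ultimately have "Y dvd coeff b m" unfolding eq by (simp add: dvd_add_left_iff)
    then show False using mK by (simp add: K_def)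
  qed
  have "Y dvd coeff (b * ?g) k" unfolding coeff_mult by (intro dvd_sum dvd_mult2 Yb)
  with b[of k] have "Y dvd coeff r k" by (metis coeff_diff diff_add_cancel dvd_add)
  then show ?thesis by (simp add: Y_def)
qed

text \<open>Since \<open>f\<^sub>l\<close> is monic of degree \<open>l - 1\<close> in \<open>z\<close>, the coefficient of \<open>z\<^sup>m\<^sup>-\<^sup>1\<close> is \<open>C m\<close>; its degree in \<open>y\<close> is too
  small for a nonzero multiple of \<open>y\<^sup>n - 1\<close>.\<close>

lemma f_poly_combination_zero:
  assumes "m \<le> n" and "n \<ge> 1"
    and "\<And>k. monom 1 n - 1 dvd coeff (\<Sum>l=1..m. smult (C l) (f_poly l)) k"
    and "\<And>l k. k \<ge> n \<Longrightarrow> coeff (C l) k = 0" and "1 \<le> l" "l \<le> m"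
  shows "C l = (0 :: int poly)"
  using assms
proof (induction m)
  case (Suc m)
  have "coeff (\<Sum>l=1..Suc m. smult (C l) (f_poly l)) m = C (Suc m)"
  proof -
    have "coeff (f_poly l) m = 0" if "l \<in> {1..m}" for l
      using coeff_f_poly[of "l - 1"] that by (cases l) auto
    then show ?thesis using coeff_f_poly[of m] by (simp add: coeff_sum)
  qed
  then have "monom 1 n - 1 dvd C (Suc m)" using Suc.prems(3)[of m] by simp
  moreover have "degree (monom 1 n - 1 :: int poly) = n"
    using \<open>n \<ge> 1\<close> degree_add_eq_left[of "- 1 :: int poly" "monom 1 n"] by (simp add: degree_monom_eq)
  moreover have "degree (C (Suc m)) < n" if "C (Suc m) \<noteq> 0"
    using Suc.prems(4) that by (metis leading_coeff_0_iff not_le)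
  ultimately have 0: "C (Suc m) = 0"
    using dvd_imp_degree_le[of "monom 1 n - 1" "C (Suc m)"] by (metis not_le)
  show ?case
  proof (cases "l = Suc m")
    case False
    show ?thesis
    proof (rule Suc.IH)
      show "monom 1 n - 1 dvd coeff (\<Sum>l=1..m. smult (C l) (f_poly l)) k" for k
        using Suc.prems(3)[of k] by (simp add: 0)
    qed (use Suc.prems False in auto)
  qed (simp add: 0)
qed simp

lemma green_basis_independent:
  assumes "(\<Sum>l=1..n. \<Sum>i<n. of_int (c l i) * (y_var ^ i * f_poly l)) \<in> green_ideal n"
    and "1 \<le> l" "l \<le> n" "i < n"
  shows "c l i = 0"
proof -
  define C where "C l = (\<Sum>i<n. monom (c l i) i)" for l
  have cC: "coeff (C l) k = (if k < n then c l k else 0)" for l k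
    by (simp add: C_def coeff_sum)
  have "of_int a * (y_var ^ i * f) = smult (monom a i) f" for a i f
    by (simp add: y_var_power of_int_poly smult_monom)
  then have e: "(\<Sum>l=1..n. \<Sum>i<n. of_int (c l i) * (y_var ^ i * f_poly l)) = (\<Sum>l=1..n. smult (C l) (f_poly l))"
    by (simp add: C_def smult_sum)
  have "C l = 0"
  proof (rule f_poly_combination_zero[of n n])
    show "monom 1 n - 1 dvd coeff (\<Sum>l=1..n. smult (C l) (f_poly l)) k" for k
    proof (rule green_ideal_coeffs)
      show "(\<Sum>l=1..n. smult (C l) (f_poly l)) \<in> green_ideal n" using assms(1) unfolding e .
      show "coeff (\<Sum>l=1..n. smult (C l) (f_poly l)) k = 0" if "k \<ge> n" for k
      proof -
        have "coeff (f_poly l) k = 0" if "l \<in> {1..n}" for l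
          using coeff_f_poly[of "l - 1"] that \<open>k \<ge> n\<close> by (cases l) auto
        then show ?thesis by (simp add: coeff_sum)
      qed
    qed (use assms in simp)
  qed (use assms in \<open>auto simp: cC\<close>)
  then show ?thesis using cC[of l i] assms(4) by simp
qed

context taft_root begin

section \<open>Multiplicativity of the class polynomial\<close>

definition eqv :: "int poly poly \<Rightarrow> int poly poly \<Rightarrow> bool" (infix "\<approx>" 50) where
  "a \<approx> b \<longleftrightarrow> a - b \<in> green_ideal n"

lemma green_ideal_ideal: "type_ideal (green_ideal n)"
  unfolding green_ideal_def by (rule type_ideal_Idl)

lemma eqv_refl: "a \<approx> a"
  and eqv_sym: "a \<approx> b \<Longrightarrow> b \<approx> a"
  and eqv_trans[trans]: "a \<approx> b \<Longrightarrow> b \<approx> c \<Longrightarrow> a \<approx> c"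
  and eqv_add: "a \<approx> b \<Longrightarrow> c \<approx> d \<Longrightarrow> a + c \<approx> b + d"
  and eqv_diff: "a \<approx> b \<Longrightarrow> c \<approx> d \<Longrightarrow> a - c \<approx> b - d"
  and eqv_mult: "a \<approx> b \<Longrightarrow> c \<approx> d \<Longrightarrow> a * c \<approx> b * d"
proof -
  note I = type_idealD[OF green_ideal_ideal]
  show "a \<approx> a" by (simp add: eqv_def I(1))
  show "a \<approx> b \<Longrightarrow> b \<approx> a" using I(5)[of "a - b"] by (simp add: eqv_def)
  show "a \<approx> b \<Longrightarrow> b \<approx> c \<Longrightarrow> a \<approx> c" using I(2)[of "a - b" "b - c"] by (simp add: eqv_def)
  show "a \<approx> b \<Longrightarrow> c \<approx> d \<Longrightarrow> a + c \<approx> b + d" using I(2)[of "a - b" "c - d"] by (simp add: eqv_def algebra_simps)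
  show "a \<approx> b \<Longrightarrow> c \<approx> d \<Longrightarrow> a - c \<approx> b - d" using I(6)[of "a - b" "c - d"] by (simp add: eqv_def algebra_simps)
  show "a * c \<approx> b * d" if "a \<approx> b" "c \<approx> d"
  proof -
    have "(a - b) * c + b * (c - d) \<in> green_ideal n"
      using that unfolding eqv_def by (intro I(2-4))
    then show ?thesis by (simp add: eqv_def algebra_simps)
  qed
qed

lemma y_pow_n_eqv: "y_var ^ n \<approx> 1"
  and z_top_eqv: "z_var * f_poly n \<approx> f_poly n + y_var * f_poly n"
proof -
  have "{y_var ^ n - 1, (z_var - y_var - 1) * f_poly n} \<subseteq> green_ideal n"
    unfolding green_ideal_def by (rule Idl_superset)
  then show "y_var ^ n \<approx> 1" "z_var * f_poly n \<approx> f_poly n + y_var * f_poly n"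
    by (simp_all add: eqv_def algebra_simps)
qed

lemma y_pow_mod_eqv: "y_var ^ (i mod n) \<approx> y_var ^ i"
proof -
  have "y_var ^ (n * a) \<approx> 1" for a
  proof (induction a)
    case (Suc a)
    show ?case using eqv_mult[OF y_pow_n_eqv Suc] by (simp add: power_add)
  qed (simp add: eqv_refl)
  from eqv_mult[OF this[of "i div n"] eqv_refl[of "y_var ^ (i mod n)"]]
  have "y_var ^ i \<approx> y_var ^ (i mod n)" by (simp flip: power_add)
  then show ?thesis by (rule eqv_sym)
qed

text \<open>The image of the class of a module: every summand \<open>C(l,i)\<close> contributes \<open>y\<^sup>i f\<^sub>l\<close>.\<close>

definition pair_poly :: "'k mat_pair \<Rightarrow> int poly poly" where
  "pair_poly M = (\<Sum>l=1..n. \<Sum>i<n. of_int (chain_mult l i M) * (y_var ^ i * f_poly l))"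

lemma pair_poly_biprod:
  "\<lbrakk>biprod M N S; M \<in> taft_pairs; N \<in> taft_pairs; S \<in> taft_pairs\<rbrakk> \<Longrightarrow> pair_poly S = pair_poly M + pair_poly N"
  by (simp add: pair_poly_def chain_mult_biprod distrib_right sum.distrib)

lemma zero_dim_pair: "M \<in> taft_pairs \<Longrightarrow> fst M = 0 \<Longrightarrow> M = zero_pair"
  by (cases M) (auto simp: zero_pair_def taft_pairs_def intro!: eq_matI)

lemma chain_mult_zero_pair: "chain_mult l i zero_pair = 0"
proof -
  have "layer_rank j s zero_pair = 0" for j s
  proof -
    have "(0\<^sub>m 0 0 :: 'k mat) ^\<^sub>m j * eproj (0\<^sub>m 0 0) s = 0\<^sub>m 0 0" by (rule eq_matI) auto
    then show ?thesis by (simp add: zero_pair_def mrank_eq_iff has_rank_zero)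
  qed
  then show ?thesis by (simp add: chain_mult_def)
qed

lemma pair_poly_zero_pair: "pair_poly zero_pair = 0" by (simp add: pair_poly_def chain_mult_zero_pair)

lemma chain_mult_pair_iso:
  assumes "pair_iso M N" "M \<in> taft_pairs" "N \<in> taft_pairs" shows "chain_mult l i M = chain_mult l i N"
  using chain_mult_biprod[OF pair_iso_biprod_zero_pair[OF assms] assms(2) zero_taft_pair assms(3)]
    by (simp add: chain_mult_zero_pair)

lemma pair_poly_chain_exact:
  assumes "l \<le> n" "i < n" shows "pair_poly (chain l i) = y_var ^ i * f_poly l"
proof -
  have "pair_poly (chain l i) = (\<Sum>l'=1..n. \<Sum>i'<n. if i' = i then if l' =
    l then y_var ^ i * f_poly l else 0 else 0)"
    unfolding pair_poly_def by (intro sum.cong refl) (use assms in \<open>auto simp: chain_mult_chain\<close>)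
  also have "\<dots> = (if 1 \<le> l then y_var ^ i * f_poly l else 0)" using assms by simp
  also have "\<dots> = y_var ^ i * f_poly l" by (cases l) auto
  finally show ?thesis .
qed

lemma pair_poly_chain: "l \<le> n \<Longrightarrow> pair_poly (chain l i) \<approx> y_var ^ i * f_poly l"
  using eqv_mult[OF y_pow_mod_eqv eqv_refl, of i "f_poly l"] pair_poly_chain_exact[of l "i mod n"]
  by (simp add: chain_mod)

definition multiplicative :: "'k mat_pair \<Rightarrow> bool" where
  "multiplicative V \<longleftrightarrow> V \<in> taft_pairs \<and> (\<forall>N\<in>taft_pairs. pair_poly (pair_tensor V N) \<approx> pair_poly V * pair_poly N)"

text \<open>Both sides are additive in \<open>N\<close>, and every \<open>N\<close> is a direct sum of chains.\<close>

lemma multiplicativeI: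
  assumes V: "V \<in> taft_pairs"
    and ch: "\<And>l i. \<lbrakk>1 \<le> l; l \<le> n; i < n\<rbrakk> \<Longrightarrow> pair_poly (pair_tensor V (chain l i)) \<approx> pair_poly V * (y_var
      ^ i * f_poly l)"
  shows "multiplicative V"
  unfolding multiplicative_def
proof (intro conjI ballI V)
  fix N assume "N \<in> taft_pairs"
  then show "pair_poly (pair_tensor V N) \<approx> pair_poly V * pair_poly N"
  proof (rule taft_pair_induct)
    have "pair_tensor V zero_pair = zero_pair"
      by (rule zero_dim_pair[OF pair_tensor_taft_pair[OF V zero_taft_pair]]) (simp add: zero_pair_def)
    then show "pair_poly (pair_tensor V zero_pair) \<approx> pair_poly V * pair_poly zero_pair"
      by (simp add: pair_poly_zero_pair eqv_refl)
  next
    fix l i U S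
    assume h: "1 \<le> l" "l \<le> n" "i < n" "U \<in> taft_pairs" "S \<in> taft_pairs" "biprod (chain l i) U S"
      "pair_poly (pair_tensor V U) \<approx> pair_poly V * pair_poly U"
    note ct = chain_taft_pair[OF h(2), of i]
    have "pair_poly (pair_tensor V S) = pair_poly (pair_tensor V (chain l i)) + pair_poly (pair_tensor V U)"
      by (intro pair_poly_biprod pair_tensor_biprod_right[OF h(6)] pair_tensor_taft_pair V h ct)
    also have "\<dots> \<approx> pair_poly V * (y_var ^ i * f_poly l) + pair_poly V * pair_poly U"
      by (rule eqv_add[OF ch[OF h(1-3)] h(7)])
    also have "\<dots> = pair_poly V * pair_poly S"
      by (simp add: pair_poly_biprod[OF h(6) ct h(4,5)] pair_poly_chain_exact h distrib_left)
    finally show "pair_poly (pair_tensor V S) \<approx> pair_poly V * pair_poly S" .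
  qed
qed

text \<open>Associativity of the tensor product.\<close>

lemma multiplicative_pair_tensor:
  assumes "multiplicative V" "multiplicative W" shows "multiplicative (pair_tensor V W)"
  unfolding multiplicative_def
proof (intro conjI ballI)
  have V: "V \<in> taft_pairs" "\<And>N. N \<in> taft_pairs \<Longrightarrow> pair_poly (pair_tensor V N) \<approx> pair_poly V * pair_poly N"
    and W: "W \<in> taft_pairs" "\<And>N. N \<in> taft_pairs \<Longrightarrow> pair_poly (pair_tensor W N) \<approx> pair_poly W * pair_poly N"
    using assms by (auto simp: multiplicative_def)
  show "pair_tensor V W \<in> taft_pairs" by (rule pair_tensor_taft_pair) fact+
  fix N assume N: "N \<in> taft_pairs"
  have "pair_poly (pair_tensor (pair_tensor V W) N) = pair_poly (pair_tensor V (pair_tensor W N))"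
    by (simp add: pair_tensor_assoc V W N)
  also have "\<dots> \<approx> pair_poly V * pair_poly (pair_tensor W N)" by (intro V pair_tensor_taft_pair W N)
  also have "\<dots> \<approx> pair_poly V * (pair_poly W * pair_poly N)" by (intro eqv_mult eqv_refl W N)
  also have "\<dots> = (pair_poly V * pair_poly W) * pair_poly N" by (simp add: mult.assoc)
  also have "\<dots> \<approx> pair_poly (pair_tensor V W) * pair_poly N" by (intro eqv_mult eqv_refl eqv_sym[OF V(2)] W)
  finally show "pair_poly (pair_tensor (pair_tensor V W) N) \<approx> pair_poly (pair_tensor V W) * pair_poly N" .
qed

text \<open>Both directions will be used: the set of these modules is closed under direct sums, and under
  removal of a summand that belongs to it.\<close>

lemma multiplicative_biprod:
  assumes b: "biprod V W Z" and tm: "V \<in> taft_pairs" "W \<in> taft_pairs" "Z \<in> taft_pairs" and V: "multiplicative V"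
  shows "multiplicative W \<longleftrightarrow> multiplicative Z"
proof -
  have "pair_poly (pair_tensor W N) \<approx> pair_poly W * pair_poly N \<longleftrightarrow>
    pair_poly (pair_tensor Z N) \<approx> pair_poly Z * pair_poly N" if N: "N \<in> taft_pairs" for N
  proof -
    have 1: "pair_poly (pair_tensor Z N) = pair_poly (pair_tensor V N) + pair_poly (pair_tensor W N)"
      by (intro pair_poly_biprod pair_tensor_biprod_left[OF b] pair_tensor_taft_pair tm N)
    have 2: "pair_poly Z * pair_poly N = pair_poly V * pair_poly N + pair_poly W * pair_poly N"
      by (simp add: pair_poly_biprod[OF b tm] distrib_right)
    have 3: "pair_poly (pair_tensor V N) \<approx> pair_poly V * pair_poly N" using V N
      by (simp add: multiplicative_def)
    show ?thesis
      using eqv_add[OF 3, of "pair_poly (pair_tensor W N)" "pair_poly W * pair_poly N"]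
        eqv_diff[OF _ 3, of "pair_poly (pair_tensor Z N)" "pair_poly Z * pair_poly N"] unfolding 1 2 by auto
  qed
  then show ?thesis using tm by (auto simp: multiplicative_def)
qed

lemma multiplicative_chain_1: "multiplicative (chain 1 j)"
proof (rule multiplicativeI)
  show "chain 1 j \<in> taft_pairs" using n2 by (intro chain_taft_pair) simp
  fix l i assume "1 \<le> l" "l \<le> n" "i < n"
  then have "pair_poly (pair_tensor (chain 1 j) (chain l i)) \<approx> y_var ^ (j + i) * f_poly l"
    by (subst chain_1_pair_tensor_chain) (auto intro: pair_poly_chain)
  also have "y_var ^ (j + i) * f_poly l = (y_var ^ j * f_poly 1) * (y_var ^ i * f_poly l)"
    by (simp add: power_add)
  also have "\<dots> \<approx> pair_poly (chain 1 j) * (y_var ^ i * f_poly l)"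
    using n2 by (intro eqv_mult eqv_refl eqv_sym[OF pair_poly_chain]) simp
  finally show "pair_poly (pair_tensor (chain 1 j) (chain l i)) \<approx> pair_poly (chain 1 j) * (y_var ^ i *
    f_poly l)" .
qed

lemma pair_poly_chain_2: "pair_poly (chain 2 0) = z_var"
  using pair_poly_chain_exact[of 2 0] n2 by (simp add: numeral_2_eq_2)

lemma multiplicative_chain_2: "multiplicative (chain 2 0)"
proof (rule multiplicativeI)
  show c2: "chain 2 0 \<in> taft_pairs" using n2 by (intro chain_taft_pair)
  fix l i assume l: "1 \<le> l" "l \<le> n" "i < n"
  note tc = pair_tensor_taft_pair[OF c2 chain_taft_pair[OF l(2), of i]]
  show "pair_poly (pair_tensor (chain 2 0) (chain l i)) \<approx> pair_poly (chain 2 0) * (y_var ^ i * f_poly l)"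
  proof (cases "l = n")
    case True
    have "pair_poly (pair_tensor (chain 2 0) (chain n i)) = pair_poly (chain n i) + pair_poly (chain n (i + 1))"
      by (rule pair_poly_biprod[OF chain_2_tensor_chain_n]) (use tc True in \<open>auto intro: chain_taft_pair\<close>)
    also have "\<dots> \<approx> y_var ^ i * f_poly n + y_var ^ (i + 1) * f_poly n"
      by (intro eqv_add pair_poly_chain) auto
    also have "\<dots> = y_var ^ i * (f_poly n + y_var * f_poly n)" by (simp add: algebra_simps)
    also have "\<dots> \<approx> y_var ^ i * (z_var * f_poly n)" by (intro eqv_mult eqv_refl eqv_sym[OF z_top_eqv])
    also have "\<dots> = pair_poly (chain 2 0) * (y_var ^ i * f_poly n)" by (simp add: pair_poly_chain_2)
    finally show ?thesis using True by simp
  next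
    case False
    then have ln: "l < n" using l by simp
    have "pair_poly (pair_tensor (chain 2 0) (chain l i)) = pair_poly (chain (l + 1) i)
      + pair_poly (chain (l - 1) (i + 1))"
      by (rule pair_poly_biprod[OF chain_2_tensor_chain[OF l(1) ln]]) (use tc l ln in \<open>auto intro:
        chain_taft_pair\<close>)
    also have "\<dots> \<approx> y_var ^ i * f_poly (l + 1) + y_var ^ (i + 1) * f_poly (l - 1)"
      by (intro eqv_add pair_poly_chain) (use l ln in auto)
    also have "\<dots> = y_var ^ i * (f_poly (l + 1) + y_var * f_poly (l - 1))"
      by (simp add: algebra_simps)
    also have "f_poly (l + 1) + y_var * f_poly (l - 1) = z_var * f_poly l"
      using l(1) f_poly_rec[of "l - 1"] by simp
    also have "y_var ^ i * (z_var * f_poly l) = pair_poly (chain 2 0) * (y_var ^ i * f_poly l)"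
      by (simp add: pair_poly_chain_2 mult.left_commute)
    finally show ?thesis .
  qed
qed

text \<open>For \<open>i = 0\<close> the chain of length \<open>m + 1\<close> is what remains of \<open>C(2,0) \<otimes> C(m,0)\<close> after removal of
  \<open>C(m-1,1)\<close>; a general \<open>i\<close> is reached by tensoring with \<open>C(1,i)\<close>.\<close>

lemma multiplicative_chain: "1 \<le> l \<Longrightarrow> l \<le> n \<Longrightarrow> multiplicative (chain l i)"
proof (induction l arbitrary: i rule: less_induct)
  case (less l)
  have 0: "multiplicative (chain l 0)"
  proof (cases "l \<le> 2")
    case True
    then have "l = 1 \<or> l = 2" using less by auto
    then show ?thesis using multiplicative_chain_1 multiplicative_chain_2 by auto
  next
    case False
    define m where "m = l - 1"
    have m: "2 \<le> m" "m < n" "l = m + 1" using False less by (auto simp: m_def)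
    have b: "biprod (chain (m - 1) 1) (chain l 0) (pair_tensor (chain 2 0) (chain m 0))"
      using biprod_commute[OF chain_2_tensor_chain[of m 0]] m by simp
    have "multiplicative (pair_tensor (chain 2 0) (chain m 0))"
      by (intro multiplicative_pair_tensor multiplicative_chain_2 less) (use m in auto)
    moreover have "multiplicative (chain (m - 1) 1)" by (rule less) (use m in auto)
    moreover have "chain (m - 1) 1 \<in> taft_pairs" "chain l 0 \<in> taft_pairs" "pair_tensor (chain 2 0)
      (chain m 0) \<in> taft_pairs"
      using m less n2 by (auto intro!: chain_taft_pair pair_tensor_taft_pair)
    ultimately show ?thesis
      using multiplicative_biprod[OF b] by blast
  qed
  show ?case
    using multiplicative_pair_tensor[OF multiplicative_chain_1[of i] 0] less
    by (simp add: chain_1_pair_tensor_chain[of l i 0, simplified])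
qed

lemma multiplicative_all: "M \<in> taft_pairs \<Longrightarrow> multiplicative M"
proof (induction rule: taft_pair_induct)
  case zero
  have "pair_tensor zero_pair N = zero_pair" if "N \<in> taft_pairs" for N
    by (rule zero_dim_pair[OF pair_tensor_taft_pair[OF zero_taft_pair that]]) (simp add: zero_pair_def)
  then show ?case by (simp add: multiplicative_def pair_poly_zero_pair zero_taft_pair eqv_refl)
next
  case (step l i U S)
  then show ?case
    using multiplicative_biprod[OF step(6) chain_taft_pair[of l i] step(4,5) multiplicative_chain[of l
      i]] by blast
qed

theorem pair_poly_pair_tensor: "M \<in> taft_pairs \<Longrightarrow> N \<in> taft_pairs \<Longrightarrow>
  pair_poly (pair_tensor M N) \<approx> pair_poly M * pair_poly N"
  using multiplicative_all by (auto simp: multiplicative_def)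

lemma pair_poly_unit: "pair_poly (chain 1 0) = 1"
  using pair_poly_chain_exact[of 1 0] n2 by simp

lemma pair_poly_y: "pair_poly (chain 1 1) = y_var"
  using pair_poly_chain_exact[of 1 1] n2 by simp

end

lemma quotient_simps:
  fixes I :: "'a::ring_1 set"
  assumes "type_ideal I"
  shows "carrier (ring_of_type_algebra Quot I) = range (\<lambda>a. I +>\<^bsub>ring_of_type_algebra\<^esub> a)"
    "(I +>\<^bsub>ring_of_type_algebra\<^esub> a) \<oplus>\<^bsub>ring_of_type_algebra Quot I\<^esub> (I +>\<^bsub>ring_of_type_algebra\<^esub> b) =
      I +>\<^bsub>ring_of_type_algebra\<^esub> (a + b)"
    "(I +>\<^bsub>ring_of_type_algebra\<^esub> a) \<otimes>\<^bsub>ring_of_type_algebra Quot I\<^esub> (I +>\<^bsub>ring_of_type_algebra\<^esub> b) =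
      I +>\<^bsub>ring_of_type_algebra\<^esub> (a * b)"
    "\<one>\<^bsub>ring_of_type_algebra Quot I\<^esub> = I +>\<^bsub>ring_of_type_algebra\<^esub> 1"
proof -
  interpret ideal I "ring_of_type_algebra :: 'a ring" using assms by (simp add: type_ideal_iff)
  show "carrier (ring_of_type_algebra Quot I) = range (\<lambda>a. I +>\<^bsub>ring_of_type_algebra\<^esub> a)"
    by (auto simp: FactRing_def A_RCOSETS_defs a_r_coset_def type_ring_simps)
  note h = rcos_ring_hom
  show "(I +>\<^bsub>ring_of_type_algebra\<^esub> a) \<oplus>\<^bsub>ring_of_type_algebra Quot I\<^esub> (I +>\<^bsub>ring_of_type_algebra\<^esub> b) =
    I +>\<^bsub>ring_of_type_algebra\<^esub> (a + b)"
    using ring_hom_add[OF h, of a b] by (simp add: type_ring_simps)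
  show "(I +>\<^bsub>ring_of_type_algebra\<^esub> a) \<otimes>\<^bsub>ring_of_type_algebra Quot I\<^esub> (I +>\<^bsub>ring_of_type_algebra\<^esub> b) =
    I +>\<^bsub>ring_of_type_algebra\<^esub> (a * b)"
    using ring_hom_mult[OF h, of a b] by (simp add: type_ring_simps)
  show "\<one>\<^bsub>ring_of_type_algebra Quot I\<^esub> = I +>\<^bsub>ring_of_type_algebra\<^esub> 1"
    using ring_hom_one[OF h] by (simp add: type_ring_simps)
qed

lemma coset_eq_iff:
  assumes "type_ideal I"
  shows "I +>\<^bsub>ring_of_type_algebra\<^esub> a = I +>\<^bsub>ring_of_type_algebra\<^esub> b \<longleftrightarrow> a - b \<in> (I :: 'a::ring_1 set)"
proof
  note I = type_idealD[OF assms]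
  assume "I +>\<^bsub>ring_of_type_algebra\<^esub> a = I +>\<^bsub>ring_of_type_algebra\<^esub> b"
  moreover have "a \<in> I +>\<^bsub>ring_of_type_algebra\<^esub> a" using I(1) by (simp add: type_coset)
  ultimately show "a - b \<in> I" by (simp add: type_coset)
next
  note I = type_idealD[OF assms]
  assume ab: "a - b \<in> I"
  have "x - a \<in> I \<longleftrightarrow> x - b \<in> I" for x
    using I(2)[OF _ ab, of "x - a"] I(6)[OF _ ab, of "x - b"] by (auto simp: algebra_simps)
  then show "I +>\<^bsub>ring_of_type_algebra\<^esub> a = I +>\<^bsub>ring_of_type_algebra\<^esub> b" by (simp add: type_coset)
qed

section \<open>Representations of monoid algebras\<close>

lemma poly_mapping_sum_singles:
  "(\<Sum>w\<in>Poly_Mapping.keys a. Poly_Mapping.single w (Poly_Mapping.lookup a w)) = (a :: 'w \<Rightarrow>\<^sub>0 'b::comm_monoid_add)"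
proof (rule poly_mapping_eqI)
  fix k
  have "Poly_Mapping.lookup (\<Sum>w\<in>Poly_Mapping.keys a. Poly_Mapping.single w (Poly_Mapping.lookup a w)) k
    = (\<Sum>w\<in>Poly_Mapping.keys a. if w = k then Poly_Mapping.lookup a w else 0)"
    by (simp add: lookup_sum lookup_single when_def)
  also have "\<dots> = Poly_Mapping.lookup a k" by (simp add: in_keys_iff)
  finally show "Poly_Mapping.lookup (\<Sum>w\<in>Poly_Mapping.keys a. Poly_Mapping.single w (Poly_Mapping.lookup a w)) k
    = Poly_Mapping.lookup a k" .
qed

lemma poly_mapping_add_induct [case_names zero single add]:
  fixes a :: "'w \<Rightarrow>\<^sub>0 'b::comm_monoid_add"
  assumes "P 0" "\<And>w c. P (Poly_Mapping.single w c)" "\<And>a b. P a \<Longrightarrow> P b \<Longrightarrow> P (a + b)"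
  shows "P a"
proof -
  have "P (\<Sum>w\<in>S. Poly_Mapping.single w (Poly_Mapping.lookup a w))" if "finite S" for S
    using that by (induction S) (auto intro: assms)
  from this[of "Poly_Mapping.keys a"] show ?thesis by (simp add: poly_mapping_sum_singles)
qed

lemma scalar_central:
  fixes a :: "'w::monoid_add \<Rightarrow>\<^sub>0 'k::field"
  shows "Poly_Mapping.single 0 c * a = a * Poly_Mapping.single 0 c"
  by (induction a rule: poly_mapping_add_induct) (simp_all add: mult_single mult.commute algebra_simps)

text \<open>A representation on \<open>k\<^sup>d\<close> of the algebra of a monoid. For words this is the free algebra, for
  pairs of words its tensor square.\<close>

definition alg_rep :: "nat \<Rightarrow> (('w::monoid_add \<Rightarrow>\<^sub>0 'k::field) \<Rightarrow> 'k mat) \<Rightarrow> bool" where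
  "alg_rep d f \<longleftrightarrow> (\<forall>a. f a \<in> carrier_mat d d) \<and> (\<forall>a b. f (a + b) = f a + f b) \<and>
    (\<forall>a b. f (a * b) = f a * f b) \<and> (\<forall>c. f (Poly_Mapping.single 0 c) = c \<cdot>\<^sub>m 1\<^sub>m d)"

lemma alg_repD:
  assumes "alg_rep d f"
  shows "f a \<in> carrier_mat d d" "dim_row (f a) = d" "dim_col (f a) = d" "f (a + b) = f a + f b"
    "f (a * b) = f a * f b" "f (Poly_Mapping.single 0 c) = c \<cdot>\<^sub>m 1\<^sub>m d"
  using assms by (auto simp: alg_rep_def)

lemma alg_rep_zero_one:
  assumes "alg_rep d f" shows "f 0 = 0\<^sub>m d d" "f 1 = 1\<^sub>m d"
proof -
  have "f 0 = f (Poly_Mapping.single 0 0)" by simp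
  also have "\<dots> = 0\<^sub>m d d" unfolding alg_repD(6)[OF assms] by (auto intro!: eq_matI)
  finally show "f 0 = 0\<^sub>m d d" .
  have "f 1 = f (Poly_Mapping.single 0 1)" by simp
  also have "\<dots> = 1\<^sub>m d" unfolding alg_repD(6)[OF assms] by (auto intro!: eq_matI)
  finally show "f 1 = 1\<^sub>m d" .
qed

lemma alg_rep_single:
  assumes "alg_rep d f"
  shows "f (Poly_Mapping.single w c) = c \<cdot>\<^sub>m f (Poly_Mapping.single w 1)"
proof -
  have "Poly_Mapping.single w c = Poly_Mapping.single 0 c * Poly_Mapping.single w 1"
    by (simp add: mult_single)
  then have "f (Poly_Mapping.single w c) = (c \<cdot>\<^sub>m 1\<^sub>m d) * f (Poly_Mapping.single w 1)"
    by (simp only: alg_repD[OF assms])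
  then show ?thesis using alg_repD[OF assms] by (simp add: mat_smult_l mat_one_l)
qed

lemma alg_rep_diff:
  assumes "alg_rep d f" shows "f (a - b) = f a - f b"
proof -
  have "f a = f (a - b) + f b" by (simp flip: alg_repD(4)[OF assms])
  then show ?thesis using alg_repD(1)[OF assms, of "a - b"] alg_repD(1)[OF assms, of b]
    by (auto intro!: eq_matI)
qed

lemma alg_rep_pow:
  assumes "alg_rep d f" shows "f (a ^ k) = f a ^\<^sub>m k"
proof (induction k)
  case 0
  then show ?case using alg_repD[OF assms] by (simp add: alg_rep_zero_one[OF assms])
next
  case (Suc k)
  have "f (a ^ Suc k) = f (a ^ k * a)" by (simp add: power_commutes)
  then show ?case by (simp add: Suc alg_repD(5)[OF assms])
qed

lemma alg_rep_kernel: "alg_rep d f \<Longrightarrow> type_ideal {a. f a = 0\<^sub>m d d}"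
  by (auto simp: type_ideal_def alg_repD alg_rep_zero_one mat_zero_l mat_zero_r)

definition mat_ext :: "nat \<Rightarrow> ('w \<Rightarrow> 'k::field mat) \<Rightarrow> ('w \<Rightarrow>\<^sub>0 'k) \<Rightarrow> 'k mat" where
  "mat_ext d R a = mat d d (\<lambda>ij. \<Sum>w\<in>Poly_Mapping.keys a. Poly_Mapping.lookup a w * R w $$ ij)"

lemma mat_ext_add: "mat_ext d R (a + b) = mat_ext d R a + mat_ext d R b"
proof (rule eq_matI)
  fix i j assume "i < dim_row (mat_ext d R a + mat_ext d R b)" "j < dim_col (mat_ext d R a + mat_ext d R b)"
  then have "i < d" "j < d" by (auto simp: mat_ext_def)
  then show "mat_ext d R (a + b) $$ (i,j) = (mat_ext d R a + mat_ext d R b) $$ (i,j)"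
    using setsum_keys_plus_distrib[of "\<lambda>w x. x * R w $$ (i,j)" a b]
    by (simp add: mat_ext_def distrib_right)
qed (auto simp: mat_ext_def)

lemma mat_ext_single: "R w \<in> carrier_mat d d \<Longrightarrow> mat_ext d R (Poly_Mapping.single w c) = c \<cdot>\<^sub>m R w"
  by (rule eq_matI) (auto simp: mat_ext_def)

lemma mat_ext_carrier: "mat_ext d R a \<in> carrier_mat d d"
  by (simp add: mat_ext_def)

lemma mat_ext_zero: "mat_ext d R 0 = 0\<^sub>m d d"
  by (rule eq_matI) (auto simp: mat_ext_def)

lemma alg_rep_mat_ext:
  fixes R :: "'w::monoid_add \<Rightarrow> 'k::field mat"
  assumes R: "\<And>w. R w \<in> carrier_mat d d" "R 0 = 1\<^sub>m d" "\<And>v w. R (v + w) = R v * R w"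
  shows "alg_rep d (mat_ext d R)"
proof -
  have [simp]: "dim_row (R w) = d" "dim_col (R w) = d" "dim_row (mat_ext d R a) =
    d" "dim_col (mat_ext d R a) = d" for w a
    using R(1)[of w] mat_ext_carrier[of d R a] by auto
  have "mat_ext d R (a * b) = mat_ext d R a * mat_ext d R b" for a b
  proof (induction a rule: poly_mapping_add_induct)
    case (single w c)
    show ?case
    proof (induction b rule: poly_mapping_add_induct)
      case (single v e)
      then show ?case by (simp add: mult_single mat_ext_single[where R =
        R, OF R(1)] R(3) mat_smult_l mat_smult_r smult_smult_mat mult.commute)
    qed (simp_all add: mat_ext_zero mat_zero_r distrib_left mat_ext_add mat_distl)
  qed (simp_all add: mat_ext_zero mat_zero_l distrib_right mat_ext_add mat_distr)
  then show ?thesis by (simp add: alg_rep_def mat_ext_carrier mat_ext_add mat_ext_single R)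
qed

lemma alg_rep_eq_mat_ext:
  assumes "alg_rep d f" shows "f a = mat_ext d (\<lambda>w. f (Poly_Mapping.single w 1)) a"
proof (induction a rule: poly_mapping_add_induct)
  case (single w c)
  have "mat_ext d (\<lambda>w. f (Poly_Mapping.single w 1)) (Poly_Mapping.single w c) =
    c \<cdot>\<^sub>m f (Poly_Mapping.single w 1)"
    by (rule mat_ext_single) (rule alg_repD[OF assms])
  then show ?case using alg_rep_single[OF assms, of w c] by simp
qed (simp_all add: mat_ext_zero alg_rep_zero_one[OF assms] mat_ext_add alg_repD[OF assms])

lemma word_induct [case_names zero gen]:
  assumes "P 0" "\<And>x w. P w \<Longrightarrow> P (Word [x] + w)" shows "P w"
proof (cases w)
  case (Word xs)
  have "P (Word xs)"
  proof (induction xs)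
    case Nil then show ?case using assms(1) by (simp add: zero_word_def)
  next
    case (Cons x xs)
    from assms(2)[OF this, of x] show ?case by simp
  qed
  then show ?thesis using Word by simp
qed

text \<open>A matrix that commutes with the generators commutes with all words, hence with all linear
  combinations of words.\<close>

lemma alg_rep_intertwine:
  assumes f: "alg_rep d f" and h: "alg_rep e h" and P: "P \<in> carrier_mat e d"
    and gen: "\<And>x. P * f (free_gen x) = h (free_gen x) * P"
  shows "P * f a = h a * (P :: 'k::field mat)"
proof -
  note [simp] = alg_repD(2,3)[OF f] alg_repD(2,3)[OF h]
  have [simp]: "dim_row P = e" "dim_col P = d" using P by auto
  have w: "P * f (Poly_Mapping.single w 1) = h (Poly_Mapping.single w 1) * P" for w
  proof (induction w rule: word_induct)
    case zero
    then show ?case by (simp add: alg_rep_zero_one[OF f] alg_rep_zero_one[OF h] mat_one_l mat_one_r)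
  next
    case (gen x w)
    have s: "Poly_Mapping.single (Word [x] + w) 1 = free_gen x * Poly_Mapping.single w (1::'k)"
      by (simp add: mult_single)
    have "P * f (free_gen x * Poly_Mapping.single w 1) = (P * f (free_gen x)) * f (Poly_Mapping.single w 1)"
      by (simp add: alg_repD(5)[OF f] mat_assoc)
    also have "\<dots> = h (free_gen x) * (P * f (Poly_Mapping.single w 1))"
      by (simp add: assms(4) mat_assoc)
    also have "\<dots> = h (free_gen x * Poly_Mapping.single w 1) * P"
      by (simp add: gen alg_repD(5)[OF h] mat_assoc)
    finally show ?case unfolding s .
  qed
  show ?thesis
  proof (induction a rule: poly_mapping_add_induct)
    case (single v c)
    then show ?case unfolding alg_rep_single[OF f, of v c] alg_rep_single[OF h, of v c]
      by (simp add: mat_smult_l mat_smult_r w)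
  qed (simp_all add: alg_rep_zero_one[OF f] alg_rep_zero_one[OF h] mat_zero_l mat_zero_r alg_repD(4)[OF f]
      alg_repD(4)[OF h] mat_distl mat_distr)
qed

fun word_rep :: "nat \<Rightarrow> 'k::field mat \<Rightarrow> 'k mat \<Rightarrow> word \<Rightarrow> 'k mat" where
  "word_rep d G H (Word xs) = foldr (\<lambda>x A. (case x of GenG \<Rightarrow> G | GenH \<Rightarrow> H) * A) xs (1\<^sub>m d)"

lemma word_rep_list [simp]:
  "word_rep d G H (Word []) = 1\<^sub>m d"
  "word_rep d G H (Word (x # xs)) = (case x of GenG \<Rightarrow> G | GenH \<Rightarrow> H) * word_rep d G H (Word xs)"
  by simp_all

declare word_rep.simps [simp del]

lemma alg_rep_word_rep:
  assumes GH: "G \<in> carrier_mat d d" "H \<in> carrier_mat d d"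
  shows "alg_rep d (mat_ext d (word_rep d G H))"
    "mat_ext d (word_rep d G H) (free_gen GenG) = G" "mat_ext d (word_rep d G H) (free_gen GenH) = H"
proof -
  have c: "word_rep d G H (Word xs) \<in> carrier_mat d d" for xs
  proof (induction xs)
    case (Cons x xs)
    then show ?case using GH by (cases x) auto
  qed simp
  have [simp]: "dim_row (word_rep d G H (Word xs)) = d" "dim_col (word_rep d G H (Word xs)) = d"
    "dim_row G = d" "dim_col G = d" "dim_row H = d" "dim_col H = d" for xs
    using c[of xs] GH by auto
  have m: "word_rep d G H (Word (xs @ ys)) = word_rep d G H (Word xs) * word_rep d G H (Word ys)" for xs ys
  proof (induction xs)
    case (Cons x xs)
    then show ?case by (cases x) (simp_all add: mat_assoc)
  qed (simp add: mat_one_l)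
  have c': "word_rep d G H w \<in> carrier_mat d d" for w using c by (cases w) simp
  show "alg_rep d (mat_ext d (word_rep d G H))"
  proof (rule alg_rep_mat_ext[OF c'])
    show "word_rep d G H 0 = 1\<^sub>m d" by (simp add: zero_word_def)
    show "word_rep d G H (v + w) = word_rep d G H v * word_rep d G H w" for v w
      by (cases v; cases w) (simp add: m)
  qed
  show "mat_ext d (word_rep d G H) (free_gen GenG) = G" "mat_ext d (word_rep d G H) (free_gen GenH) = H"
    by (subst mat_ext_single[where R = "word_rep d G H", OF c'], auto simp: mat_one_r intro!: eq_matI)+
qed

text \<open>The linear extension of a monoid homomorphism into an algebra with structure map \<open>\<kappa>\<close> is an
  algebra homomorphism. It is used for the comultiplication and for the counit.\<close>

lemma linear_ext_props:
  fixes g :: "'w::monoid_add \<Rightarrow> 'b::ring_1" and \<kappa> :: "'k::field \<Rightarrow> 'b"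
  assumes \<kappa>: "\<kappa> 0 = 0" "\<kappa> 1 = 1" "\<And>x y. \<kappa> (x + y) = \<kappa> x + \<kappa> y" "\<And>x y. \<kappa> (x * y) = \<kappa> x * \<kappa> y"
      "\<And>x b. \<kappa> x * b = b * \<kappa> x"
    and g: "g 0 = 1" "\<And>v w. g (v + w) = g v * g w"
  defines "E \<equiv> \<lambda>a. \<Sum>w\<in>Poly_Mapping.keys a. \<kappa> (Poly_Mapping.lookup a w) * g w"
  shows "E (a + b) = E a + E b" "E (a * b) = E a * E b" "E (Poly_Mapping.single w c) = \<kappa> c * g w"
proof -
  show add: "E (a + b) = E a + E b" for a b
    unfolding E_def
    using setsum_keys_plus_distrib[of "\<lambda>w x. \<kappa> x * g w" a b] by (simp add: \<kappa> distrib_right)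
  show single: "E (Poly_Mapping.single w c) = \<kappa> c * g w" for w c
    by (cases "c = 0") (simp_all add: E_def \<kappa>)
  have E0: "E 0 = 0" by (simp add: E_def)
  show "E (a * b) = E a * E b"
  proof (induction a rule: poly_mapping_add_induct)
    case (single w c)
    show ?case
    proof (induction b rule: poly_mapping_add_induct)
      case (single v e)
      have "\<kappa> c * \<kappa> e * (g w * g v) = \<kappa> c * (\<kappa> e * g w) * g v" by (simp add: mult.assoc)
      also have "\<kappa> e * g w = g w * \<kappa> e" by (rule \<kappa>)
      finally show ?case by (simp add: mult_single \<open>\<And>w c. E (Poly_Mapping.single w c) =
        \<kappa> c * g w\<close> \<kappa>(4) g mult.assoc)
    qed (simp_all add: E0 distrib_left add)
  qed (simp_all add: E0 distrib_right add)
qed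

lemma comult_word_add: "comult_word (v + w) = (comult_word v * comult_word w :: 'k::field free_alg2)"
  by (cases v; cases w) simp

lemma free_comult_hom:
  fixes a b :: "'k::field free_alg"
  shows "free_comult (a + b) = free_comult a + free_comult b" "free_comult (a * b) =
    free_comult a * free_comult b"
    "free_comult (Poly_Mapping.single w c) = Poly_Mapping.single 0 c * comult_word w"
  using linear_ext_props[of "Poly_Mapping.single 0 :: 'k \<Rightarrow> 'k free_alg2" comult_word]
  by (auto simp: free_comult_def single_add mult_single scalar_central comult_word_add zero_word_def)

lemma counit_word_add: "counit_word (v + w) = counit_word v * counit_word w"
  by (cases v; cases w) simp

lemma free_counit_hom:
  fixes a b :: "'k::field free_alg"
  shows "free_counit (a + b) = free_counit a + free_counit b" "free_counit (a * b) =
    free_counit a * free_counit b"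
    "free_counit (Poly_Mapping.single w c) = c * counit_word w"
  using linear_ext_props[of "\<lambda>x. x" counit_word]
  by (auto simp: free_counit_def mult.commute counit_word_add zero_word_def)

context taft_root begin

section \<open>Modules over the Taft algebra as pairs of matrices\<close>

abbreviation "cls \<equiv> taft_class n q"
abbreviation "TA \<equiv> taft_algebra n q"
abbreviation "TI \<equiv> taft_scalar n q"
abbreviation "mods \<equiv> fd_modules (taft_algebra n q) (taft_scalar n q)"
abbreviation "tens \<equiv> taft_module_tensor n q"

lemma taft_ideal_ideal: "type_ideal (taft_ideal n q)"
  unfolding taft_ideal_def by (rule type_ideal_Idl)

lemma taft_tensor_ideal_ideal: "type_ideal (taft_tensor_ideal n q)"
  unfolding taft_tensor_ideal_def by (rule type_ideal_Idl)

lemma cls_eq_iff: "cls a = cls b \<longleftrightarrow> a - b \<in> taft_ideal n q"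
  unfolding taft_class_def by (rule coset_eq_iff[OF taft_ideal_ideal])

lemma TA_simps: "carrier TA = range cls" "cls a \<oplus>\<^bsub>TA\<^esub> cls b = cls (a + b)"
  "cls a \<otimes>\<^bsub>TA\<^esub> cls b = cls (a * b)" "\<one>\<^bsub>TA\<^esub> = cls 1"
  unfolding taft_algebra_def taft_class_def using quotient_simps[OF taft_ideal_ideal] by auto

text \<open>Every class has a representative in the free algebra, so the laws of a module over the
  quotient can be checked on representatives. This is what reduces modules to pairs of matrices.\<close>

lemma mods_iff_alg_rep: "(d,\<rho>) \<in> mods \<longleftrightarrow> alg_rep d (\<lambda>a. \<rho> (cls a))"
proof
  assume "(d,\<rho>) \<in> mods"
  then have h: "\<rho> \<in> Ring.ring_hom TA (ring_mat TYPE('k) d ())" and s: "\<And>c. \<rho> (TI c) = c \<cdot>\<^sub>m 1\<^sub>m d"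
    by (auto simp: fd_modules_def)
  have c: "cls a \<in> carrier TA" for a by (simp add: TA_simps)
  show "alg_rep d (\<lambda>a. \<rho> (cls a))" unfolding alg_rep_def
  proof (intro conjI allI)
    fix a b x
    show "\<rho> (cls a) \<in> carrier_mat d d" using ring_hom_closed[OF h c[of a]] by (simp add: ring_mat_simps)
    show "\<rho> (cls (a + b)) = \<rho> (cls a) + \<rho> (cls b)"
      using ring_hom_add[OF h c[of a] c[of b]] by (simp add: ring_mat_simps TA_simps)
    show "\<rho> (cls (a * b)) = \<rho> (cls a) * \<rho> (cls b)"
      using ring_hom_mult[OF h c[of a] c[of b]] by (simp add: ring_mat_simps TA_simps)
    show "\<rho> (cls (Poly_Mapping.single 0 x)) = x \<cdot>\<^sub>m 1\<^sub>m d" using s[of x] by (simp add: taft_scalar_def)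
  qed
next
  assume f: "alg_rep d (\<lambda>a. \<rho> (cls a))"
  have "\<rho> \<in> Ring.ring_hom TA (ring_mat TYPE('k) d ())"
  proof (rule Ring.ring_hom_memI; unfold ring_mat_simps)
    show "\<rho> x \<in> carrier_mat d d" if "x \<in> carrier TA" for x
      using that alg_repD(1)[OF f] by (auto simp: TA_simps)
    show "\<rho> (x \<oplus>\<^bsub>TA\<^esub> y) = \<rho> x + \<rho> y" if "x \<in> carrier TA" "y \<in> carrier TA" for x y
      using that alg_repD(4)[OF f] by (auto simp: TA_simps)
    show "\<rho> (x \<otimes>\<^bsub>TA\<^esub> y) = \<rho> x * \<rho> y" if "x \<in> carrier TA" "y \<in> carrier TA" for x y
      using that alg_repD(5)[OF f] by (auto simp: TA_simps)
    show "\<rho> \<one>\<^bsub>TA\<^esub> = 1\<^sub>m d" using alg_rep_zero_one(2)[OF f] by (simp add: TA_simps)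
  qed
  then show "(d,\<rho>) \<in> mods"
    using alg_repD(6)[OF f] by (simp add: fd_modules_def taft_scalar_def)
qed

definition pair_of :: "('k free_alg set, 'k) fd_module \<Rightarrow> 'k mat_pair" where
  "pair_of M = (fst M, snd M (cls (free_gen GenG)), snd M (cls (free_gen GenH)))"

lemma fst_pair_of[simp]: "fst (pair_of M) = fst M" by (simp add: pair_of_def)

text \<open>The kernel of a representation is an ideal, so it contains the ideal of relations if and only
  if it contains the three generators.\<close>

lemma alg_rep_taft_pairs_kernel:
  assumes f: "alg_rep d f"
  shows "(d, f (free_gen GenG), f (free_gen GenH)) \<in> taft_pairs \<longleftrightarrow> (\<forall>a\<in>taft_ideal n q. f a = 0\<^sub>m d d)"
proof -
  let ?G = "f (free_gen GenG)" and ?H = "f (free_gen GenH)"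
  note [simp] = alg_repD(2,3)[OF f]
  have 1: "f (free_gen GenG ^ n - 1) = ?G ^\<^sub>m n - 1\<^sub>m d"
    by (simp add: alg_rep_diff[OF f] alg_rep_pow[OF f] alg_rep_zero_one[OF f])
  have 2: "f (free_gen GenH ^ n) = ?H ^\<^sub>m n" by (rule alg_rep_pow[OF f])
  have 3: "f (free_gen GenH * free_gen GenG - Poly_Mapping.single 0 q * free_gen GenG * free_gen GenH)
      = ?H * ?G - q \<cdot>\<^sub>m (?G * ?H)"
    by (simp add: alg_rep_diff[OF f] alg_repD(5,6)[OF f] mat_smult_l mat_one_l)
  have diff0: "A - B = 0\<^sub>m d d \<longleftrightarrow> A = B" if "A \<in> carrier_mat d d" "B \<in> carrier_mat d d" for A B :: "'k mat"
  proof
    assume "A - B = 0\<^sub>m d d"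
    then have "(A - B) $$ (i,j) = 0" if "i < d" "j < d" for i j using that by simp
    then show "A = B" using that by (intro eq_matI) auto
  qed (use that in \<open>auto intro!: eq_matI\<close>)
  have d1: "?G ^\<^sub>m n - 1\<^sub>m d = 0\<^sub>m d d \<longleftrightarrow> ?G ^\<^sub>m n = 1\<^sub>m d"
    by (rule diff0) (use alg_repD(1)[OF f] in auto)
  have d3: "?H * ?G - q \<cdot>\<^sub>m (?G * ?H) = 0\<^sub>m d d \<longleftrightarrow> ?H * ?G = q \<cdot>\<^sub>m (?G * ?H)"
    by (rule diff0) (auto intro!: carrier_matI)
  have "(d, ?G, ?H) \<in> taft_pairs \<longleftrightarrow> taft_relators n q \<subseteq> {a. f a = 0\<^sub>m d d}"
    unfolding taft_relators_def taft_pairs_def using alg_repD(1)[OF f]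
    by (simp add: 1 2 3 d1 d3)
  also have "\<dots> \<longleftrightarrow> taft_ideal n q \<subseteq> {a. f a = 0\<^sub>m d d}"
    unfolding taft_ideal_def using Idl_least[OF alg_rep_kernel[OF f]] Idl_superset by blast
  finally show ?thesis by auto
qed

lemma pair_of_taft_pair:
  assumes "M \<in> mods" shows "pair_of M \<in> taft_pairs"
proof -
  obtain d \<rho> where M: "M = (d,\<rho>)" by (cases M)
  have f: "alg_rep d (\<lambda>a. \<rho> (cls a))" using assms by (simp add: M mods_iff_alg_rep)
  have "\<rho> (cls a) = 0\<^sub>m d d" if "a \<in> taft_ideal n q" for a
  proof -
    have "cls a = cls 0" using that by (simp add: cls_eq_iff)
    then show ?thesis using alg_rep_zero_one(1)[OF f] by simp
  qed
  then show ?thesis using alg_rep_taft_pairs_kernel[OF f] by (simp add: pair_of_def M)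
qed

lemma module_of_alg_rep:
  assumes f: "alg_rep d f" and t: "(d, f (free_gen GenG), f (free_gen GenH)) \<in> taft_pairs"
    and \<rho>: "\<And>a. \<rho> (cls a) = f a"
  shows "(d,\<rho>) \<in> mods" "pair_of (d,\<rho>) = (d, f (free_gen GenG), f (free_gen GenH))"
  using f by (simp_all add: mods_iff_alg_rep \<rho> pair_of_def)

lemma alg_rep_coset:
  assumes f: "alg_rep d f" and t: "(d, f (free_gen GenG), f (free_gen GenH)) \<in> taft_pairs"
    and "b \<in> cls a"
  shows "f b = f a"
proof -
  have "b - a \<in> taft_ideal n q" using assms(3) by (simp add: taft_class_def type_coset)
  then have 0: "f (b - a) = 0\<^sub>m d d" using alg_rep_taft_pairs_kernel[OF f] t by blast
  have "f b = f (b - a) + f a" by (simp flip: alg_repD(4)[OF f])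
  then show ?thesis using 0 alg_repD(1)[OF f, of a] by simp
qed

lemma cls_self: "a \<in> cls a"
  using type_idealD(1)[OF taft_ideal_ideal] by (simp add: taft_class_def type_coset)

lemma pair_of_surj:
  assumes "P \<in> taft_pairs" obtains M where "M \<in> mods" "pair_of M = P"
proof -
  obtain d G H where P: "P = (d,G,H)" by (metis prod.collapse)
  define f where "f = mat_ext d (word_rep d G H)"
  note w = alg_rep_word_rep[OF taft_pairsD(1,2)[OF assms[unfolded P]], folded f_def]
  have t: "(d, f (free_gen GenG), f (free_gen GenH)) \<in> taft_pairs" using assms by (simp add: w P)
  define \<rho> where "\<rho> x = the_elem (f ` x)" for x
  have "\<rho> (cls a) = f a" for a
  proof -
    have "f b = f a" if "b \<in> cls a" for b by (rule alg_rep_coset[OF w(1) t that])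
    then have "f ` cls a = {f a}" using cls_self[of a] by blast
    then show ?thesis by (simp add: \<rho>_def)
  qed
  from module_of_alg_rep[OF w(1) t this] that show ?thesis by (simp add: w P)
qed

text \<open>By \<open>alg_rep_intertwine\<close> it is enough that an isomorphism commutes with \<open>g\<close> and \<open>h\<close>; its inverse then
  also commutes with them.\<close>

lemma iso_iff_pair_iso:
  "(M,N) \<in> fd_module_iso TA TI \<longleftrightarrow> M \<in> mods \<and> N \<in> mods \<and> pair_iso (pair_of M) (pair_of N)"
proof -
  obtain d \<rho> e \<sigma> where MN: "M = (d,\<rho>)" "N = (e,\<sigma>)" by (metis prod.collapse)
  have "(\<forall>x\<in>carrier TA. P * \<rho> x = \<sigma> x * P) \<longleftrightarrow>
      P * \<rho> (cls (free_gen GenG)) = \<sigma> (cls (free_gen GenG)) * P \<and>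
      P * \<rho> (cls (free_gen GenH)) = \<sigma> (cls (free_gen GenH)) * P"
    if "P \<in> carrier_mat e d" "M \<in> mods" "N \<in> mods" for P
  proof
    assume h: "P * \<rho> (cls (free_gen GenG)) = \<sigma> (cls (free_gen GenG)) * P \<and>
      P * \<rho> (cls (free_gen GenH)) = \<sigma> (cls (free_gen GenH)) * P"
    have f: "alg_rep d (\<lambda>a. \<rho> (cls a))" "alg_rep e (\<lambda>a. \<sigma> (cls a))"
      using that by (simp_all add: MN mods_iff_alg_rep)
    have "P * \<rho> (cls (free_gen x)) = \<sigma> (cls (free_gen x)) * P" for x using h by (cases x) auto
    from alg_rep_intertwine[OF f that(1) this]
    show "\<forall>x\<in>carrier TA. P * \<rho> x = \<sigma> x * P" by (auto simp: TA_simps)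
  qed (auto simp: TA_simps)
  note int = this
  have sym: "B * \<sigma> x = \<rho> x * B"
    if "A \<in> carrier_mat e d" "B \<in> carrier_mat d e" "A * B = 1\<^sub>m e" "B * A = 1\<^sub>m d" "A * \<rho> x = \<sigma> x * A"
      "\<rho> x \<in> carrier_mat d d" "\<sigma> x \<in> carrier_mat e e" for A B x
  proof -
    have d: "dim_row A = e" "dim_col A = d" "dim_row B = d" "dim_col B = e"
      "dim_row (\<rho> x) = d" "dim_col (\<rho> x) = d" "dim_row (\<sigma> x) = e" "dim_col (\<sigma> x) = e"
      using that by auto
    have "B * \<sigma> x = B * (\<sigma> x * (A * B))" by (simp add: that(3) mat_one_r d)
    also have "\<dots> = B * (\<sigma> x * A) * B" by (simp add: mat_assoc d)
    also have "\<dots> = (B * A) * (\<rho> x * B)" unfolding that(5)[symmetric] by (simp add: mat_assoc d)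
    also have "\<dots> = \<rho> x * B" by (simp add: that(4) mat_one_l d)
    finally show ?thesis .
  qed
  show ?thesis
  proof
    assume "(M,N) \<in> fd_module_iso TA TI"
    then obtain P Q where M: "M \<in> mods" "N \<in> mods"
      and PQ: "P \<in> carrier_mat e d" "Q \<in> carrier_mat d e" "P * Q = 1\<^sub>m e" "Q * P = 1\<^sub>m d"
        "\<forall>x\<in>carrier TA. P * \<rho> x = \<sigma> x * P"
      unfolding MN fd_module_iso_def by auto
    have g: "P * \<rho> (cls a) = \<sigma> (cls a) * P" for a using PQ(5) by (simp add: TA_simps)
    have f: "alg_rep d (\<lambda>a. \<rho> (cls a))" "alg_rep e (\<lambda>a. \<sigma> (cls a))"
      using M by (simp_all add: MN mods_iff_alg_rep)
    have "Q * \<sigma> (cls a) = \<rho> (cls a) * Q" for a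
      by (rule sym[OF PQ(1-4) g]) (use alg_repD(1)[OF f(1)] alg_repD(1)[OF f(2)] in auto)
    then have "pair_hom (pair_of N) (pair_of M) Q" using PQ(2) by (simp add: pair_of_def MN)
    moreover have "pair_hom (pair_of M) (pair_of N) P" using g PQ(1) by (simp add: pair_of_def MN)
    ultimately have "pair_iso (pair_of M) (pair_of N)"
      unfolding pair_iso_def using PQ(3,4) by (intro exI[of _ P] exI[of _ Q]) (simp add: MN)
    with M show "M \<in> mods \<and> N \<in> mods \<and> pair_iso (pair_of M) (pair_of N)" by blast
  next
    assume h: "M \<in> mods \<and> N \<in> mods \<and> pair_iso (pair_of M) (pair_of N)"
    then obtain A B where "pair_hom (pair_of M) (pair_of N) A" "pair_hom (pair_of N) (pair_of M) B"
      "A * B = 1\<^sub>m e" "B * A = 1\<^sub>m d" unfolding pair_iso_def by (auto simp: MN)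
    then show "(M,N) \<in> fd_module_iso TA TI"
      using h int[of A] unfolding fd_module_iso_def MN pair_of_def by auto
  qed
qed

lemma alg_rep_dsum:
  assumes f: "alg_rep d f" and h: "alg_rep e h"
  shows "alg_rep (d + e) (\<lambda>a. four_block_mat (f a) (0\<^sub>m d e) (0\<^sub>m e d) (h a))"
proof -
  note cf = alg_repD(1)[OF f] and ch = alg_repD(1)[OF h]
  show ?thesis unfolding alg_rep_def
  proof (intro conjI allI)
    fix a b c
    show "four_block_mat (f a) (0\<^sub>m d e) (0\<^sub>m e d) (h a) \<in> carrier_mat (d + e) (d + e)"
      by (rule four_block_carrier_mat[OF cf ch])
    show "four_block_mat (f (a + b)) (0\<^sub>m d e) (0\<^sub>m e d) (h (a + b)) =
        four_block_mat (f a) (0\<^sub>m d e) (0\<^sub>m e d) (h a) + four_block_mat (f b) (0\<^sub>m d e) (0\<^sub>m e d) (h b)"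
      by (subst add_four_block_mat[OF cf _ _ ch cf _ _ ch]) (auto simp: alg_repD[OF f] alg_repD[OF h])
    show "four_block_mat (f (a * b)) (0\<^sub>m d e) (0\<^sub>m e d) (h (a * b)) =
        four_block_mat (f a) (0\<^sub>m d e) (0\<^sub>m e d) (h a) * four_block_mat (f b) (0\<^sub>m d e) (0\<^sub>m e d) (h b)"
      by (subst mult_four_block_mat[OF cf _ _ ch cf _ _ ch])
        (auto simp: alg_repD(2,3,5)[OF f] alg_repD(2,3,5)[OF h] mat_zero_l mat_zero_r mat_add_zero)
    show "four_block_mat (f (Poly_Mapping.single 0 c)) (0\<^sub>m d e) (0\<^sub>m e d) (h (Poly_Mapping.single 0 c)) =
        c \<cdot>\<^sub>m 1\<^sub>m (d + e)"
      by (rule eq_matI) (auto simp: alg_repD(6)[OF f] alg_repD(6)[OF h])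
  qed
qed

lemma dsum_mods:
  assumes "M \<in> mods" "N \<in> mods"
  shows "fd_module_dsum M N \<in> mods" "pair_of (fd_module_dsum M N) = pair_dsum (pair_of M) (pair_of N)"
proof -
  obtain d \<rho> e \<sigma> where MN: "M = (d,\<rho>)" "N = (e,\<sigma>)" by (metis prod.collapse)
  have f: "alg_rep d (\<lambda>a. \<rho> (cls a))" "alg_rep e (\<lambda>a. \<sigma> (cls a))"
    using assms by (simp_all add: MN mods_iff_alg_rep)
  show "fd_module_dsum M N \<in> mods" using alg_rep_dsum[OF f] by (simp add: MN mods_iff_alg_rep)
  show "pair_of (fd_module_dsum M N) = pair_dsum (pair_of M) (pair_of N)" by (simp add: MN pair_of_def)
qed

text \<open>The counit kills the relations, so its value on a class is its value on any representative.\<close>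

lemma trivial_mods:
  shows "taft_trivial_module \<in> (mods :: ('k free_alg set, 'k) fd_module set)"
    "pair_of (taft_trivial_module :: ('k free_alg set, 'k) fd_module) = chain 1 0"
proof -
  define f :: "'k free_alg \<Rightarrow> 'k mat" where "f a = free_counit a \<cdot>\<^sub>m 1\<^sub>m 1" for a
  have f: "alg_rep 1 f" unfolding alg_rep_def f_def
    by (auto intro!: eq_matI simp: free_counit_hom zero_word_def mult_entry simp del: index_mult_mat(1))
  have GH: "f (free_gen GenG) = chainG 1 0" "f (free_gen GenH) = chainH 1"
    by (auto intro!: eq_matI simp: f_def free_counit_hom chainG_def chainH_def)
  have t: "(1, f (free_gen GenG), f (free_gen GenH)) \<in> taft_pairs"
    using chain_taft_pair[of 1 0] n2 unfolding GH chain_def by simp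
  have "taft_counit (cls a) = free_counit a" for a
  proof -
    have "free_counit b = free_counit a" if "b \<in> cls a" for b
    proof -
      have "f b $$ (0,0) = f a $$ (0,0)" using alg_rep_coset[OF f t that] by simp
      then show ?thesis by (simp add: f_def)
    qed
    then have "free_counit ` cls a = {free_counit a}" using cls_self[of a] by blast
    then show ?thesis by (simp add: taft_counit_def)
  qed
  then have "taft_counit (cls a) \<cdot>\<^sub>m 1\<^sub>m 1 = f a" for a by (simp add: f_def)
  note m = module_of_alg_rep[OF f t, of "\<lambda>x. taft_counit x \<cdot>\<^sub>m 1\<^sub>m 1", OF this]
  show "taft_trivial_module \<in> (mods :: ('k free_alg set, 'k) fd_module set)"
    "pair_of (taft_trivial_module :: ('k free_alg set, 'k) fd_module) = chain 1 0"
    using m by (simp_all add: taft_trivial_module_def GH chain_def)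
qed

lemma alg_rep_leg_entry:
  fixes F :: "'k free_alg2 \<Rightarrow> 'k mat"
  assumes F: "alg_rep D F"
  shows "i < D \<Longrightarrow> j < D \<Longrightarrow> F (left_leg a) $$ (i,j) =
      (\<Sum>u\<in>Poly_Mapping.keys a. Poly_Mapping.lookup a u * F (Poly_Mapping.single (u,0) 1) $$ (i,j))"
    "i < D \<Longrightarrow> j < D \<Longrightarrow> F (right_leg a) $$ (i,j) =
      (\<Sum>u\<in>Poly_Mapping.keys a. Poly_Mapping.lookup a u * F (Poly_Mapping.single (0,u) 1) $$ (i,j))"
proof -
  note [simp] = alg_repD(2,3)[OF F]
  have s: "F (sum g S) $$ (i,j) = (\<Sum>u\<in>S. F (g u) $$ (i,j))" if "i < D" "j < D"
    for g :: "word \<Rightarrow> 'k free_alg2" and S i j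
    by (induction S rule: infinite_finite_induct) (use that in \<open>simp_all add: alg_rep_zero_one(1)[OF F]
      alg_repD(4)[OF F]\<close>)
  have c: "F (Poly_Mapping.single uv x) $$ (i,j) = x * F (Poly_Mapping.single uv 1) $$ (i,j)"
    if "i < D" "j < D" for uv x i j
    using that by (subst alg_rep_single[OF F]) simp
  show "i < D \<Longrightarrow> j < D \<Longrightarrow> F (left_leg a) $$ (i,j) =
      (\<Sum>u\<in>Poly_Mapping.keys a. Poly_Mapping.lookup a u * F (Poly_Mapping.single (u,0) 1) $$ (i,j))"
    "i < D \<Longrightarrow> j < D \<Longrightarrow> F (right_leg a) $$ (i,j) =
      (\<Sum>u\<in>Poly_Mapping.keys a. Poly_Mapping.lookup a u * F (Poly_Mapping.single (0,u) 1) $$ (i,j))"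
    unfolding left_leg_def right_leg_def by (simp_all only: s, (intro sum.cong refl c; assumption)+)
qed

text \<open>Let \<open>F\<close> be the action of the tensor square of the free algebra on the outer tensor product; it
  is a representation. Its restrictions to the two legs are \<open>f a \<otimes> 1\<close> and \<open>1 \<otimes> h a\<close>, so it kills the
  tensor ideal. Composed with the comultiplication of the free algebra it gives a representation
  \<open>\<tau>\<close> of the free algebra with generators acting as in \<open>pair_tensor\<close>. By \<open>pair_tensor_taft_pair\<close> the
  relations hold, so \<open>\<tau>\<close> is constant on the classes of the Taft algebra and describes the action
  on the tensor product.\<close>

lemma tensor_mods:
  assumes "M \<in> mods" "N \<in> mods"
  shows "tens M N \<in> mods" "pair_of (tens M N) = pair_tensor (pair_of M) (pair_of N)"
proof -
  obtain d \<rho> e \<sigma> where MN: "M = (d,\<rho>)" "N = (e,\<sigma>)" by (metis prod.collapse)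
  define f where "f a = \<rho> (cls a)" for a
  define h where "h a = \<sigma> (cls a)" for a
  have f: "alg_rep d f" and h: "alg_rep e h"
    using assms by (simp_all add: MN mods_iff_alg_rep f_def[abs_def] h_def[abs_def])
  have tf: "(d, f (free_gen GenG), f (free_gen GenH)) \<in> taft_pairs" and th: "(e, h (free_gen GenG), h
    (free_gen GenH)) \<in> taft_pairs"
    using pair_of_taft_pair[OF assms(1)] pair_of_taft_pair[OF assms(2)]
      by (simp_all add: pair_of_def MN f_def h_def)
  note [simp] = alg_repD(2,3)[OF f] alg_repD(2,3)[OF h]
  define R where "R = (\<lambda>uv. kronecker (f (Poly_Mapping.single (fst uv) 1)) (h (Poly_Mapping.single (snd
    uv) 1)))"
  define F where "F = free_tensor_act n q M N"
  have F_ext: "F = mat_ext (d * e) R"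
    by (rule ext) (simp add: F_def MN mat_ext_def R_def f_def h_def case_prod_unfold)
  have Rc: "R w \<in> carrier_mat (d * e) (d * e)" for w
    unfolding R_def by (rule kronecker_carrier) (rule alg_repD(1)[OF f] alg_repD(1)[OF h])+
  note one = alg_rep_zero_one(2)[OF f] alg_rep_zero_one(2)[OF h]
  have F: "alg_rep (d * e) F" unfolding F_ext
  proof (rule alg_rep_mat_ext[OF Rc])
    show "R 0 = 1\<^sub>m (d * e)" by (simp add: R_def one kronecker_one)
    show "R (v + w) = R v * R w" for v w
    proof -
      have s: "Poly_Mapping.single (a + b) (1::'k) = Poly_Mapping.single a 1 * Poly_Mapping.single b 1"
        for a b :: word
        by (simp add: mult_single)
      show ?thesis by (simp add: R_def s alg_repD(5)[OF f] alg_repD(5)[OF h] kronecker_mult)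
    qed
  qed
  note [simp] = alg_repD(2,3)[OF F]
  have F1: "F (Poly_Mapping.single w 1) = R w" for w
    unfolding F_ext by (subst mat_ext_single[where R = R, OF Rc]) (use Rc[of w] in \<open>auto intro!: eq_matI\<close>)
  have left: "F (left_leg a) = kronecker (f a) (1\<^sub>m e)" for a
  proof (rule eq_matI)
    fix i j assume "i < dim_row (kronecker (f a) (1\<^sub>m e))" "j < dim_col (kronecker (f a) (1\<^sub>m e))"
    then have ij: "i < d * e" "j < d * e" by auto
    note b = pair_index_bounds[OF ij(1)] pair_index_bounds[OF ij(2)]
    have "F (left_leg a) $$ (i,j) = (\<Sum>u\<in>Poly_Mapping.keys a. Poly_Mapping.lookup a u * R (u,0) $$ (i,j))"
      by (simp add: alg_rep_leg_entry(1)[OF F ij] F1)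
    also have "\<dots> = (\<Sum>u\<in>Poly_Mapping.keys a. Poly_Mapping.lookup a u * f (Poly_Mapping.single u 1) $$ (i
      div e, j div e))
        * 1\<^sub>m e $$ (i mod e, j mod e)"
      using ij by (simp add: R_def kronecker_entry one sum_distrib_right mult.assoc)
    also have "(\<Sum>u\<in>Poly_Mapping.keys a. Poly_Mapping.lookup a u * f (Poly_Mapping.single u 1) $$ (i div
      e, j div e))
        = f a $$ (i div e, j div e)"
      by (subst alg_rep_eq_mat_ext[OF f, of a]) (use b in \<open>simp add: mat_ext_def\<close>)
    also have "\<dots> * 1\<^sub>m e $$ (i mod e, j mod e) = kronecker (f a) (1\<^sub>m e) $$ (i,j)"
      using ij by (simp add: kronecker_entry)
    finally show "F (left_leg a) $$ (i,j) = kronecker (f a) (1\<^sub>m e) $$ (i,j)" .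
  qed simp_all
  have right: "F (right_leg a) = kronecker (1\<^sub>m d) (h a)" for a
  proof (rule eq_matI)
    fix i j assume "i < dim_row (kronecker (1\<^sub>m d) (h a))" "j < dim_col (kronecker (1\<^sub>m d) (h a))"
    then have ij: "i < d * e" "j < d * e" by auto
    note b = pair_index_bounds[OF ij(1)] pair_index_bounds[OF ij(2)]
    have "F (right_leg a) $$ (i,j) = (\<Sum>u\<in>Poly_Mapping.keys a. Poly_Mapping.lookup a u * R (0,u) $$ (i,j))"
      by (simp add: alg_rep_leg_entry(2)[OF F ij] F1)
    also have "\<dots> = 1\<^sub>m d $$ (i div e, j div e) *
        (\<Sum>u\<in>Poly_Mapping.keys a. Poly_Mapping.lookup a u * h (Poly_Mapping.single u 1) $$ (i mod e, j mod e))"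
      using ij by (simp add: R_def kronecker_entry one sum_distrib_left mult.left_commute)
    also have "(\<Sum>u\<in>Poly_Mapping.keys a. Poly_Mapping.lookup a u * h (Poly_Mapping.single u 1) $$ (i mod
      e, j mod e))
        = h a $$ (i mod e, j mod e)"
      by (subst alg_rep_eq_mat_ext[OF h, of a]) (use b in \<open>simp add: mat_ext_def\<close>)
    also have "1\<^sub>m d $$ (i div e, j div e) * \<dots> = kronecker (1\<^sub>m d) (h a) $$ (i,j)"
      using ij by (simp add: kronecker_entry)
    finally show "F (right_leg a) $$ (i,j) = kronecker (1\<^sub>m d) (h a) $$ (i,j)" .
  qed simp_all
  have "left_leg ` taft_ideal n q \<union> right_leg ` taft_ideal n q \<subseteq> {t. F t = 0\<^sub>m (d * e) (d * e)}"
    using alg_rep_taft_pairs_kernel[OF f] alg_rep_taft_pairs_kernel[OF h] tf th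
    by (auto simp: left right kronecker_zero)
  from Idl_least[OF alg_rep_kernel[OF F] this]
  have ker: "F t = 0\<^sub>m (d * e) (d * e)" if "t \<in> taft_tensor_ideal n q" for t
    using that unfolding taft_tensor_ideal_def by blast
  define \<tau> where "\<tau> a = F (free_comult a)" for a
  have \<tau>: "alg_rep (d * e) \<tau>" unfolding alg_rep_def \<tau>_def
    using alg_repD(1)[OF F] by (simp add: free_comult_hom alg_repD(4-6)[OF F] zero_word_def)
  have gens: "\<tau> (free_gen GenG) = kronecker (f (free_gen GenG)) (h (free_gen GenG))"
    "\<tau> (free_gen GenH) = kronecker (1\<^sub>m d) (h (free_gen GenH)) + kronecker (f (free_gen GenH)) (h
      (free_gen GenG))"
    by (simp_all add: \<tau>_def free_comult_hom mult_single F1 R_def one alg_repD(4)[OF F])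
  have tt: "(d * e, \<tau> (free_gen GenG), \<tau> (free_gen GenH)) = pair_tensor (pair_of M) (pair_of N)"
    by (simp add: gens pair_of_def MN f_def h_def)
  then have t: "(d * e, \<tau> (free_gen GenG), \<tau> (free_gen GenH)) \<in> taft_pairs"
    using pair_tensor_taft_pair[OF pair_of_taft_pair[OF assms(1)] pair_of_taft_pair[OF assms(2)]] by simp
  have act: "taft_tensor_act n q M N (taft_comult n q (cls a)) = \<tau> a" for a
  proof -
    have "F x = \<tau> a" if "b \<in> cls a" "x \<in> taft_tensor_ideal n q +>\<^bsub>ring_of_type_algebra\<^esub> free_comult b" for b x
    proof -
      have "F x = F (x - free_comult b) + F (free_comult b)" by (simp flip: alg_repD(4)[OF F])
      also have "F (x - free_comult b) = 0\<^sub>m (d * e) (d * e)" using that(2) by (intro ker) (simp add: type_coset)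
      also have "\<dots> + F (free_comult b) = \<tau> b" using alg_repD(1)[OF F] by (simp add: \<tau>_def)
      also have "\<dots> = \<tau> a" by (rule alg_rep_coset[OF \<tau> t that(1)])
      finally show ?thesis .
    qed
    then have all: "F x = \<tau> a" if "x \<in> taft_comult n q (cls a)" for x
      using that unfolding taft_comult_def by blast
    have "free_comult a \<in> taft_tensor_ideal n q +>\<^bsub>ring_of_type_algebra\<^esub> free_comult a"
      using type_idealD(1)[OF taft_tensor_ideal_ideal] by (simp add: type_coset)
    then have mem: "free_comult a \<in> taft_comult n q (cls a)"
      unfolding taft_comult_def using cls_self[of a] by blast
    have "F ` taft_comult n q (cls a) = {\<tau> a}"
    proof
      show "F ` taft_comult n q (cls a) \<subseteq> {\<tau> a}" using all by blast
      show "{\<tau> a} \<subseteq> F ` taft_comult n q (cls a)" using imageI[OF mem, of F] all[OF mem] by simp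
    qed
    then show ?thesis by (simp add: taft_tensor_act_def F_def)
  qed
  have e: "tens M N = (d * e, \<lambda>x. taft_tensor_act n q M N (taft_comult n q x))"
    by (simp add: taft_module_tensor_def MN)
  show "tens M N \<in> mods" "pair_of (tens M N) = pair_tensor (pair_of M) (pair_of N)"
    unfolding e using module_of_alg_rep[OF \<tau> t, OF act] tt by simp_all
qed

end

section \<open>The Green ring\<close>

lemma iso_class_ring_coset: "K +>\<^bsub>iso_class_ring A \<iota> T E\<^esub> a = {k + a | k. k \<in> K}"
  unfolding a_r_coset_def r_coset_def by (auto simp: iso_class_ring_def)

context taft_root begin

lemma pair_iso_trans:
  assumes "pair_iso M N" "pair_iso N L" "M \<in> taft_pairs" "N \<in> taft_pairs" "L \<in> taft_pairs" shows "pair_iso M L"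
proof -
  obtain A B where AB: "pair_hom M N A" "pair_hom N M B" "A * B = 1\<^sub>m (fst N)" "B * A = 1\<^sub>m (fst M)"
    using assms(1) unfolding pair_iso_def by blast
  obtain C D where CD: "pair_hom N L C" "pair_hom L N D" "C * D = 1\<^sub>m (fst L)" "D * C = 1\<^sub>m (fst N)"
    using assms(2) unfolding pair_iso_def by blast
  note [simp] = pair_hom_dim[OF AB(1)] pair_hom_dim[OF AB(2)] pair_hom_dim[OF CD(1)] pair_hom_dim[OF CD(2)]
  have "C * A * (B * D) = C * ((A * B) * D)" "B * D * (C * A) = B * ((D * C) * A)"
    by (simp_all add: mat_assoc)
  then have "C * A * (B * D) = 1\<^sub>m (fst L)" "B * D * (C * A) = 1\<^sub>m (fst M)"
    by (simp_all add: AB CD mat_one_l)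
  then show ?thesis unfolding pair_iso_def
    using pair_hom_comp[OF AB(1) CD(1)] pair_hom_comp[OF CD(2) AB(2)] assms by blast
qed

abbreviation "miso \<equiv> fd_module_iso (taft_algebra n q) (taft_scalar n q)"
abbreviation "iclasses \<equiv> iso_classes (taft_algebra n q) (taft_scalar n q)"
abbreviation "icls \<equiv> iso_class (taft_algebra n q) (taft_scalar n q)"

lemma equiv_iso: "equiv mods miso"
proof (rule equivI)
  show "miso \<subseteq> mods \<times> mods" by (auto simp: iso_iff_pair_iso)
  show "refl_on mods miso" by (rule refl_onI) (auto simp: iso_iff_pair_iso pair_of_taft_pair pair_iso_refl)
  show "sym miso" by (rule symI) (auto simp: iso_iff_pair_iso pair_iso_sym)
  show "trans miso" by (rule transI) (meson iso_iff_pair_iso pair_of_taft_pair pair_iso_trans)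
qed

lemma icls_eq_iff: "M \<in> mods \<Longrightarrow> N \<in> mods \<Longrightarrow> icls M = icls N \<longleftrightarrow> pair_iso (pair_of M) (pair_of N)"
  unfolding iso_class_def using eq_equiv_class_iff[OF equiv_iso] by (simp add: iso_iff_pair_iso)

lemma iclasses_iff: "C \<in> iclasses \<longleftrightarrow> (\<exists>M\<in>mods. C = icls M)"
  by (auto simp: iso_classes_def iso_class_def quotient_def)

lemma mem_icls: "M \<in> mods \<Longrightarrow> N \<in> icls M \<longleftrightarrow> N \<in> mods \<and> icls N = icls M"
  using icls_eq_iff[of M N] by (auto simp: iso_class_def iso_iff_pair_iso)

lemma mem_iclsD:
  assumes "M \<in> mods" "N \<in> icls M" shows "N \<in> mods" "pair_iso (pair_of N) (pair_of M)"
  using assms mem_icls[OF assms(1), of N] icls_eq_iff[of N M] by auto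

lemma iso_class_mult_icls:
  assumes "M \<in> mods" "N \<in> mods"
  shows "iso_class_mult (taft_algebra n q) (taft_scalar n q) tens (icls M) (icls N) = icls (tens M N)"
proof -
  have "icls (tens M' N') = icls (tens M N)" if "M' \<in> icls M" "N' \<in> icls N" for M' N'
  proof -
    have m: "M' \<in> mods" "N' \<in> mods" "pair_iso (pair_of M') (pair_of M)" "pair_iso (pair_of N') (pair_of N)"
      using that assms mem_iclsD by blast+
    show ?thesis
      using m assms by (simp add: icls_eq_iff tensor_mods pair_tensor_pair_iso pair_of_taft_pair)
  qed
  moreover have "M \<in> icls M" "N \<in> icls N" using assms by (simp_all add: mem_icls)
  ultimately show ?thesis unfolding iso_class_mult_def by blast
qed

text \<open>The choice of a representative is immaterial by \<open>class_mult_icls\<close>.\<close>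

definition class_mult :: "nat \<Rightarrow> nat \<Rightarrow> ('k free_alg set, 'k) iso_class \<Rightarrow> int" where
  "class_mult l i C = chain_mult l i (pair_of (SOME M. M \<in> C))"

lemma class_mult_icls: assumes "M \<in> mods" shows "class_mult l i (icls M) = chain_mult l i (pair_of M)"
proof -
  have "M \<in> icls M" using assms by (simp add: mem_icls)
  then have "(SOME N. N \<in> icls M) \<in> icls M" by (rule someI)
  note h = mem_iclsD[OF assms this]
  show ?thesis unfolding class_mult_def by (intro chain_mult_pair_iso pair_of_taft_pair assms h)
qed

definition coef :: "nat \<Rightarrow> nat \<Rightarrow> (('k free_alg set, 'k) iso_class \<Rightarrow>\<^sub>0 int) \<Rightarrow> int" where
  "coef l i a = (\<Sum>C\<in>Poly_Mapping.keys a. Poly_Mapping.lookup a C * class_mult l i C)"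

lemma coef_add: "coef l i (a + b) = coef l i a + coef l i b"
  unfolding coef_def
  using setsum_keys_plus_distrib[of "\<lambda>C x. x * class_mult l i C" a b] by (simp add: distrib_right)

lemma coef_single: "coef l i (Poly_Mapping.single C c) = c * class_mult l i C"
  by (simp add: coef_def)

lemma coef_zero: "coef l i 0 = 0" by (simp add: coef_def)

definition green_poly :: "(('k free_alg set, 'k) iso_class \<Rightarrow>\<^sub>0 int) \<Rightarrow> int poly poly" where
  "green_poly a = (\<Sum>l=1..n. \<Sum>i<n. of_int (coef l i a) * (y_var ^ i * f_poly l))"

lemma green_poly_add: "green_poly (a + b) = green_poly a + green_poly b"
  by (simp add: green_poly_def coef_add distrib_right sum.distrib)

lemma green_poly_diff: "green_poly (a - b) = green_poly a - green_poly b"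
  using green_poly_add[of "a - b" b] by simp

lemma green_poly_zero: "green_poly 0 = 0" by (simp add: green_poly_def coef_zero)

lemma green_poly_sum: "green_poly (sum g S) = (\<Sum>x\<in>S. green_poly (g x))"
  by (induction S rule: infinite_finite_induct) (simp_all add: green_poly_zero green_poly_add)

lemma green_poly_icls: "M \<in> mods \<Longrightarrow> green_poly (Poly_Mapping.single (icls M) c) =
  of_int c * pair_poly (pair_of M)"
  by (simp add: green_poly_def pair_poly_def coef_single class_mult_icls sum_distrib_left mult.assoc)

abbreviation "IR \<equiv> iso_class_ring (taft_algebra n q) (taft_scalar n q) tens taft_trivial_module"

lemma IR_simps: "carrier IR = {a. Poly_Mapping.keys a \<subseteq> iclasses}" "a \<oplus>\<^bsub>IR\<^esub> b = a + b"
  "\<one>\<^bsub>IR\<^esub> = Poly_Mapping.single (icls taft_trivial_module) 1" "\<zero>\<^bsub>IR\<^esub> = 0"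
  by (simp_all add: iso_class_ring_def)

lemma IR_carrier_closed:
  shows "a \<in> carrier IR \<Longrightarrow> b \<in> carrier IR \<Longrightarrow> a + b \<in> carrier IR"
    "a \<in> carrier IR \<Longrightarrow> - a \<in> carrier IR" "a \<in> carrier IR \<Longrightarrow> b \<in> carrier IR \<Longrightarrow> a - b \<in> carrier IR"
    "0 \<in> carrier IR" "M \<in> mods \<Longrightarrow> Poly_Mapping.single (icls M) c \<in> carrier IR"
    "(\<And>x. x \<in> S \<Longrightarrow> g x \<in> carrier IR) \<Longrightarrow> sum g S \<in> carrier IR"
proof -
  have add: "a + b \<in> carrier IR" if "a \<in> carrier IR" "b \<in> carrier IR" for a b
    using that keys_add[of a b] by (auto simp: IR_simps)
  then show "a \<in> carrier IR \<Longrightarrow> b \<in> carrier IR \<Longrightarrow> a + b \<in> carrier IR" .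
  show neg: "a \<in> carrier IR \<Longrightarrow> - a \<in> carrier IR" for a by (simp add: IR_simps)
  show "a \<in> carrier IR \<Longrightarrow> b \<in> carrier IR \<Longrightarrow> a - b \<in> carrier IR"
    using add[of a "- b"] neg[of b] by simp
  show zero: "0 \<in> carrier IR" by (simp add: IR_simps)
  show "M \<in> mods \<Longrightarrow> Poly_Mapping.single (icls M) c \<in> carrier IR"
    by (auto simp: IR_simps iclasses_iff split: if_splits)
  show "(\<And>x. x \<in> S \<Longrightarrow> g x \<in> carrier IR) \<Longrightarrow> sum g S \<in> carrier IR"
    by (induction S rule: infinite_finite_induct) (auto intro: add zero)
qed

lemma green_poly_expand: "green_poly a = (\<Sum>C\<in>Poly_Mapping.keys a. green_poly (Poly_Mapping.single C
  (Poly_Mapping.lookup a C)))"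
  using green_poly_sum[of "\<lambda>C. Poly_Mapping.single C (Poly_Mapping.lookup a C)" "Poly_Mapping.keys a"]
  by (simp add: poly_mapping_sum_singles)

lemma eqv_sum: "(\<And>x. x \<in> S \<Longrightarrow> f x \<approx> g x) \<Longrightarrow> sum f S \<approx> sum g S"
  by (induction S rule: infinite_finite_induct) (auto intro: eqv_refl eqv_add)

text \<open>By biadditivity this reduces to classes of modules, where it is \<open>pair_poly_pair_tensor\<close>.\<close>

lemma IR_mult:
  assumes "a \<in> carrier IR" "b \<in> carrier IR"
  shows "a \<otimes>\<^bsub>IR\<^esub> b \<in> carrier IR" "green_poly (a \<otimes>\<^bsub>IR\<^esub> b) \<approx> green_poly a * green_poly b"
proof -
  let ?m = "iso_class_mult (taft_algebra n q) (taft_scalar n q) tens"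
  have prod: "a \<otimes>\<^bsub>IR\<^esub> b = (\<Sum>C\<in>Poly_Mapping.keys a. \<Sum>D\<in>Poly_Mapping.keys b.
      Poly_Mapping.single (?m C D) (Poly_Mapping.lookup a C * Poly_Mapping.lookup b D))"
    by (simp add: iso_class_ring_def)
  have cl: "\<exists>M\<in>mods. C = icls M" if "C \<in> Poly_Mapping.keys a \<or> C \<in> Poly_Mapping.keys b" for C
    using that assms by (auto simp: IR_simps iclasses_iff[symmetric])
  show "a \<otimes>\<^bsub>IR\<^esub> b \<in> carrier IR" unfolding prod
  proof (intro IR_carrier_closed(6))
    fix C D assume "C \<in> Poly_Mapping.keys a" "D \<in> Poly_Mapping.keys b"
    then obtain M N where "M \<in> mods" "N \<in> mods" "C = icls M" "D = icls N" using cl by meson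
    then show "Poly_Mapping.single (?m C D) (Poly_Mapping.lookup a C * Poly_Mapping.lookup b D) \<in> carrier IR"
      by (simp add: iso_class_mult_icls IR_carrier_closed(5) tensor_mods)
  qed
  have "green_poly (a \<otimes>\<^bsub>IR\<^esub> b) = (\<Sum>C\<in>Poly_Mapping.keys a. \<Sum>D\<in>Poly_Mapping.keys b.
      green_poly (Poly_Mapping.single (?m C D) (Poly_Mapping.lookup a C * Poly_Mapping.lookup b D)))"
    by (simp add: prod green_poly_sum)
  also have "\<dots> \<approx> (\<Sum>C\<in>Poly_Mapping.keys a. \<Sum>D\<in>Poly_Mapping.keys b.
      green_poly (Poly_Mapping.single C (Poly_Mapping.lookup a C)) * green_poly (Poly_Mapping.single D
        (Poly_Mapping.lookup b D)))"
  proof (intro eqv_sum)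
    fix C D assume "C \<in> Poly_Mapping.keys a" "D \<in> Poly_Mapping.keys b"
    then obtain M N where MN: "M \<in> mods" "N \<in> mods" "C = icls M" "D = icls N" using cl by meson
    define x y where "x = Poly_Mapping.lookup a C" and "y = Poly_Mapping.lookup b D"
    have "green_poly (Poly_Mapping.single (?m C D) (x * y)) =
      of_int (x * y) * pair_poly (pair_tensor (pair_of M) (pair_of N))"
      using MN by (simp add: iso_class_mult_icls green_poly_icls tensor_mods)
    also have "\<dots> \<approx> of_int (x * y) * (pair_poly (pair_of M) * pair_poly (pair_of N))"
      by (intro eqv_mult eqv_refl pair_poly_pair_tensor pair_of_taft_pair MN)
    also have "\<dots> = green_poly (Poly_Mapping.single C x) * green_poly (Poly_Mapping.single D y)"
      using MN by (simp add: green_poly_icls mult_ac)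
    finally show "green_poly (Poly_Mapping.single (?m C D) (x * y)) \<approx> green_poly (Poly_Mapping.single C
      x) * green_poly (Poly_Mapping.single D y)" .
  qed
  also have "\<dots> = green_poly a * green_poly b" by (simp add: green_poly_expand[of a] green_poly_expand[of
    b] sum_product)
  finally show "green_poly (a \<otimes>\<^bsub>IR\<^esub> b) \<approx> green_poly a * green_poly b" .
qed

lemma green_poly_one: "green_poly \<one>\<^bsub>IR\<^esub> = 1"
  by (simp add: IR_simps green_poly_icls trivial_mods pair_poly_unit[unfolded One_nat_def])

lemma group_IR: "group (add_monoid IR)"
proof (rule groupI)
  fix x assume "x \<in> carrier (add_monoid IR)"
  then show "\<exists>y\<in>carrier (add_monoid IR). y \<otimes>\<^bsub>add_monoid IR\<^esub> x = \<one>\<^bsub>add_monoid IR\<^esub>"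
    using IR_carrier_closed(2)[of x] by (intro bexI[of _ "- x"]) (simp_all add: IR_simps)
qed (use IR_carrier_closed(1,4) in \<open>auto simp: IR_simps add.assoc\<close>)

definition relator_group :: "(('k free_alg set, 'k) iso_class \<Rightarrow>\<^sub>0 int) set" where
  "relator_group = generate (add_monoid IR) (green_relators (taft_algebra n q) (taft_scalar n q))"

lemma relator: "M \<in> mods \<Longrightarrow> N \<in> mods \<Longrightarrow>
  Poly_Mapping.single (icls (fd_module_dsum M N)) 1 - Poly_Mapping.single (icls M) 1
    - Poly_Mapping.single (icls N) 1 \<in> relator_group"
  unfolding relator_group_def by (rule generate.incl) (unfold green_relators_def, blast)

lemma relators_carrier: "green_relators (taft_algebra n q) (taft_scalar n q) \<subseteq> carrier (add_monoid IR)"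
proof
  fix a assume "a \<in> green_relators (taft_algebra n q) (taft_scalar n q)"
  then obtain M N where MN: "M \<in> mods" "N \<in> mods" and a: "a = Poly_Mapping.single (icls (fd_module_dsum M N)) 1
      - Poly_Mapping.single (icls M) 1 - Poly_Mapping.single (icls N) 1"
    unfolding green_relators_def by blast
  have "a \<in> carrier IR" unfolding a by (intro IR_carrier_closed(3,5) dsum_mods MN)
  then show "a \<in> carrier (add_monoid IR)" by simp
qed

lemma subgroup_relator_group: "subgroup relator_group (add_monoid IR)"
  unfolding relator_group_def by (rule group.generate_is_subgroup[OF group_IR relators_carrier])

lemma inv_IR: "a \<in> carrier IR \<Longrightarrow> inv\<^bsub>add_monoid IR\<^esub> a = - a"
  using group.inv_equality[OF group_IR, of "- a" a] IR_carrier_closed(2)[of a] by (simp add: IR_simps)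

lemma relator_group_closed: "relator_group \<subseteq> carrier IR" "0 \<in> relator_group" "a \<in> relator_group \<Longrightarrow>
  b \<in> relator_group \<Longrightarrow> a + b \<in> relator_group"
  "a \<in> relator_group \<Longrightarrow> - a \<in> relator_group" "a \<in> relator_group \<Longrightarrow> b \<in> relator_group \<Longrightarrow> a - b \<in> relator_group"
proof -
  show sub: "relator_group \<subseteq> carrier IR" using subgroup.subset[OF subgroup_relator_group] by simp
  show "0 \<in> relator_group" using subgroup.one_closed[OF subgroup_relator_group] by (simp add: IR_simps)
  show add: "a \<in> relator_group \<Longrightarrow> b \<in> relator_group \<Longrightarrow> a + b \<in> relator_group" for a b
    using subgroup.m_closed[OF subgroup_relator_group, of a b] by (simp add: IR_simps)
  show neg: "a \<in> relator_group \<Longrightarrow> - a \<in> relator_group" for a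
    using subgroup.m_inv_closed[OF subgroup_relator_group, of a] inv_IR[of a] sub by auto
  show "a \<in> relator_group \<Longrightarrow> b \<in> relator_group \<Longrightarrow> a - b \<in> relator_group" using add[of a "- b"] neg[of b] by simp
qed

lemma green_poly_relator_group:
  assumes "a \<in> relator_group" shows "green_poly a = 0"
proof -
  have rel: "green_poly a = 0" if "a \<in> green_relators (taft_algebra n q) (taft_scalar n q)" for a
  proof -
    obtain M N where MN: "M \<in> mods" "N \<in> mods" and a: "a = Poly_Mapping.single (icls (fd_module_dsum M N)) 1
        - Poly_Mapping.single (icls M) 1 - Poly_Mapping.single (icls N) 1"
      using \<open>a \<in> _\<close> by (auto simp: green_relators_def)
    note d = dsum_mods[OF MN]
    have "pair_poly (pair_of (fd_module_dsum M N)) = pair_poly (pair_of M) + pair_poly (pair_of N)"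
      by (rule pair_poly_biprod) (use pair_dsum_biprod[of "pair_of M" "pair_of N"] pair_of_taft_pair[OF
        d(1)] d(2) MN pair_of_taft_pair in auto)
    then show ?thesis using MN d(1) by (simp add: a green_poly_diff green_poly_icls)
  qed
  show ?thesis using assms unfolding relator_group_def
  proof (induction rule: generate.induct)
    case one
    then show ?case by (simp add: IR_simps green_poly_zero)
  next
    case (incl h)
    then show ?case by (rule rel)
  next
    case (inv h)
    then have "inv\<^bsub>add_monoid IR\<^esub> h = 0 - h" using relators_carrier by (subst inv_IR) auto
    then show ?case using rel[OF inv] by (simp only: green_poly_diff green_poly_zero)
  next
    case (eng h1 h2)
    then show ?case by (simp add: IR_simps green_poly_add)
  qed
qed

definition chain_module :: "nat \<Rightarrow> nat \<Rightarrow> ('k free_alg set, 'k) fd_module" where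
  "chain_module l i = (SOME M. M \<in> mods \<and> pair_of M = chain l i)"

lemma chain_module: assumes "l \<le> n" shows "chain_module l i \<in> mods" "pair_of (chain_module l i) = chain l i"
proof -
  have "\<exists>M. M \<in> mods \<and> pair_of M = chain l i" using pair_of_surj[OF chain_taft_pair[OF assms]] by metis
  then have "chain_module l i \<in> mods \<and> pair_of (chain_module l i) = chain l i"
    unfolding chain_module_def by (rule someI_ex)
  then show "chain_module l i \<in> mods" "pair_of (chain_module l i) = chain l i" by auto
qed

text \<open>The combination of classes of chains to which \<open>a\<close> is congruent modulo the relators.\<close>

definition chain_form :: "(('k free_alg set, 'k) iso_class \<Rightarrow>\<^sub>0 int) \<Rightarrow> (('k free_alg set, 'k) iso_class
  \<Rightarrow>\<^sub>0 int)" where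
  "chain_form a = (\<Sum>l=1..n. \<Sum>i<n. Poly_Mapping.single (icls (chain_module l i)) (coef l i a))"

lemma chain_form_add: "chain_form (a + b) = chain_form a + chain_form b"
  by (simp add: chain_form_def coef_add single_add sum.distrib)

lemma chain_form_diff: "chain_form (a - b) = chain_form a - chain_form b"
  using chain_form_add[of "a - b" b] by (simp add: eq_diff_eq)

lemma chain_form_icls:
  "M \<in> mods \<Longrightarrow> chain_form (Poly_Mapping.single (icls M) 1) =
    (\<Sum>l=1..n. \<Sum>i<n. Poly_Mapping.single (icls (chain_module l i)) (chain_mult l i (pair_of M)))"
  by (simp add: chain_form_def coef_single class_mult_icls)

text \<open>Induction on the decomposition of \<open>M\<close> into chains. A module of dimension \<open>0\<close> is isomorphic to its
  direct sum with itself, so its class is a relator up to sign.\<close>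

lemma single_minus_chain_form:
  assumes "M \<in> mods"
  shows "Poly_Mapping.single (icls M) 1 - chain_form (Poly_Mapping.single (icls M) 1) \<in> relator_group"
proof -
  have "P = pair_of M \<Longrightarrow> M \<in> mods \<Longrightarrow> Poly_Mapping.single (icls M) 1 - chain_form (Poly_Mapping.single
    (icls M) 1) \<in> relator_group"
    if "P \<in> taft_pairs" for P M
    using that
  proof (induction P arbitrary: M rule: taft_pair_induct)
    case zero
    have "pair_of (fd_module_dsum M M) = zero_pair"
      using zero pair_of_taft_pair[OF dsum_mods(1)[of M M]] dsum_mods(2)[of M M]
      by (intro zero_dim_pair) (auto simp: zero_pair_def simp flip: zero(1))
    then have "icls (fd_module_dsum M M) = icls M"
      using zero dsum_mods(1)[of M M] by (simp add: icls_eq_iff pair_iso_refl zero_taft_pair flip: zero(1))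
    then have "- Poly_Mapping.single (icls M) 1 \<in> relator_group" using relator[OF zero(2,2)] by simp
    then have "Poly_Mapping.single (icls M) 1 \<in> relator_group" using relator_group_closed(4) by fastforce
    moreover have "chain_form (Poly_Mapping.single (icls M) 1) = 0"
      using zero by (simp add: chain_form_icls chain_mult_zero_pair flip: zero(1))
    ultimately show ?case by simp
  next
    case (step l i U S)
    obtain N where N: "N \<in> mods" "pair_of N = U" using pair_of_surj[OF step(4)] .
    note B = chain_module[OF step(2), of i]
    let ?B = "chain_module l i"
    note D = dsum_mods[OF B(1) N(1)]
    have "pair_iso (pair_of M) (pair_dsum (chain l i) U)"
      using biprod_iso_pair_dsum[OF step(6) chain_taft_pair[OF step(2)] step(4,5)] step(8) by simp
    then have iM: "icls M = icls (fd_module_dsum ?B N)"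
      using step(9) D by (simp add: icls_eq_iff B N)
    have mS: "chain_mult l' i' (pair_of M) = chain_mult l' i' (pair_of ?B) + chain_mult l' i' (pair_of
      N)" for l' i'
      using chain_mult_biprod[OF step(6) chain_taft_pair[OF step(2)] step(4,5)] step(8) by (simp add: B N)
    have cM: "chain_form (Poly_Mapping.single (icls M) 1) =
        chain_form (Poly_Mapping.single (icls ?B) 1) + chain_form (Poly_Mapping.single (icls N) 1)"
      using step(9) B(1) N(1) by (simp add: chain_form_icls mS single_add sum.distrib)
    have cB: "chain_form (Poly_Mapping.single (icls ?B) 1) = Poly_Mapping.single (icls ?B) 1"
    proof -
      have "chain_form (Poly_Mapping.single (icls ?B) 1) =
          (\<Sum>l'=1..n. \<Sum>i'<n. if i' = i then if l' = l then Poly_Mapping.single (icls ?B) 1 else 0 else 0)"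
        unfolding chain_form_icls[OF B(1)]
        by (intro sum.cong refl) (use step(1-3) in \<open>auto simp: B chain_mult_chain\<close>)
      then show ?thesis using step(1-3) by simp
    qed
    have "Poly_Mapping.single (icls N) 1 - chain_form (Poly_Mapping.single (icls N) 1) \<in> relator_group"
      using step(7)[of N] N by simp
    from relator_group_closed(3)[OF relator[OF B(1) N(1)] this]
    show ?case by (simp only: cM cB) (simp add: iM algebra_simps)
  qed
  from this[OF pair_of_taft_pair[OF assms] refl assms] show ?thesis .
qed

lemma minus_chain_form_relator_group:
  assumes "a \<in> carrier IR" shows "a - chain_form a \<in> relator_group"
proof -
  have "Poly_Mapping.keys a \<subseteq> iclasses" using assms by (simp add: IR_simps)
  then show ?thesis
  proof (induction rule: frag_induction)
    case zero
    show ?case using relator_group_closed(2) by (simp add: chain_form_def coef_zero)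
  next
    case (one C)
    then show ?case using single_minus_chain_form by (auto simp: iclasses_iff)
  next
    case (diff a b)
    have e: "(a - b) - chain_form (a - b) = (a - chain_form a) - (b - chain_form b)"
      by (simp add: chain_form_diff)
    show ?case unfolding e by (rule relator_group_closed(5)[OF diff])
  qed
qed

text \<open>If the image is \<open>0\<close>, all coefficients of the chains vanish by linear independence of the \<open>y\<^sup>i f\<^sub>l\<close>,
  so \<open>a\<close> is congruent to \<open>0\<close> modulo the relators.\<close>

lemma green_poly_kernel:
  assumes "a \<in> carrier IR" "green_poly a \<approx> 0" shows "a \<in> relator_group"
proof -
  have "green_poly a \<in> green_ideal n" using assms(2) by (simp add: eqv_def)
  then have "coef l i a = 0" if "1 \<le> l" "l \<le> n" "i < n" for l i
    using green_basis_independent[where n = n and c = "\<lambda>l i. coef l i a" and l = l and i =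
      i] that unfolding green_poly_def by blast
  then have "chain_form a = 0" by (simp add: chain_form_def)
  then show ?thesis using minus_chain_form_relator_group[OF assms(1)] by simp
qed

text \<open>The image is closed under the ring operations and contains \<open>1\<close>, \<open>y\<close> and \<open>z\<close>.\<close>

lemma green_poly_surj: "\<exists>a\<in>carrier IR. green_poly a \<approx> r"
proof -
  define S where "S = {r. \<exists>a\<in>carrier IR. green_poly a \<approx> r}"
  have SI: "r \<in> S" if "a \<in> carrier IR" "green_poly a \<approx> r" for a r using that by (auto simp: S_def)
  have add: "r + s \<in> S" if "r \<in> S" "s \<in> S" for r s
  proof -
    obtain a b where "a \<in> carrier IR" "green_poly a \<approx> r" "b \<in> carrier IR" "green_poly b \<approx> s"
      using \<open>r \<in> S\<close> \<open>s \<in> S\<close> by (auto simp: S_def)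
    then show ?thesis by (intro SI[of "a + b"] IR_carrier_closed) (auto simp: green_poly_add intro: eqv_add)
  qed
  have diff: "r - s \<in> S" if "r \<in> S" "s \<in> S" for r s
  proof -
    obtain a b where "a \<in> carrier IR" "green_poly a \<approx> r" "b \<in> carrier IR" "green_poly b \<approx> s"
      using \<open>r \<in> S\<close> \<open>s \<in> S\<close> by (auto simp: S_def)
    then show ?thesis by (intro SI[of "a - b"] IR_carrier_closed) (auto simp: green_poly_diff intro: eqv_diff)
  qed
  have mult: "r * s \<in> S" if "r \<in> S" "s \<in> S" for r s
  proof -
    obtain a b where ab: "a \<in> carrier IR" "green_poly a \<approx> r" "b \<in> carrier IR" "green_poly b \<approx> s"
      using \<open>r \<in> S\<close> \<open>s \<in> S\<close> by (auto simp: S_def)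
    show ?thesis
      by (rule SI[OF IR_mult(1)[OF ab(1,3)]]) (rule eqv_trans[OF IR_mult(2)[OF ab(1,3)] eqv_mult[OF ab(2,4)]])
  qed
  have gen: "pair_poly (chain l i) \<in> S" if "l \<le> n" for l i
    by (rule SI[of "Poly_Mapping.single (icls (chain_module l i)) 1"])
      (use chain_module[OF that] in \<open>simp_all add: IR_carrier_closed green_poly_icls eqv_refl\<close>)
  have one: "1 \<in> S" and y: "y_var \<in> S" and z: "z_var \<in> S"
    using gen[of 1 0] gen[of 1 1] gen[of 2 0] n2 by (simp_all add: pair_poly_unit[unfolded One_nat_def]
      pair_poly_y[unfolded One_nat_def] pair_poly_chain_2)
  have zero: "0 \<in> S" using diff[OF one one] by simp
  have int: "of_int c \<in> S" for c
  proof (induction c rule: int_induct[of _ 0])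
    case base then show ?case by (simp add: zero)
  next
    case (step1 i) then show ?case using add[OF _ one, of "of_int i"] by simp
  next
    case (step2 i) then show ?case using diff[OF _ one, of "of_int i"] by simp
  qed
  have const: "[:a:] \<in> S" for a
  proof (induction a)
    case 0 then show ?case by (simp add: zero)
  next
    case (pCons c a)
    have "[:pCons c a:] = of_int c + y_var * [:a:]" by (simp add: y_var_def of_int_poly)
    then show ?case using add[OF int mult[OF y pCons(2)]] by simp
  qed
  have "r \<in> S"
  proof (induction r)
    case 0 then show ?case by (simp add: zero)
  next
    case (pCons a r)
    have "pCons a r = [:a:] + z_var * r" by (simp add: z_var_def)
    then show ?case using add[OF const mult[OF z pCons(2)]] by simp
  qed
  then show ?thesis by (simp add: S_def)
qed

abbreviation "poly_coset r \<equiv> green_ideal n +>\<^bsub>ring_of_type_algebra\<^esub> r"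

lemma poly_coset_eq_iff: "poly_coset r = poly_coset s \<longleftrightarrow> r \<approx> s"
  by (simp add: coset_eq_iff[OF green_ideal_ideal] eqv_def)

text \<open>All elements of a coset of the relators have the same image, which \<open>the_elem\<close> extracts.\<close>

definition green_map :: "(('k free_alg set, 'k) iso_class \<Rightarrow>\<^sub>0 int) set \<Rightarrow> int poly poly set" where
  "green_map A = the_elem ((\<lambda>a. poly_coset (green_poly a)) ` A)"

lemma green_map_eq:
  assumes "A \<noteq> {}" "\<And>a. a \<in> A \<Longrightarrow> green_poly a \<approx> r" shows "green_map A = poly_coset r"
proof -
  have "poly_coset (green_poly a) = poly_coset r" if "a \<in> A" for a using assms(2)[OF that]
    by (simp add: poly_coset_eq_iff)
  then have "(\<lambda>a. poly_coset (green_poly a)) ` A = {poly_coset r}" using assms(1) by auto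
  then show ?thesis by (simp add: green_map_def)
qed

abbreviation "green_coset a \<equiv> relator_group +>\<^bsub>IR\<^esub> a"

lemma green_coset_green_poly: "x \<in> green_coset a \<Longrightarrow> green_poly x = green_poly a"
  by (auto simp: iso_class_ring_coset green_poly_add green_poly_relator_group)

lemma green_coset_self: "a \<in> green_coset a"
  using relator_group_closed(2) by (auto simp: iso_class_ring_coset intro!: exI[of _ 0])

lemma green_coset_carrier: "a \<in> carrier IR \<Longrightarrow> x \<in> green_coset a \<Longrightarrow> x \<in> carrier IR"
  using relator_group_closed(1) by (auto simp: iso_class_ring_coset intro: IR_carrier_closed(1))

lemma green_map_coset: "green_map (green_coset a) = poly_coset (green_poly a)"
  by (rule green_map_eq) (use green_coset_self green_coset_green_poly in \<open>auto simp: eqv_refl\<close>)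

lemma green_ring_simps:
  "carrier (taft_green_ring n q) = green_coset ` carrier IR"
  "A \<otimes>\<^bsub>taft_green_ring n q\<^esub> B = (\<Union>a\<in>A. \<Union>b\<in>B. green_coset (a \<otimes>\<^bsub>IR\<^esub> b))"
  "A \<oplus>\<^bsub>taft_green_ring n q\<^esub> B = {a + b | a b. a \<in> A \<and> b \<in> B}"
  "\<one>\<^bsub>taft_green_ring n q\<^esub> = green_coset \<one>\<^bsub>IR\<^esub>"
  unfolding taft_green_ring_def green_ring_def relator_group_def[symmetric] FactRing_def
  by (auto simp: A_RCOSETS_defs a_r_coset_def rcoset_mult_def set_add_defs IR_simps)

lemma green_map_ring_hom:
  "green_map \<in> Ring.ring_hom (taft_green_ring n q) (ring_of_type_algebra Quot green_ideal n)"
proof (rule ring_hom_memI)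
  note Q = quotient_simps[OF green_ideal_ideal]
  show "green_map A \<in> carrier (ring_of_type_algebra Quot green_ideal n)"
    if "A \<in> carrier (taft_green_ring n q)" for A
    using that by (auto simp: green_ring_simps Q(1) green_map_coset)
  fix A B assume "A \<in> carrier (taft_green_ring n q)" "B \<in> carrier (taft_green_ring n q)"
  then obtain a b where ab: "a \<in> carrier IR" "b \<in> carrier IR" "A = green_coset a" "B = green_coset b"
    by (auto simp: green_ring_simps)
  have "green_map (A \<otimes>\<^bsub>taft_green_ring n q\<^esub> B) = poly_coset (green_poly a * green_poly b)"
  proof (rule green_map_eq)
    show "A \<otimes>\<^bsub>taft_green_ring n q\<^esub> B \<noteq> {}"
      unfolding green_ring_simps(2) ab(3,4) using green_coset_self by blast
    fix x assume "x \<in> A \<otimes>\<^bsub>taft_green_ring n q\<^esub> B"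
    then obtain a' b' where h: "a' \<in> green_coset a" "b' \<in> green_coset b" "x \<in> green_coset (a' \<otimes>\<^bsub>IR\<^esub> b')"
      unfolding green_ring_simps(2) ab(3,4) by blast
    have "green_poly x \<approx> green_poly a' * green_poly b'"
      unfolding green_coset_green_poly[OF h(3)] by (intro IR_mult green_coset_carrier[OF ab(1) h(1)]
        green_coset_carrier[OF ab(2) h(2)])
    then show "green_poly x \<approx> green_poly a * green_poly b" by (simp add: green_coset_green_poly[OF h(1)]
      green_coset_green_poly[OF h(2)])
  qed
  then show "green_map (A \<otimes>\<^bsub>taft_green_ring n q\<^esub> B) =
      green_map A \<otimes>\<^bsub>ring_of_type_algebra Quot green_ideal n\<^esub> green_map B"
    by (simp add: ab Q(3) green_map_coset)
  have "green_map (A \<oplus>\<^bsub>taft_green_ring n q\<^esub> B) = poly_coset (green_poly a + green_poly b)"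
  proof (rule green_map_eq)
    show "A \<oplus>\<^bsub>taft_green_ring n q\<^esub> B \<noteq> {}"
      unfolding green_ring_simps(3) ab(3,4) using green_coset_self by blast
    fix x assume "x \<in> A \<oplus>\<^bsub>taft_green_ring n q\<^esub> B"
    then obtain a' b' where h: "a' \<in> green_coset a" "b' \<in> green_coset b" "x = a' + b'"
      unfolding green_ring_simps(3) ab(3,4) by blast
    then show "green_poly x \<approx> green_poly a + green_poly b"
      by (simp add: green_poly_add green_coset_green_poly eqv_refl)
  qed
  then show "green_map (A \<oplus>\<^bsub>taft_green_ring n q\<^esub> B) =
      green_map A \<oplus>\<^bsub>ring_of_type_algebra Quot green_ideal n\<^esub> green_map B"
    by (simp add: ab Q(2) green_map_coset)
next
  show "green_map \<one>\<^bsub>taft_green_ring n q\<^esub> = \<one>\<^bsub>ring_of_type_algebra Quot green_ideal n\<^esub>"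
    by (simp add: green_ring_simps(4) green_map_coset green_poly_one quotient_simps(4)[OF green_ideal_ideal])
qed

lemma green_map_bij:
  "bij_betw green_map (carrier (taft_green_ring n q)) (carrier (ring_of_type_algebra Quot green_ideal n))"
  unfolding bij_betw_def
proof
  show "inj_on green_map (carrier (taft_green_ring n q))"
  proof (rule inj_onI)
    fix A B assume "A \<in> carrier (taft_green_ring n q)" "B \<in> carrier (taft_green_ring n q)" and eq:
      "green_map A = green_map B"
    then obtain a b where ab: "a \<in> carrier IR" "b \<in> carrier IR" "A = green_coset a" "B = green_coset b"
      by (auto simp: green_ring_simps)
    have "green_poly a \<approx> green_poly b" using eq by (simp add: ab green_map_coset poly_coset_eq_iff)
    then have "green_poly (a - b) \<approx> 0" using eqv_diff[of "green_poly a" "green_poly b" "green_poly b"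
      "green_poly b"] by (simp add: green_poly_diff eqv_refl)
    then have k: "a - b \<in> relator_group" by (intro green_poly_kernel IR_carrier_closed ab)
    have "x - a \<in> relator_group \<longleftrightarrow> x - b \<in> relator_group" for x
      using relator_group_closed(3)[OF _ k, of "x - a"] relator_group_closed(5)[OF _ k, of "x - b"]
        by (auto simp: algebra_simps)
    moreover have "green_coset c = {x. x - c \<in> relator_group}" for c
      by (auto simp: iso_class_ring_coset intro!: exI[of _ "_ - c"])
    ultimately show "A = B" by (simp add: ab)
  qed
  show "green_map ` carrier (taft_green_ring n q) = carrier (ring_of_type_algebra Quot green_ideal n)"
  proof
    show "green_map ` carrier (taft_green_ring n q) \<subseteq> carrier (ring_of_type_algebra Quot green_ideal n)"
      using ring_hom_closed[OF green_map_ring_hom] by blast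
    show "carrier (ring_of_type_algebra Quot green_ideal n) \<subseteq> green_map ` carrier (taft_green_ring n q)"
    proof
      fix x assume "x \<in> carrier (ring_of_type_algebra Quot green_ideal n)"
      then obtain r where r: "x = poly_coset r" by (auto simp: quotient_simps(1)[OF green_ideal_ideal])
      obtain a where "a \<in> carrier IR" "green_poly a \<approx> r" using green_poly_surj by blast
      then have "x = green_map (green_coset a)" "green_coset a \<in> carrier (taft_green_ring n q)"
        using eqv_sym[of "green_poly a" r] by (auto simp only: green_ring_simps(1) r green_map_coset
          poly_coset_eq_iff)
      then show "x \<in> green_map ` carrier (taft_green_ring n q)" by blast
    qed
  qed
qed

end

theorem theorem3p10:
  fixes n :: nat and q :: "'k::field"
  assumes "n \<ge> 2"
    and "primitive_root_of_unity n q"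
  shows "taft_green_ring n q \<simeq> (ring_of_type_algebra :: int poly poly ring) Quot green_ideal n"
proof -
  interpret taft_root n q by (unfold_locales) (use assms in auto)
  show ?thesis unfolding is_ring_iso_def ring_iso_def
    using green_map_ring_hom green_map_bij by blast
qed

end
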